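(* Let $(\mathbf A_i)_{i\ge1}$ be an iid sequence of $d\times d$ random matrices with generic element $\mathbf A\in\mathrm{RV}(\alpha,\mu^{\mathbf A})$ such that $$\lim_{M\to\infty}\limsup_{t\to\infty}\frac{\mathbb P(\|\mathbf A_1\|\,\|\mathbf A_2\|>t,\ M<\|\mathbf A_1\|\le t/M)}{\mathbb P(\|\mathbf A\|>t)}=0.$$ Then for every $n\ge2$, $$\frac{\mathbb P(\|\mathbf\Pi_n\|>t)}{\mathbb P(\|\mathbf A\|>t)}\to\sum_{k=1}^n\mathbb E\big[\|\mathbf\Pi_{k-1}\Theta_{\mathbf A_k}\mathbf\Pi_{k+1,n}\|^\alpha\big],\qquad t\to\infty.$$ Additionally, if $\mathbb P(\|\mathbf\Pi_{k-1}\Theta_{\mathbf A_k}\mathbf\Pi_{k+1,n}\|>0)>0$ for some $k\le n$, then $\mathbf\Pi_n$ is regularly varying and, as $t\to\infty$, $$\mathbb P\Big(\frac{\mathbf\Pi_n}{\|\mathbf\Pi_n\|}\in\cdot\,\Big|\,\|\mathbf\Pi_n\|>t\Big)\stackrel{w}{\to}\mathbb P(\Theta_{\mathbf\Pi_n}\in\cdot)=\sum_{k=1}^np_k\,\mathbb E\Big[\frac{\|\mathbf\Pi_{k-1}\Theta_{\mathbf A_k}\mathbf\Pi_{k+1,n}\|^\alpha}{\mathbb E[\|\mathbf\Pi_{k-1}\Theta_{\mathbf A_k}\mathbf\Pi_{k+1,n}\|^\alpha]}\,\mathbf 1\Big(\frac{\mathbf\Pi_{k-1}\Theta_{\mathbf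 A_k}\mathbf\Pi_{k+1,n}}{\|\mathbf\Pi_{k-1}\Theta_{\mathbf A_k}\mathbf\Pi_{k+1,n}\|}\in\cdot\Big)\Big],$$ where $$p_k=\frac{\mathbb E[\|\mathbf\Pi_{k-1}\Theta_{\mathbf A_k}\mathbf\Pi_{k+1,n}\|^\alpha]}{\sum_{j=1}^n\mathbb E[\|\mathbf\Pi_{j-1}\Theta_{\mathbf A_j}\mathbf\Pi_{j+1,n}\|^\alpha]},\qquad k=1,\dots,n.$$
   Context: The space of $d\times d$ real matrices is identified with $\mathbb R^{d^2}$ and equipped with a fixed norm $\|\cdot\|$. For measures on a punctured Euclidean space $\mathbb R^m\setminus\{\mathbf 0\}$, $\stackrel{v}{\to}$ is vague convergence (convergence of integrals of non-negative continuous functions with compact support in $\mathbb R^m\setminus\{\mathbf 0\}$). $\stackrel{w}{\to}$ denotes weak convergence. A random element $\mathbf X$ of a finite-dimensional normed space is regularly varying with index $\alpha>0$ and limit measure $\mu^{\mathbf X}$, written $\mathbf X\in\mathrm{RV}(\alpha,\mu^{\mathbf X})$, if $\mu^{\mathbf X}$ is a non-null Radon measure on the space without the origin such that $\mathbb P(t^{-1}\mathbf X\in\cdot)/\mathbb P(\|\mathbf X\|>t)\stackrel{v}{\to}\mu^{\mathbf X}(\cdot)$ as $t\to\infty$, and $\mu^{\mathbf X}(tA)=t^{-\alpha}\mu^{\mathbf X}(A)$ for all $t>0$ and Borel $A$. Its spectral distribution is the law of a random element $\Theta_{\mathbf X}$ of the unit sphere with $\mathbb P(\mathbf X/\|\mathbf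 X\|\in\cdot\mid\|\mathbf X\|>x)\stackrel{w}{\to}\mathbb P(\Theta_{\mathbf X}\in\cdot)$ as $x\to\infty$. $\mathbf\Pi_{i,j}=\mathbf A_i\mathbf A_{i+1}\cdots\mathbf A_j$ for $i\le j$ and $\mathbf\Pi_{i,j}=\mathrm{Id}_d$ (identity matrix) for $i>j$; $\mathbf\Pi_n=\mathbf\Pi_{1,n}$, so $\mathbf\Pi_0=\mathrm{Id}_d$. The $\Theta_{\mathbf A_k}$ are copies of $\Theta_{\mathbf A}$ independent of $(\mathbf A_i)$. Summands with $p_k=0$ are interpreted as $0$. *)

theory Defs
  imports "HOL-Probability.Probability"
begin

text \<open>
  All norms on a finite-dimensional space induce the same topology and Borel sets, so an arbitrary
  norm \<open>N\<close> is a function on a Euclidean space whose topology and \<open>borel\<close> are the library's.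
  The library norm itself is just one instance.  Nonnegativity follows from the three clauses.
\<close>

definition is_norm :: "('a::real_vector \<Rightarrow> real) \<Rightarrow> bool" where
  "is_norm N \<longleftrightarrow>
     (\<forall>x. N x = 0 \<longleftrightarrow> x = 0) \<and>
     (\<forall>c x. N (c *\<^sub>R x) = \<bar>c\<bar> * N x) \<and>
     (\<forall>x y. N (x + y) \<le> N x + N y)"

definition punctured_borel :: "'a::euclidean_space measure" where
  "punctured_borel = restrict_space borel (- {0})"

text \<open>
  On the locally compact, second countable space \<open>- {0}\<close>, the Radon measures are exactly the Borel
  measures that are finite on compact sets.
\<close>

definition radon_punctured :: "'a::euclidean_space measure \<Rightarrow> bool" where
  "radon_punctured \<mu> \<longleftrightarrow>
     sets \<mu> = sets punctured_borel \<and>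
     (\<forall>K. compact K \<and> K \<subseteq> - {0} \<longrightarrow> emeasure \<mu> K < \<infinity>)"

definition vague_conv ::
  "('t \<Rightarrow> 'a::euclidean_space measure) \<Rightarrow> 'a measure \<Rightarrow> 't filter \<Rightarrow> bool" where
  "vague_conv \<mu>s \<mu> F \<longleftrightarrow>
     (\<forall>f :: 'a \<Rightarrow> real.
        continuous_on (- {0}) f \<and> (\<forall>x. 0 \<le> f x) \<and>
        (\<exists>K. compact K \<and> K \<subseteq> - {0} \<and> (\<forall>x \<in> - {0} - K. f x = 0)) \<longrightarrow>
        ((\<lambda>t. \<integral>\<^sup>+x. ennreal (f x) \<partial>\<mu>s t) \<longlongrightarrow> (\<integral>\<^sup>+x. ennreal (f x) \<partial>\<mu>)) F)"

text \<open>The library's \<open>weak_conv_m\<close> covers only sequences of measures on the real line.\<close>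

definition weak_conv_filter ::
  "('t \<Rightarrow> 'a::topological_space measure) \<Rightarrow> 'a measure \<Rightarrow> 't filter \<Rightarrow> bool" where
  "weak_conv_filter \<mu>s \<mu> F \<longleftrightarrow>
     (\<forall>f :: 'a \<Rightarrow> real. continuous_on UNIV f \<and> bounded (range f) \<longrightarrow>
        ((\<lambda>t. \<integral>x. f x \<partial>\<mu>s t) \<longlongrightarrow> (\<integral>x. f x \<partial>\<mu>)) F)"

text \<open>
  If \<open>N (X \<omega>)\<close> were bounded by some \<open>t\<close>, the division by zero below would yield the null
  measure for large \<open>t\<close>, which \<open>regularly_varying\<close> excludes by requiring a non-null limit.
\<close>

definition tail_measure ::
  "('a::euclidean_space \<Rightarrow> real) \<Rightarrow> 'w measure \<Rightarrow> ('w \<Rightarrow> 'a) \<Rightarrow> real \<Rightarrow> 'a measure" where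
  "tail_measure N M X t =
     scale_measure (ennreal (1 / \<P>(\<omega> in M. N (X \<omega>) > t)))
       (restrict_space (distr M borel (\<lambda>\<omega>. X \<omega> /\<^sub>R t)) (- {0}))"

definition regularly_varying ::
  "('a::euclidean_space \<Rightarrow> real) \<Rightarrow> 'w measure \<Rightarrow> ('w \<Rightarrow> 'a) \<Rightarrow> real \<Rightarrow> 'a measure \<Rightarrow> bool" where
  "regularly_varying N M X \<alpha> \<mu> \<longleftrightarrow>
     \<alpha> > 0 \<and> X \<in> borel_measurable M \<and>
     radon_punctured \<mu> \<and> emeasure \<mu> (space \<mu>) \<noteq> 0 \<and>
     vague_conv (tail_measure N M X) \<mu> at_top \<and>
     (\<forall>t > 0. \<forall>A \<in> sets \<mu>.
        emeasure \<mu> ((\<lambda>x. t *\<^sub>R x) ` A) = ennreal (t powr (- \<alpha>)) * emeasure \<mu> A)"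

text \<open>
  The conditional law of \<open>X / N X\<close> given \<open>N X > t\<close>.
\<close>

definition cond_direction ::
  "('a::euclidean_space \<Rightarrow> real) \<Rightarrow> 'w measure \<Rightarrow> ('w \<Rightarrow> 'a) \<Rightarrow> real \<Rightarrow> 'a measure" where
  "cond_direction N M X t =
     distr (uniform_measure M {\<omega> \<in> space M. N (X \<omega>) > t}) borel (\<lambda>\<omega>. X \<omega> /\<^sub>R N (X \<omega>))"

text \<open>
  A law on the unit sphere is represented as a Borel probability measure on the whole space that is
  concentrated on the sphere; as the sphere is closed, weak convergence means the same in both.
\<close>

definition spectral_law ::
  "('a::euclidean_space \<Rightarrow> real) \<Rightarrow> 'w measure \<Rightarrow> ('w \<Rightarrow> 'a) \<Rightarrow> 'a measure \<Rightarrow> bool" where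
  "spectral_law N M X S \<longleftrightarrow>
     prob_space S \<and> sets S = sets borel \<and> emeasure S {x. N x = 1} = 1 \<and>
     weak_conv_filter (cond_direction N M X) S at_top"

text \<open>\<open>a i ** \<dots> ** a j\<close>, which is the identity \<open>mat 1\<close> for \<open>i > j\<close>.\<close>

definition mat_prod :: "(nat \<Rightarrow> real^'n^'n) \<Rightarrow> nat \<Rightarrow> nat \<Rightarrow> real^'n^'n" where
  "mat_prod a i j = foldr (**) (map a [i..<Suc j]) (mat 1)"

text \<open>\<open>\<Pi>\<^sub>k\<^sub>-\<^sub>1 \<Theta>\<^sub>k \<Pi>\<^sub>k\<^sub>+\<^sub>1\<^sub>,\<^sub>n\<close>; only used for \<open>k \<ge> 1\<close>.\<close>

definition repl_prod ::
  "(nat \<Rightarrow> 'w \<Rightarrow> real^'n^'n) \<Rightarrow> (nat \<Rightarrow> 'w \<Rightarrow> real^'n^'n) \<Rightarrow> nat \<Rightarrow> nat \<Rightarrow> 'w \<Rightarrow> real^'n^'n" where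
  "repl_prod A \<theta> n k \<omega> =
     mat_prod (\<lambda>i. A i \<omega>) 1 (k - 1) ** \<theta> k \<omega> ** mat_prod (\<lambda>i. A i \<omega>) (k + 1) n"

definition norm_moment :: "('a \<Rightarrow> real) \<Rightarrow> 'w measure \<Rightarrow> real \<Rightarrow> ('w \<Rightarrow> 'a) \<Rightarrow> real" where
  "norm_moment N M \<alpha> Y = (\<integral>\<omega>. N (Y \<omega>) powr \<alpha> \<partial>M)"

end

theory Submission
  imports Defs
begin

text \<open>
  A product of independent regularly varying matrices is large essentially only because exactly
  one of its factors is large, while the factors to its left and to its right stay of order one.
  Given that the \<open>k\<close>-th factor is large, it looks like a Pareto radius times an independent
  direction \<open>\<theta> k\<close>, so that the product looks like the same radius times
  \<open>\<Pi>\<^sub>k\<^sub>-\<^sub>1 \<theta>\<^sub>k \<Pi>\<^sub>k\<^sub>+\<^sub>1\<^sub>,\<^sub>n\<close>.  Since the Pareto measure is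
  homogeneous, this scenario contributes the \<open>\<alpha>\<close>-th moment of the norm of that matrix to the
  tail of the product, and its direction, weighted by the \<open>\<alpha>\<close>-th power of its norm, to the
  spectral law.  The limits in the theorem are the sums of these contributions over \<open>k\<close>.

  Three parts make this precise.

  The first is the passage between vague convergence and polar coordinates.  Vague convergence on
  the punctured space does not see mass that escapes to infinity;
  \<open>regularly_varying_imp_regular_tail\<close> shows that homogeneity of the limit forbids such an
  escape, so that the tail of the norm is regularly varying.  Together with the spectral law this
  yields \<open>polar_convergence\<close>: the rescaled law of the matrix converges on bounded continuous
  functions that vanish near the origin.  Conversely \<open>polar_imp_regularly_varying\<close> recovers
  regular variation from these two ingredients, and is applied to the product at the end.

  The second is that two large factors are negligible.  By hypothesis this holds for two factors.
  A partial product has a tail comparable with that of one factor (\<open>prod_tail_bound\<close>), and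
  this lets a partial product take the place of a single factor in the hypothesis
  (\<open>two_factors_large\<close>); the two facts are proved from each other by induction on the number
  of factors.  The hypothesis also forces the moment of order \<open>\<alpha>\<close> to be finite
  (\<open>moment_finite\<close>), which is what makes the limits finite.

  The third is the computation for one large factor.  Conditionally on the other factors, a test
  function of the product is a test function of the large factor, so \<open>polar_convergence\<close>
  applies under the integral sign (\<open>single_jump_limit\<close>).  Summing over the position of the
  large factor gives \<open>big_jump_limit\<close>, and test functions that depend on the direction and on
  a cutoff of the norm turn it into the tail asymptotics and the spectral law.
\<close>

section \<open>Norms\<close>

lemma is_normD:
  assumes "is_norm N"
  shows is_norm_eq_0: "N x = 0 \<longleftrightarrow> x = 0"
    and is_norm_scaleR: "N (c *\<^sub>R x) = \<bar>c\<bar> * N x"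
    and is_norm_triangle: "N (x + y) \<le> N x + N y"
  using assms unfolding is_norm_def by auto

lemma is_norm_zero: "is_norm N \<Longrightarrow> N 0 = 0"
  by (simp add: is_norm_eq_0)

lemma is_norm_nonneg: 
  assumes "is_norm N" shows "0 \<le> N x"
proof -
  have "N (- x) = N x"
    using is_norm_scaleR[OF assms, of "-1" x] by simp
  then show ?thesis
    using is_norm_triangle[OF assms, of x "-x"] is_norm_zero[OF assms] by simp
qed

lemma is_norm_pos: "is_norm N \<Longrightarrow> x \<noteq> 0 \<Longrightarrow> 0 < N x"
  using is_norm_nonneg[of N x] is_norm_eq_0[of N x] by simp

lemma is_norm_normalize:
  assumes "is_norm N" "x \<noteq> 0" shows "N (x /\<^sub>R N x) = 1"
  using is_norm_pos[OF assms] by (simp add: is_norm_scaleR[OF assms(1)])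

lemma is_norm_le_norm:
  fixes N :: "'a::euclidean_space \<Rightarrow> real"
  assumes "is_norm N"
  obtains c where "c > 0" "\<And>x. N x \<le> c * norm x"
proof -
  define c where "c = (\<Sum>b\<in>Basis. N b) + 1"
  have sum_le: "N (\<Sum>b\<in>B. g b) \<le> (\<Sum>b\<in>B. N (g b))" if "finite B" for B :: "'a set" and g :: "'a \<Rightarrow> 'a"
    using that
  proof (induction B)
    case (insert b B)
    then show ?case using is_norm_triangle[OF assms, of "g b" "sum g B"] by simp
  qed (simp add: is_norm_zero[OF assms])
  have c: "c > 0"
    unfolding c_def using sum_nonneg[of Basis N] is_norm_nonneg[OF assms] by fastforce
  have "N x \<le> c * norm x" for x
  proof -
    have "N x = N (\<Sum>b\<in>Basis. (x \<bullet> b) *\<^sub>R b)"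
      by (simp add: euclidean_representation)
    also have "\<dots> \<le> (\<Sum>b\<in>Basis. N ((x \<bullet> b) *\<^sub>R b))"
      by (rule sum_le) simp
    also have "\<dots> \<le> (\<Sum>b\<in>Basis. norm x * N b)"
      unfolding is_norm_scaleR[OF assms]
      by (intro sum_mono mult_right_mono is_norm_nonneg[OF assms] Basis_le_norm)
    also have "\<dots> \<le> c * norm x"
      by (simp add: c_def flip: sum_distrib_left) (simp add: algebra_simps)
    finally show ?thesis .
  qed
  with c that show ?thesis by blast
qed

lemma is_norm_continuous:
  fixes N :: "'a::euclidean_space \<Rightarrow> real"
  assumes "is_norm N"
  shows "continuous_on S N"
proof -
  obtain c where c: "c > 0" "\<And>x. N x \<le> c * norm x"
    using is_norm_le_norm[OF assms] by blast
  have *: "N x - N y \<le> c * dist x y" for x y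
    using is_norm_triangle[OF assms, of "x - y" y] c(2)[of "x - y"] by (simp add: dist_norm)
  have "c-lipschitz_on S N"
  proof (rule lipschitz_onI)
    show "dist (N x) (N y) \<le> c * dist x y" for x y
      using *[of x y] *[of y x] by (simp add: dist_real_def dist_commute abs_le_iff)
  qed (use c in simp)
  then show ?thesis by (rule lipschitz_on_continuous_on)
qed

lemma is_norm_borel:
  fixes N :: "'a::euclidean_space \<Rightarrow> real"
  assumes "is_norm N"
  shows "N \<in> borel_measurable borel"
  by (rule borel_measurable_continuous_onI[OF is_norm_continuous[OF assms]])

lemma norm_le_is_norm:
  fixes N :: "'a::euclidean_space \<Rightarrow> real"
  assumes "is_norm N"
  obtains c where "c > 0" "\<And>x. norm x \<le> c * N x"
proof -
  have "sphere (0::'a) 1 \<noteq> {}" by simp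
  then obtain u where u: "u \<in> sphere 0 1" "\<And>x. x \<in> sphere 0 1 \<Longrightarrow> N u \<le> N x"
    using continuous_attains_inf[OF compact_sphere _ is_norm_continuous[OF assms]] by metis
  then have Nu: "N u > 0" by (intro is_norm_pos[OF assms]) auto
  have "norm x \<le> 1 / N u * N x" for x
  proof (cases "x = 0")
    case False
    then have "N u \<le> N (x /\<^sub>R norm x)" by (intro u) simp
    also have "\<dots> = N x / norm x"
      using False by (simp add: is_norm_scaleR[OF assms] divide_inverse mult.commute)
    finally show ?thesis using Nu False by (simp add: field_simps)
  qed (simp add: is_norm_zero[OF assms])
  moreover have "1 / N u > 0" using Nu by simp
  ultimately show ?thesis using that by blast
qed

lemma bounded_bilinear_matrix_mult:
  "bounded_bilinear ((**) :: real^'n^'n \<Rightarrow> real^'n^'n \<Rightarrow> real^'n^'n)"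
  unfolding bilinear_conv_bounded_bilinear[symmetric] bilinear_def
  by (auto intro!: linearI simp: matrix_matrix_mult_def vec_eq_iff sum.distrib algebra_simps sum_distrib_left)

lemma is_norm_matrix_mult:
  fixes N :: "real^'n^'n \<Rightarrow> real"
  assumes "is_norm N"
  obtains c where "c \<ge> 1" "\<And>x y :: real^'n^'n. N (x ** y) \<le> c * (N x * N y)"
proof -
  obtain a where a: "a > 0" "\<And>x. N x \<le> a * norm x" using is_norm_le_norm[OF assms] by blast
  obtain b where b: "b > 0" "\<And>x. norm x \<le> b * N x" using norm_le_is_norm[OF assms] by blast
  obtain K where K: "\<And>(x::real^'n^'n) (y::real^'n^'n). norm (x ** y) \<le> norm x * norm y * K" "K > 0"
    using bounded_bilinear.pos_bounded[OF bounded_bilinear_matrix_mult[where 'n='n]] by metis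
  have "N (x ** y) \<le> max 1 (a * b * b * K) * (N x * N y)" for x y :: "real^'n^'n"
  proof -
    have "N (x ** y) \<le> a * (norm x * norm y * K)"
      using a K by (meson order_trans mult_left_mono less_imp_le)
    also have "norm x * norm y \<le> (b * N x) * (b * N y)"
      by (intro mult_mono b) (use b is_norm_nonneg[OF assms] in auto)
    finally have "N (x ** y) \<le> (a * b * b * K) * (N x * N y)"
      using a K by (simp add: mult_left_mono mult_right_mono ac_simps)
    also have "\<dots> \<le> max 1 (a * b * b * K) * (N x * N y)"
      by (intro mult_right_mono) (use is_norm_nonneg[OF assms] in auto)
    finally show ?thesis .
  qed
  then show ?thesis using that[of "max 1 (a * b * b * K)"] by auto
qed

lemma borel_measurable_matrix_mult [measurable (raw)]:
  fixes f g :: "'a \<Rightarrow> real^'n^'n"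
  assumes "f \<in> borel_measurable M" "g \<in> borel_measurable M"
  shows "(\<lambda>x. f x ** g x) \<in> borel_measurable M"
  by (rule borel_measurable_continuous_Pair[OF assms])
     (intro bounded_bilinear.continuous_on[OF bounded_bilinear_matrix_mult] continuous_intros)

section \<open>Pareto measure\<close>

text \<open>
  The radial part of every limit measure of index \<open>\<alpha>\<close>.  The measure is infinite near the
  origin; only its restrictions to \<open>{s<..}\<close> with \<open>s > 0\<close> are finite.
\<close>

definition pareto :: "real \<Rightarrow> real measure" where
  "pareto \<alpha> = density lborel (\<lambda>r. ennreal (indicator {0<..} r * (\<alpha> * r powr (- \<alpha> - 1))))"

lemma sets_pareto [measurable_cong, simp]: "sets (pareto \<alpha>) = sets borel"
  by (simp add: pareto_def)

lemma space_pareto [simp]: "space (pareto \<alpha>) = UNIV"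
  by (simp add: pareto_def)

lemma sigma_finite_pareto: "sigma_finite_measure (pareto \<alpha>)"
  unfolding pareto_def
  by (subst sigma_finite_measure.sigma_finite_iff_density_finite) (auto intro: sigma_finite_lborel)

lemma AE_pareto_pos: "AE r in pareto \<alpha>. r > 0"
  unfolding pareto_def by (subst AE_density) (auto split: split_indicator)

lemma emeasure_pareto_greaterThan:
  assumes "\<alpha> > 0" "s > 0"
  shows "emeasure (pareto \<alpha>) {s<..} = ennreal (s powr - \<alpha>)"
proof -
  have "emeasure (pareto \<alpha>) {s<..} = (\<integral>\<^sup>+r. ennreal (\<alpha> * r powr (- \<alpha> - 1)) * indicator {s..} r \<partial>lborel)"
  proof -
    have "emeasure (pareto \<alpha>) {s<..} = (\<integral>\<^sup>+r. ennreal (indicator {0<..} r * (\<alpha> * r powr (- \<alpha> - 1))) * indicator {s<..} r \<partial>lborel)"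
      unfolding pareto_def by (rule emeasure_density) auto
    also have "\<dots> = (\<integral>\<^sup>+r. ennreal (\<alpha> * r powr (- \<alpha> - 1)) * indicator {s..} r \<partial>lborel)"
    proof (rule nn_integral_cong_AE, use AE_lborel_singleton[of s] in eventually_elim)
      case (elim r)
      then show ?case using assms by (auto split: split_indicator)
    qed
    finally show ?thesis .
  qed
  also have "\<dots> = ennreal (0 - (- (s powr - \<alpha>)))"
  proof (rule nn_integral_FTC_atLeast)
    show "((\<lambda>r. - (r powr - \<alpha>)) has_real_derivative \<alpha> * x powr (- \<alpha> - 1)) (at x)" if "s \<le> x" for x
      using that assms by (auto intro!: derivative_eq_intros)
    have "((\<lambda>r::real. r powr - \<alpha>) \<longlongrightarrow> 0) at_top"
      using assms by (intro tendsto_neg_powr filterlim_ident) auto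
    then show "((\<lambda>r. - (r powr - \<alpha>)) \<longlongrightarrow> 0) at_top"
      using tendsto_minus by force
  qed (use assms in auto)
  finally show ?thesis by simp
qed

lemma measure_pareto_greaterThan:
  assumes "\<alpha> > 0" "s > 0"
  shows "measure (pareto \<alpha>) {s<..} = s powr - \<alpha>"
  using emeasure_pareto_greaterThan[OF assms] by (simp add: measure_def)

text \<open>
  Homogeneity of the radial measure.  It is the source of all powers \<open>\<alpha>\<close> in the limits:
  moving a matrix of norm \<open>c\<close> to the unit sphere costs the factor \<open>c powr \<alpha>\<close>.
\<close>

lemma nn_integral_pareto_scale:
  assumes "c > 0" and [measurable]: "f \<in> borel_measurable borel"
  shows "(\<integral>\<^sup>+r. f (c * r) \<partial>pareto \<alpha>) = ennreal (c powr \<alpha>) * (\<integral>\<^sup>+r. f r \<partial>pareto \<alpha>)"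
proof -
  let ?d = "\<lambda>r::real. ennreal (indicator {0<..} r * (\<alpha> * r powr (- \<alpha> - 1)))"
  have "(\<integral>\<^sup>+r. f r \<partial>pareto \<alpha>) = (\<integral>\<^sup>+r. ?d r * f r \<partial>lborel)"
    unfolding pareto_def by (subst nn_integral_density) auto
  also have "\<dots> = ennreal c * (\<integral>\<^sup>+r. ?d (c * r) * f (c * r) \<partial>lborel)"
    using assms(1) by (subst nn_integral_real_affine[where c=c and t=0]) auto
  also have "(\<lambda>r. ?d (c * r) * f (c * r)) = (\<lambda>r. ennreal (c powr (- \<alpha> - 1)) * (?d r * f (c * r)))"
  proof
    fix r
    have "?d (c * r) = ennreal (c powr (- \<alpha> - 1) * (indicator {0<..} r * (\<alpha> * r powr (- \<alpha> - 1))))"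
      using assms(1) by (auto split: split_indicator simp: powr_mult zero_less_mult_iff ac_simps)
    then show "?d (c * r) * f (c * r) = ennreal (c powr (- \<alpha> - 1)) * (?d r * f (c * r))"
      by (subst (asm) ennreal_mult') (simp_all add: mult.assoc)
  qed
  also have "(\<integral>\<^sup>+r. ennreal (c powr (- \<alpha> - 1)) * (?d r * f (c * r)) \<partial>lborel) = 
      ennreal (c powr (- \<alpha> - 1)) * (\<integral>\<^sup>+r. f (c * r) \<partial>pareto \<alpha>)"
    unfolding pareto_def by (subst nn_integral_density) (auto intro!: nn_integral_cmult)
  finally have "ennreal (c powr \<alpha>) * (\<integral>\<^sup>+r. f r \<partial>pareto \<alpha>) =
     ennreal (c powr \<alpha> * (c * c powr (- \<alpha> - 1))) * (\<integral>\<^sup>+r. f (c * r) \<partial>pareto \<alpha>)"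
    using assms(1) by (simp add: ennreal_mult mult.assoc)
  also have "c powr \<alpha> * (c * c powr (- \<alpha> - 1)) = 1"
  proof -
    have "c * c powr (- \<alpha> - 1) = c powr (1 + (- \<alpha> - 1))"
      using assms(1) by (subst powr_add) simp
    then show ?thesis using assms(1) by (simp flip: powr_add)
  qed
  finally show ?thesis by simp
qed

section \<open>Test functions\<close>

text \<open>
  In contrast to the test functions of vague convergence, these need not vanish near infinity.  The
  reason for this choice is that the class is stable under composition with \<open>x \<mapsto> p ** x ** q\<close>
  even if \<open>p\<close> or \<open>q\<close> is singular, whereas compact supports are not.
\<close>

definition test_fun :: "('a::euclidean_space \<Rightarrow> real) \<Rightarrow> real \<Rightarrow> real \<Rightarrow> ('a \<Rightarrow> real) \<Rightarrow> bool" where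
  "test_fun N B \<delta> f \<longleftrightarrow>
     continuous_on UNIV f \<and> \<delta> > 0 \<and> (\<forall>x. 0 \<le> f x \<and> f x \<le> B) \<and> (\<forall>x. N x \<le> \<delta> \<longrightarrow> f x = 0)"

lemma test_funD:
  assumes "test_fun N B \<delta> f"
  shows "continuous_on UNIV f" "f \<in> borel_measurable borel" "\<delta> > 0" "0 \<le> f x" "f x \<le> B" "B \<ge> 0"
    "N x \<le> \<delta> \<Longrightarrow> f x = 0"
  using assms order_trans[of 0 "f x" B] unfolding test_fun_def
  by (auto intro: borel_measurable_continuous_onI)

lemma test_fun_le_indicator:
  assumes "test_fun N B \<delta> f" shows "f x \<le> B * indicator {\<delta><..} (N x)"
  using test_funD(4-7)[OF assms] by (auto split: split_indicator)

text \<open>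
  The argument \<open>y\<close> may have any norm, so that products of matrices can be inserted without being
  normalised first.
\<close>

definition radial_integral :: "real \<Rightarrow> ('a::real_normed_vector \<Rightarrow> real) \<Rightarrow> 'a \<Rightarrow> real" where
  "radial_integral \<alpha> f y = (\<integral>r. f (r *\<^sub>R y) \<partial>pareto \<alpha>)"

text \<open>
  The integrand vanishes unless \<open>r * N y > \<delta>\<close>, and the radii with this property have Pareto mass
  \<open>(N y / \<delta>) powr \<alpha>\<close>.
\<close>

lemma radial_integral_bound:
  fixes N :: "'a::euclidean_space \<Rightarrow> real"
  assumes "\<alpha> > 0" "is_norm N" "test_fun N B \<delta> f"
  shows radial_integrable: "integrable (pareto \<alpha>) (\<lambda>r. f (r *\<^sub>R y))"
    and radial_integral_nonneg: "0 \<le> radial_integral \<alpha> f y"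
    and radial_integral_le: "radial_integral \<alpha> f y \<le> B * (N y / \<delta>) powr \<alpha>"
proof -
  note f = test_funD[OF assms(3)]
  have [measurable]: "f \<in> borel_measurable borel" by (rule f)
  let ?s = "\<delta> / N y"
  have int: "integrable (pareto \<alpha>) (\<lambda>r. f (r *\<^sub>R y)) \<and> radial_integral \<alpha> f y \<le> B * (N y / \<delta>) powr \<alpha>"
  proof (cases "y = 0")
    case True
    then have "f (r *\<^sub>R y) = 0" for r using f(3) f(7)[of 0] is_norm_zero[OF assms(2)] by simp
    then show ?thesis using f(6) by (simp add: radial_integral_def)
  next
    case False
    then have Ny: "N y > 0" by (rule is_norm_pos[OF assms(2)])
    have s: "?s > 0" using Ny f(3) by simp
    have em: "emeasure (pareto \<alpha>) {?s<..} = ennreal (?s powr - \<alpha>)"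
      by (rule emeasure_pareto_greaterThan[OF assms(1) s])
    have bnd: "AE r in pareto \<alpha>. f (r *\<^sub>R y) \<le> B * indicator {?s<..} r"
      using AE_pareto_pos
    proof eventually_elim
      case (elim r)
      have "f (r *\<^sub>R y) \<le> B * indicator {\<delta><..} (N (r *\<^sub>R y))" by (rule test_fun_le_indicator[OF assms(3)])
      also have "\<dots> \<le> B * indicator {?s<..} r"
        using elim Ny f(6) by (auto split: split_indicator simp: is_norm_scaleR[OF assms(2)] field_simps)
      finally show ?case .
    qed
    have ib: "integrable (pareto \<alpha>) (\<lambda>r. B * indicator {?s<..} r)"
      using em by (intro integrable_mult_right integrable_real_indicator) auto
    have i: "integrable (pareto \<alpha>) (\<lambda>r. f (r *\<^sub>R y))"
    proof (rule Bochner_Integration.integrable_bound[OF ib])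
      show "(\<lambda>r. f (r *\<^sub>R y)) \<in> borel_measurable (pareto \<alpha>)" by measurable
      show "AE r in pareto \<alpha>. norm (f (r *\<^sub>R y)) \<le> norm (B * indicat_real {?s<..} r)"
        using bnd by eventually_elim (use f(4,6) in simp)
    qed
    have "radial_integral \<alpha> f y \<le> (\<integral>r. B * indicator {?s<..} r \<partial>pareto \<alpha>)"
      unfolding radial_integral_def by (rule integral_mono_AE[OF i ib bnd])
    also have "\<dots> = B * ?s powr - \<alpha>"
      using measure_pareto_greaterThan[OF assms(1) s] by simp
    also have "?s powr - \<alpha> = (N y / \<delta>) powr \<alpha>"
      using Ny f(3) by (simp add: powr_minus powr_divide)
    finally show ?thesis using i by simp
  qed
  then show "integrable (pareto \<alpha>) (\<lambda>r. f (r *\<^sub>R y))" 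
    and "radial_integral \<alpha> f y \<le> B * (N y / \<delta>) powr \<alpha>" by auto
  show "0 \<le> radial_integral \<alpha> f y"
    unfolding radial_integral_def by (intro integral_nonneg_AE) (simp add: f)
qed

lemma radial_integral_measurable [measurable (raw)]:
  fixes f :: "'a::euclidean_space \<Rightarrow> real"
  assumes [measurable]: "f \<in> borel_measurable borel" "Y \<in> borel_measurable M"
  shows "(\<lambda>x. radial_integral \<alpha> f (Y x)) \<in> borel_measurable M"
proof -
  interpret sigma_finite_measure "pareto \<alpha>" by (rule sigma_finite_pareto)
  show ?thesis unfolding radial_integral_def by measurable
qed

section \<open>Regularly varying tails\<close>

abbreviation tail_prob :: "('a \<Rightarrow> real) \<Rightarrow> 'w measure \<Rightarrow> ('w \<Rightarrow> 'a) \<Rightarrow> real \<Rightarrow> real" where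
  "tail_prob N M X t \<equiv> \<P>(\<omega> in M. N (X \<omega>) > t)"

definition regular_tail :: "real \<Rightarrow> (real \<Rightarrow> real) \<Rightarrow> bool" where
  "regular_tail \<alpha> T \<longleftrightarrow> (\<forall>u>0. ((\<lambda>t. T (u * t) / T t) \<longlongrightarrow> u powr - \<alpha>) at_top)"

lemma regular_tailD: "regular_tail \<alpha> T \<Longrightarrow> u > 0 \<Longrightarrow> ((\<lambda>t. T (u * t) / T t) \<longlongrightarrow> u powr - \<alpha>) at_top"
  by (simp add: regular_tail_def)

text \<open>
  As division by zero gives zero, a tail that vanishes somewhere, and hence everywhere beyond, would
  have ratios tending to \<open>0\<close> instead of \<open>1\<close> for \<open>u = 1\<close>.
\<close>

lemma regular_tail_pos:
  assumes "regular_tail \<alpha> T" "antimono T" "\<And>t. T t \<ge> 0"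
  shows "T t > 0"
proof -
  have "((\<lambda>t. T (1 * t) / T t) \<longlongrightarrow> 1 powr - \<alpha>) at_top" by (rule regular_tailD[OF assms(1)]) simp
  then have "eventually (\<lambda>t. T (1 * t) / T t > 0) at_top" by (rule order_tendstoD) simp
  then have "eventually (\<lambda>s. t \<le> s \<and> T (1 * s) / T s > 0) at_top"
    by (intro eventually_conj eventually_ge_at_top)
  then obtain s where "t \<le> s" "T (1 * s) / T s > 0" by (auto dest: eventually_happens)
  moreover have "T s \<le> T t" by (rule antimonoD[OF assms(2)]) fact
  moreover have "T s \<noteq> 0" using \<open>T (1 * s) / T s > 0\<close> by auto
  ultimately show ?thesis using assms(3)[of s] by linarith
qed

lemma antimono_tail_prob:
  assumes "prob_space M" "is_norm N" "X \<in> borel_measurable M"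
  shows "antimono (tail_prob N (M :: 'w measure) (X :: 'w \<Rightarrow> 'a::euclidean_space))"
proof (rule antimonoI)
  interpret prob_space M by fact
  have [measurable]: "N \<in> borel_measurable borel" "X \<in> borel_measurable M"
    using is_norm_borel[OF assms(2)] assms(3) by auto
  fix s t :: real assume "s \<le> t"
  then show "tail_prob N M X t \<le> tail_prob N M X s"
    by (intro finite_measure_mono) auto
qed

definition ramp :: "real \<Rightarrow> real \<Rightarrow> real \<Rightarrow> real" where
  "ramp a b r = max 0 (min 1 ((r - a) / (b - a)))"

lemma ramp_props:
  assumes "a < b"
  shows "0 \<le> ramp a b r" "ramp a b r \<le> 1" "r \<le> a \<Longrightarrow> ramp a b r = 0" "b \<le> r \<Longrightarrow> ramp a b r = 1"
proof -
  show "0 \<le> ramp a b r" "ramp a b r \<le> 1" by (simp_all add: ramp_def)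
  show "ramp a b r = 0" if "r \<le> a"
  proof -
    have "(r - a) / (b - a) \<le> 0" using that assms by (intro divide_nonpos_pos) auto
    then show ?thesis by (simp add: ramp_def)
  qed
  show "ramp a b r = 1" if "b \<le> r"
  proof -
    have "1 \<le> (r - a) / (b - a)" using that assms by (simp add: pos_le_divide_eq)
    then show ?thesis by (simp add: ramp_def)
  qed
qed

lemma continuous_ramp: "continuous_on X (ramp a b)"
  unfolding ramp_def divide_inverse by (intro continuous_intros)

lemma ramp_meas [measurable]: "ramp a b \<in> borel_measurable borel"
  by (rule borel_measurable_continuous_onI[OF continuous_ramp])

text \<open>
  Composed with a norm, this is a continuous substitute for the indicator of a shell that is
  admissible in vague convergence, because its support is compact in the punctured space.
\<close>

definition plateau :: "real \<Rightarrow> real \<Rightarrow> real \<Rightarrow> real \<Rightarrow> real" where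
  "plateau a b e r = ramp a (a + e) r * (1 - ramp (b - e) b r)"

lemma plateau_props:
  assumes "e > 0"
  shows "0 \<le> plateau a b e r" "plateau a b e r \<le> 1"
    "plateau a b e r \<noteq> 0 \<Longrightarrow> a < r \<and> r < b"
    "a + e \<le> r \<Longrightarrow> r \<le> b - e \<Longrightarrow> plateau a b e r = 1"
proof -
  note r = ramp_props[of a "a + e" r] ramp_props[of "b - e" b r]
  show "0 \<le> plateau a b e r" "plateau a b e r \<le> 1"
    unfolding plateau_def using r assms by (auto intro!: mult_le_one)
  show "plateau a b e r \<noteq> 0 \<Longrightarrow> a < r \<and> r < b"
    unfolding plateau_def using r assms by (force simp: not_less[symmetric])
  show "a + e \<le> r \<Longrightarrow> r \<le> b - e \<Longrightarrow> plateau a b e r = 1"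
    unfolding plateau_def using r assms by simp
qed

lemma continuous_plateau: "continuous_on S g \<Longrightarrow> continuous_on S (\<lambda>x. plateau a b e (g x))"
  unfolding plateau_def
  by (intro continuous_intros continuous_on_compose2[OF continuous_ramp[of UNIV]]) auto

lemma compact_norm_shell:
  fixes N :: "'a::euclidean_space \<Rightarrow> real"
  assumes "is_norm N"
  shows "compact {x. a \<le> N x \<and> N x \<le> b}"
proof -
  obtain c where c: "c > 0" "\<And>x. norm x \<le> c * N x"
    using norm_le_is_norm[OF assms] by blast
  have "bounded {x. a \<le> N x \<and> N x \<le> b}"
  proof (rule boundedI)
    fix x assume "x \<in> {x. a \<le> N x \<and> N x \<le> b}"
    then have "c * N x \<le> c * b" using c(1) by simp
    then show "norm x \<le> c * b" using c(2)[of x] by linarith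
  qed
  moreover have "closed {x. a \<le> N x \<and> N x \<le> b}"
    by (intro closed_Collect_conj closed_Collect_le continuous_intros is_norm_continuous[OF assms])
  ultimately show ?thesis by (simp add: compact_eq_bounded_closed)
qed

lemma compact_punctured_bounded_away:
  fixes N :: "'a::euclidean_space \<Rightarrow> real"
  assumes N: "is_norm N" and K: "compact K" "K \<subseteq> - {0}"
  obtains \<delta> where "\<delta> > 0" "\<And>x. x \<in> K \<Longrightarrow> \<delta> < N x"
proof (cases "K = {}")
  case False
  then obtain x where x: "x \<in> K" "\<And>y. y \<in> K \<Longrightarrow> N x \<le> N y"
    using continuous_attains_inf[OF K(1) False is_norm_continuous[OF N]] by blast
  then have "N x > 0" using K(2) by (intro is_norm_pos[OF N]) auto
  moreover have "N x / 2 < N y" if "y \<in> K" for y using x(2)[OF that] \<open>N x > 0\<close> by linarith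
  ultimately show ?thesis using that[of "N x / 2"] by simp
qed (use that[of 1] in auto)

lemma sets_punctured_borel: "A \<in> sets punctured_borel \<longleftrightarrow> A \<in> sets borel \<and> 0 \<notin> A"
  unfolding punctured_borel_def by (subst sets_restrict_space_iff) auto

lemma nn_integral_tail_measure:
  fixes X :: "'w \<Rightarrow> 'a::euclidean_space"
  assumes [measurable]: "X \<in> borel_measurable M" "f \<in> borel_measurable borel" and "f 0 = 0"
  shows "(\<integral>\<^sup>+x. f x \<partial>tail_measure N M X t) =
    ennreal (1 / tail_prob N M X t) * (\<integral>\<^sup>+\<omega>. f (X \<omega> /\<^sub>R t) \<partial>M)"
proof -
  have "(\<integral>\<^sup>+x. f x \<partial>tail_measure N M X t) = ennreal (1 / tail_prob N M X t) *
    (\<integral>\<^sup>+x. f x * indicator (-{0}) x \<partial>distr M borel (\<lambda>\<omega>. X \<omega> /\<^sub>R t))"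
    unfolding tail_measure_def
    by (subst nn_integral_scale_measure)
       (auto simp: nn_integral_restrict_space intro!: measurable_restrict_space1)
  also have "(\<lambda>x. f x * indicator (-{0}) x) = f"
    using assms(3) by (auto split: split_indicator)
  finally show ?thesis by (simp add: nn_integral_distr)
qed

text \<open>
  Let \<open>F r\<close> be the mass of the shell between the radii \<open>1\<close> and \<open>r\<close>.  Homogeneity gives
  \<open>F (r * s) = F r + r powr - \<alpha> * F s\<close>.  Exchanging \<open>r\<close> and \<open>s\<close> and comparing yields
  \<open>F r = m * (1 - r powr - \<alpha>)\<close>; in particular spheres carry no mass.  If \<open>m\<close> were zero, all shells and hence their union, the punctured space, would be null.
\<close>

lemma regularly_varying_shell:
  fixes X :: "'w \<Rightarrow> 'a::euclidean_space"
  assumes "prob_space M" and N: "is_norm N" and rv: "regularly_varying N M X \<alpha> \<mu>"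
  obtains m where "m > 0"
    "\<And>a b. 0 < a \<Longrightarrow> a \<le> b \<Longrightarrow> emeasure \<mu> {x. a < N x \<and> N x \<le> b} = ennreal (m * (a powr - \<alpha> - b powr - \<alpha>))"
proof -
  have rad: "radon_punctured \<mu>" and nz: "emeasure \<mu> (space \<mu>) \<noteq> 0" and al: "\<alpha> > 0"
    and hom: "\<And>t A. t > 0 \<Longrightarrow> A \<in> sets \<mu> \<Longrightarrow> emeasure \<mu> ((\<lambda>x. t *\<^sub>R x) ` A) = ennreal (t powr - \<alpha>) * emeasure \<mu> A"
    using rv by (auto simp: regularly_varying_def)
  have sets_mu: "sets \<mu> = sets punctured_borel" using rad by (simp add: radon_punctured_def)
  have [measurable]: "N \<in> borel_measurable borel" by (rule is_norm_borel[OF N])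
  define E where "E a b = {x. a < N x \<and> N x \<le> b}" for a b
  have E_borel: "E a b \<in> sets borel" for a b unfolding E_def by measurable
  have E_sets: "E a b \<in> sets \<mu>" if "a > 0" for a b
    using E_borel[of a b] that by (simp add: sets_mu sets_punctured_borel E_def is_norm_zero[OF N])
  have E_fin: "emeasure \<mu> (E a b) < \<infinity>" if "a > 0" for a b
  proof -
    let ?K = "{x. a \<le> N x \<and> N x \<le> b}"
    have K: "compact ?K" by (rule compact_norm_shell[OF N])
    have "?K \<subseteq> - {0}" using that by (auto simp: is_norm_zero[OF N])
    with K have "emeasure \<mu> ?K < \<infinity>" using rad unfolding radon_punctured_def by blast
    moreover have "?K \<in> sets \<mu>"
      using borel_compact[OF K] \<open>?K \<subseteq> - {0}\<close> by (auto simp: sets_mu sets_punctured_borel)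
    then have "emeasure \<mu> (E a b) \<le> emeasure \<mu> ?K"
      by (intro emeasure_mono) (auto simp: E_def)
    ultimately show ?thesis by (rule le_less_trans[rotated])
  qed
  define F where "F r = measure \<mu> (E 1 r)" for r
  have scale: "measure \<mu> (E a (a * r)) = a powr - \<alpha> * F r" if "a > 0" for a r
  proof -
    have "E a (a * r) = (\<lambda>x. a *\<^sub>R x) ` E 1 r"
    proof (intro equalityI subsetI)
      fix x assume "x \<in> E a (a * r)"
      then have "x /\<^sub>R a \<in> E 1 r" using that
        by (auto simp: E_def is_norm_scaleR[OF N] field_simps)
      then show "x \<in> (\<lambda>x. a *\<^sub>R x) ` E 1 r" using that by (intro image_eqI[of _ _ "x /\<^sub>R a"]) auto
    qed (use that in \<open>auto simp: E_def is_norm_scaleR[OF N]\<close>)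
    then have "emeasure \<mu> (E a (a * r)) = ennreal (a powr - \<alpha>) * emeasure \<mu> (E 1 r)"
      using hom[OF that, of "E 1 r"] E_sets[of 1 r] by simp
    then show ?thesis unfolding F_def measure_def by (simp add: enn2real_mult)
  qed
  have split: "measure \<mu> (E a c) = measure \<mu> (E a b) + measure \<mu> (E b c)" if "0 < a" "a \<le> b" "b \<le> c" for a b c
  proof -
    have "E a c = E a b \<union> E b c" using that by (auto simp: E_def)
    moreover have "E a b \<inter> E b c = {}" by (auto simp: E_def)
    ultimately show ?thesis
      using that E_sets[of a b] E_sets[of b c] E_fin[of a b] E_fin[of b c]
      by (simp add: measure_Union less_top)
  qed
  have add: "F (r * s) = F r + r powr - \<alpha> * F s" if "r \<ge> 1" "s \<ge> 1" for r s
    using split[of 1 r "r * s"] scale[of r s] that unfolding F_def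
    by (simp add: mult_le_cancel_left1)
  define m where "m = F 2 / (1 - 2 powr - \<alpha>)"
  have two: "2 powr - \<alpha> < (1::real)" using al by (simp add: powr_minus_divide)
  have F_eq: "F r = m * (1 - r powr - \<alpha>)" if "r \<ge> 1" for r
  proof -
    have "F r + r powr - \<alpha> * F 2 = F 2 + 2 powr - \<alpha> * F r"
      using add[of r 2] add[of 2 r] that by (simp add: mult.commute)
    then have "F r * (1 - 2 powr - \<alpha>) = F 2 * (1 - r powr - \<alpha>)" by (simp add: algebra_simps)
    then have "F r = F 2 * (1 - r powr - \<alpha>) / (1 - 2 powr - \<alpha>)"
      using two by (subst eq_divide_eq) auto
    then show ?thesis by (simp add: m_def)
  qed
  have shell: "measure \<mu> (E a b) = m * (a powr - \<alpha> - b powr - \<alpha>)" if "0 < a" "a \<le> b" for a b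
  proof -
    have "measure \<mu> (E a b) = a powr - \<alpha> * (m * (1 - (b / a) powr - \<alpha>))"
      using scale[of a "b / a"] F_eq[of "b / a"] that by simp
    also have "(b / a) powr - \<alpha> = b powr - \<alpha> / a powr - \<alpha>" using that by (simp add: powr_divide)
    also have "a powr - \<alpha> * (m * (1 - b powr - \<alpha> / a powr - \<alpha>)) = m * (a powr - \<alpha> - b powr - \<alpha>)"
    proof -
      have "p * (m * (1 - q / p)) = m * (p - q)" if "p > 0" for p q :: real
        using that by (simp add: field_simps)
      then show ?thesis using that by simp
    qed
    finally show ?thesis .
  qed
  have eshell: "emeasure \<mu> (E a b) = ennreal (m * (a powr - \<alpha> - b powr - \<alpha>))" if "0 < a" "a \<le> b" for a b
    using shell[OF that] E_fin[OF that(1), of b] by (simp add: emeasure_eq_ennreal_measure less_top)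
  have "m \<noteq> 0"
  proof
    assume "m = 0"
    have "emeasure \<mu> (\<Union>k. E (1 / real (Suc k)) (real (Suc k))) = 0"
    proof (rule emeasure_UN_eq_0)
      have "1 / real (Suc k) \<le> real (Suc k)" for k by (simp add: field_simps)
      then show "emeasure \<mu> (E (1 / real (Suc k)) (real (Suc k))) = 0" for k
        using eshell[of "1 / real (Suc k)" "real (Suc k)"] \<open>m = 0\<close> by simp
    qed (use E_sets in auto)
    moreover have "(\<Union>k. E (1 / real (Suc k)) (real (Suc k))) = space \<mu>"
    proof -
      have "x \<in> (\<Union>k. E (1 / real (Suc k)) (real (Suc k)))" if "x \<noteq> 0" for x
      proof -
        have p: "N x > 0" using is_norm_pos[OF N that] .
        obtain k where k: "real k > max (N x) (1 / N x)" using reals_Archimedean2 by blast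
        then have "1 / N x < real (Suc k)" by simp
        then have "1 / real (Suc k) < N x" using p by (simp add: field_simps)
        with k show ?thesis by (auto simp: E_def intro!: exI[of _ k])
      qed
      moreover have "0 \<notin> E (1 / real (Suc k)) (real (Suc k))" for k by (simp add: E_def is_norm_zero[OF N])
      moreover have "space \<mu> = - {0}" using sets_eq_imp_space_eq[OF sets_mu] 
        by (simp add: punctured_borel_def space_restrict_space)
      ultimately show ?thesis by blast
    qed
    ultimately show False using nz by simp
  qed
  moreover have "m \<ge> 0" using two by (simp add: m_def F_def)
  ultimately show ?thesis using that[of m] eshell unfolding E_def by simp
qed

text \<open>
  Vague convergence controls the probability of shells only.  With \<open>T\<close> the tail of the norm and
  \<open>m\<close> the constant of the limit measure from \<open>regularly_varying_shell\<close>, it shows for \<open>b > 1\<close> that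
  \<open>T (b * t) / T t\<close> tends to \<open>1 - m * (1 - b powr - \<alpha>)\<close>, where \<open>1 - m\<close> is the mass that
  might escape to infinity.  Limits of such ratios are multiplicative in \<open>b\<close>; comparing \<open>b = 2\<close>
  with \<open>b = 4\<close> leaves only \<open>m = 0\<close> and \<open>m = 1\<close>, and \<open>m\<close> is positive.
\<close>

theorem regularly_varying_imp_regular_tail:
  fixes X :: "'w \<Rightarrow> 'a::euclidean_space"
  assumes "prob_space M" and N: "is_norm N" and rv: "regularly_varying N M X \<alpha> \<mu>"
  shows "regular_tail \<alpha> (tail_prob N M X)"
proof -
  interpret prob_space M by fact
  define T where "T = tail_prob N M X"
  have al: "\<alpha> > 0" and [measurable]: "X \<in> borel_measurable M"
    and vague: "vague_conv (tail_measure N M X) \<mu> at_top" and sets_mu: "sets \<mu> = sets punctured_borel"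
    using rv by (auto simp: regularly_varying_def radon_punctured_def)
  have [measurable]: "N \<in> borel_measurable borel" by (rule is_norm_borel[OF N])
  obtain m where m: "m > 0" 
    "\<And>a b. 0 < a \<Longrightarrow> a \<le> b \<Longrightarrow> emeasure \<mu> {x. a < N x \<and> N x \<le> b} = ennreal (m * (a powr - \<alpha> - b powr - \<alpha>))"
    using regularly_varying_shell[OF assms] by metis
  have m_sets: "{x. a < N x \<and> N x \<le> b} \<in> sets \<mu>" if "0 < a" for a b
    using that by (simp add: sets_mu sets_punctured_borel is_norm_zero[OF N])
  define D where "D a b t = \<P>(\<omega> in M. a * t < N (X \<omega>) \<and> N (X \<omega>) \<le> b * t) / T t" for a b t
  define d where "d a b = m * (a powr - \<alpha> - b powr - \<alpha>)" for a b
  have T0: "T t \<ge> 0" for t by (simp add: T_def)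
  have D0: "D a b t \<ge> 0" for a b t by (simp add: D_def T0)
  define I where "I a b e t = ennreal (1 / T t) * (\<integral>\<^sup>+\<omega>. ennreal (plateau a b e (N (X \<omega> /\<^sub>R t))) \<partial>M)" for a b e t
  define J where "J a b e = (\<integral>\<^sup>+x. ennreal (plateau a b e (N x)) \<partial>\<mu>)" for a b e
  have conv: "(I a b e \<longlongrightarrow> J a b e) at_top" if "0 < a" "e > 0" for a b e
  proof -
    let ?f = "\<lambda>x. plateau a b e (N x)"
    have meas: "?f \<in> borel_measurable borel"
      by (intro borel_measurable_continuous_onI continuous_plateau is_norm_continuous N)
    have "((\<lambda>t. \<integral>\<^sup>+x. ennreal (?f x) \<partial>tail_measure N M X t) \<longlongrightarrow> (\<integral>\<^sup>+x. ennreal (?f x) \<partial>\<mu>)) at_top"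
      using vague unfolding vague_conv_def
    proof (rule allE[of _ ?f], elim mp)
      have "?f x = 0" if "x \<in> - {0} - {x. a \<le> N x \<and> N x \<le> b}" for x
        using plateau_props(3)[OF \<open>e > 0\<close>, of a b "N x"] that by fastforce
      moreover have "{x. a \<le> N x \<and> N x \<le> b} \<subseteq> - {0}" using \<open>0 < a\<close> by (auto simp: is_norm_zero[OF N])
      ultimately show "continuous_on (- {0}) ?f \<and> (\<forall>x. 0 \<le> ?f x) \<and> 
        (\<exists>K. compact K \<and> K \<subseteq> - {0} \<and> (\<forall>x\<in>- {0} - K. ?f x = 0))"
        using compact_norm_shell[OF N, of a b] plateau_props(1)[OF \<open>e > 0\<close>]
          continuous_plateau[OF is_norm_continuous[OF N]] by blast
    qed
    moreover have "?f 0 = 0" using plateau_props(3)[OF \<open>e > 0\<close>, of a b 0] \<open>0 < a\<close> by (auto simp: is_norm_zero[OF N])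
    ultimately show ?thesis using meas
      by (subst (asm) nn_integral_tail_measure) (auto simp: T_def I_def[abs_def] J_def)
  qed
  have D_prob: "ennreal (1 / T t) * (\<integral>\<^sup>+\<omega>. indicator {\<omega>. a * t < N (X \<omega>) \<and> N (X \<omega>) \<le> b * t} \<omega> \<partial>M) = ennreal (D a b t)" for a b t
  proof -
    have "(\<integral>\<^sup>+\<omega>. indicator {\<omega>. a * t < N (X \<omega>) \<and> N (X \<omega>) \<le> b * t} \<omega> \<partial>M) =
      (\<integral>\<^sup>+\<omega>. indicator {\<omega>\<in>space M. a * t < N (X \<omega>) \<and> N (X \<omega>) \<le> b * t} \<omega> \<partial>M)"
      by (intro nn_integral_cong) (auto split: split_indicator)
    also have "\<dots> = ennreal (\<P>(\<omega> in M. a * t < N (X \<omega>) \<and> N (X \<omega>) \<le> b * t))"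
      by (subst nn_integral_indicator) (auto simp: emeasure_eq_measure)
    finally show ?thesis using T0 by (simp add: D_def ennreal_mult'[symmetric])
  qed
  have NX: "N (X \<omega> /\<^sub>R t) = N (X \<omega>) / t" if "t > 0" for \<omega> t
    using that by (simp add: is_norm_scaleR[OF N] divide_inverse mult.commute)
  have up: "I a b e t \<le> ennreal (D a b t)"
    if "t > 0" "e > 0" for a b e t
    unfolding D_prob[symmetric] I_def
  proof (intro mult_left_mono nn_integral_mono)
    fix \<omega>
    show "ennreal (plateau a b e (N (X \<omega> /\<^sub>R t))) \<le> indicator {\<omega>. a * t < N (X \<omega>) \<and> N (X \<omega>) \<le> b * t} \<omega>"
      using plateau_props(2,3)[OF \<open>e > 0\<close>, of a b "N (X \<omega>) / t"] \<open>t > 0\<close> unfolding NX[OF \<open>t > 0\<close>]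
      by (cases "plateau a b e (N (X \<omega>) / t) = 0")
         (auto split: split_indicator simp: pos_less_divide_eq pos_divide_less_eq)
  qed simp
  have lo: "ennreal (D (a + e) (b - e) t) \<le> I a b e t"
    if "t > 0" "e > 0" for a b e t
    unfolding D_prob[symmetric] I_def
  proof (intro mult_left_mono nn_integral_mono)
    fix \<omega>
    show "indicator {\<omega>. (a + e) * t < N (X \<omega>) \<and> N (X \<omega>) \<le> (b - e) * t} \<omega> \<le> ennreal (plateau a b e (N (X \<omega> /\<^sub>R t)))"
      using plateau_props(4)[OF \<open>e > 0\<close>, of a "N (X \<omega>) / t" b] \<open>t > 0\<close> unfolding NX[OF \<open>t > 0\<close>]
      by (auto split: split_indicator simp: pos_le_divide_eq pos_divide_le_eq)
  qed simp
  have mu_up: "J a b e \<le> ennreal (d a b)" if "0 < a" "a \<le> b" "e > 0" for a b e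
  proof -
    have "J a b e \<le> (\<integral>\<^sup>+x. indicator {x. a < N x \<and> N x \<le> b} x \<partial>\<mu>)"
      unfolding J_def
    proof (rule nn_integral_mono)
      fix x show "ennreal (plateau a b e (N x)) \<le> indicator {x. a < N x \<and> N x \<le> b} x"
        using plateau_props(2,3)[OF \<open>e > 0\<close>, of a b "N x"]
        by (cases "plateau a b e (N x) = 0") (auto split: split_indicator)
    qed
    then show ?thesis using m(2) m_sets that by (simp add: d_def)
  qed
  have mu_lo: "ennreal (d (a + e) (b - e)) \<le> J a b e" 
    if "0 < a" "a + e \<le> b - e" "e > 0" for a b e
  proof -
    have "(\<integral>\<^sup>+x. indicator {x. a + e < N x \<and> N x \<le> b - e} x \<partial>\<mu>) \<le> J a b e"
      unfolding J_def
    proof (rule nn_integral_mono)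
      fix x show "indicator {x. a + e < N x \<and> N x \<le> b - e} x \<le> ennreal (plateau a b e (N x))"
        using plateau_props(4)[OF \<open>e > 0\<close>, of a "N x" b] by (auto split: split_indicator)
    qed
    then show ?thesis using m(2)[of "a + e" "b - e"] m_sets[of "a + e" "b - e"] that by (simp add: d_def)
  qed
  have d_cont: "((\<lambda>e. d (a + s * e) (b - s * e)) \<longlongrightarrow> d a b) (at_right 0)" if "0 < a" "a < b" for a b s
  proof -
    have "((\<lambda>e. d (a + s * e) (b - s * e)) \<longlongrightarrow> d (a + s * 0) (b - s * 0)) (at_right 0)"
      unfolding d_def using that by (intro tendsto_intros) auto
    then show ?thesis by simp
  qed
  have D_lim: "(D a b \<longlongrightarrow> d a b) at_top" if ab: "0 < a" "a < b" for a b
  proof (rule order_tendstoI)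
    fix c assume c: "c < d a b"
    \<comment> \<open>From below: a plateau supported in the shell, equal to \<open>1\<close> on a slightly smaller shell.\<close>
    have "eventually (\<lambda>e. c < d (a + 1 * e) (b - 1 * e)) (at_right 0)"
      using order_tendstoD(1)[OF d_cont[OF ab] c] .
    moreover have "eventually (\<lambda>e. e < (b - a) / 2) (at_right 0)"
      using ab by (intro order_tendstoD(2)[OF tendsto_ident_at]) auto
    ultimately have "eventually (\<lambda>e. c < d (a + 1 * e) (b - 1 * e) \<and> e < (b - a) / 2 \<and> 0 < e) (at_right 0)"
      using eventually_at_right_less by eventually_elim auto
    then obtain e where e: "c < d (a + e) (b - e)" "e < (b - a) / 2" "0 < e"
      by (auto dest: eventually_happens)
    have "c < 0 \<or> ennreal c < ennreal (d (a + e) (b - e))"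
      using e by (auto intro: ennreal_lessI)
    then show "eventually (\<lambda>t. c < D a b t) at_top"
    proof
      assume "c < 0" then show ?thesis using D0 by (simp add: less_le_trans)
    next
      assume "ennreal c < ennreal (d (a + e) (b - e))"
      also have "\<dots> \<le> J a b e"
        using e ab by (intro mu_lo) auto
      finally have "eventually (\<lambda>t. ennreal c < I a b e t) at_top"
        using conv e ab by (intro order_tendstoD(1)) auto
      then show ?thesis using eventually_gt_at_top[of 0]
      proof eventually_elim
        case (elim t)
        then have "ennreal c < ennreal (D a b t)" using up e less_le_trans by blast
        then show ?case using D0 ennreal_less_iff[of c] by (meson linorder_not_less ennreal_leI)
      qed
    qed
  next
    fix c assume c: "d a b < c"
    \<comment> \<open>From above: a plateau equal to \<open>1\<close> on the shell, supported in a slightly larger one.\<close>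
    have "eventually (\<lambda>e. d (a + (-1) * e) (b - (-1) * e) < c) (at_right 0)"
      using order_tendstoD(2)[OF d_cont[OF ab] c] .
    moreover have "eventually (\<lambda>e. e < a) (at_right 0)"
      using ab by (intro order_tendstoD(2)[OF tendsto_ident_at]) auto
    ultimately have "eventually (\<lambda>e. d (a + (-1) * e) (b - (-1) * e) < c \<and> e < a \<and> 0 < e) (at_right 0)"
      using eventually_at_right_less by eventually_elim auto
    then obtain e where e: "d (a - e) (b + e) < c" "e < a" "0 < e"
      by (auto dest: eventually_happens)
    have d0: "d (a - e) (b + e) \<ge> 0"
      unfolding d_def using m(1) e ab al by (intro mult_nonneg_nonneg) (auto intro!: powr_mono2')
    have "J (a - e) (b + e) e \<le> ennreal (d (a - e) (b + e))"
      using e ab by (intro mu_up) auto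
    also have "\<dots> < ennreal c" using e d0 by (simp add: ennreal_less_iff)
    finally have "eventually (\<lambda>t. I (a - e) (b + e) e t < ennreal c) at_top"
      using conv e by (intro order_tendstoD(2)) auto
    then show "eventually (\<lambda>t. D a b t < c) at_top" using eventually_gt_at_top[of 0]
    proof eventually_elim
      case (elim t)
      then have "ennreal (D a b t) < ennreal c" using lo[of t e "a - e" "b + e"] e by (simp add: le_less_trans)
      then show ?case using D0 by (simp add: ennreal_less_iff)
    qed
  qed
  have ev_T: "eventually (\<lambda>t. T t > 0) at_top"
  proof -
    have "2 powr - \<alpha> < (1::real)" using al by (simp add: powr_minus_divide)
    then have "d 1 2 > 0" using m(1) by (simp add: d_def)
    then have "eventually (\<lambda>t. D 1 2 t > 0) at_top" using D_lim[of 1 2] by (intro order_tendstoD) auto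
    then show ?thesis
    proof eventually_elim
      case (elim t)
      then have "T t \<noteq> 0" by (auto simp: D_def)
      then show ?case using T0[of t] by simp
    qed
  qed
  have T_ratio: "((\<lambda>t. T (b * t) / T t) \<longlongrightarrow> 1 - d 1 b) at_top" if "b > 1" for b
  proof -
    have "((\<lambda>t. 1 - D 1 b t) \<longlongrightarrow> 1 - d 1 b) at_top" by (intro tendsto_intros D_lim) (use that in auto)
    moreover have "eventually (\<lambda>t. 1 - D 1 b t = T (b * t) / T t) at_top"
      using ev_T eventually_gt_at_top[of 0]
    proof eventually_elim
      case (elim t)
      have "\<P>(\<omega> in M. 1 * t < N (X \<omega>) \<and> N (X \<omega>) \<le> b * t) = 
         measure M ({\<omega>\<in>space M. t < N (X \<omega>)} - {\<omega>\<in>space M. b * t < N (X \<omega>)})"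
        by (intro arg_cong[where f="measure M"]) auto
      also have "\<dots> = T t - T (b * t)" unfolding T_def using that elim
        by (intro finite_measure_Diff) (auto intro: le_less_trans[of t "b * t"])
      finally show ?case using elim by (simp add: D_def field_simps)
    qed
    ultimately show ?thesis by (rule Lim_transform_eventually)
  qed
  have "m = 1"
  proof -
    define x where "x = 2 powr - \<alpha>"
    have x: "x < 1" "4 powr - \<alpha> = x * x"
      using al powr_mult[of 2 2 "-\<alpha>"] by (auto simp: x_def powr_minus_divide)
    have "((\<lambda>t. T (2 * (2 * t)) / T (2 * t) * (T (2 * t) / T t)) \<longlongrightarrow> (1 - d 1 2) * (1 - d 1 2)) at_top"
    proof (intro tendsto_mult T_ratio)
      show "((\<lambda>t. T (2 * (2 * t)) / T (2 * t)) \<longlongrightarrow> (1 - d 1 2)) at_top"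
        by (rule filterlim_compose[OF T_ratio[of 2] filterlim_tendsto_pos_mult_at_top[OF tendsto_const]])
           (auto simp: filterlim_ident)
    qed auto
    moreover have "eventually (\<lambda>t. T (2 * (2 * t)) / T (2 * t) * (T (2 * t) / T t) = T (4 * t) / T t) at_top"
      using filterlim_tendsto_pos_mult_at_top[OF tendsto_const[of 2] _ filterlim_ident, THEN filterlim_iff[THEN iffD1], rule_format, OF _ ev_T] 
      by (auto elim!: eventually_mono)
    ultimately have "((\<lambda>t. T (4 * t) / T t) \<longlongrightarrow> (1 - d 1 2) * (1 - d 1 2)) at_top"
      by (rule Lim_transform_eventually)
    from tendsto_unique[OF _ this T_ratio[of 4]] 
    have "(1 - d 1 2) * (1 - d 1 2) = 1 - d 1 4" by simp
    then have "m * (1 - m) * (1 - x) ^ 2 = 0"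
      unfolding d_def x(2) x_def[symmetric] by (simp add: algebra_simps power2_eq_square)
    then show ?thesis using x m(1) by simp
  qed
  then have gt1: "((\<lambda>t. T (b * t) / T t) \<longlongrightarrow> b powr - \<alpha>) at_top" if "b > 1" for b
    using T_ratio[OF that] by (simp add: d_def)
  have "((\<lambda>t. T (u * t) / T t) \<longlongrightarrow> u powr - \<alpha>) at_top" if "u > 0" for u
  proof (cases u "1 :: real" rule: linorder_cases)
    case greater then show ?thesis by (rule gt1)
  next
    case equal
    have "eventually (\<lambda>t. 1 = T (u * t) / T t) at_top" using ev_T by eventually_elim (simp add: equal)
    then have "((\<lambda>t. T (u * t) / T t) \<longlongrightarrow> 1) at_top" by (rule Lim_transform_eventually[OF tendsto_const])
    then show ?thesis by (simp add: equal)
  next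
    case less
    have "((\<lambda>t. T (1 / u * (u * t)) / T (u * t)) \<longlongrightarrow> (1 / u) powr - \<alpha>) at_top"
      by (rule filterlim_compose[OF gt1 filterlim_tendsto_pos_mult_at_top[OF tendsto_const]])
         (use less that in \<open>auto simp: filterlim_ident\<close>)
    then have "((\<lambda>t. inverse (T (1 / u * (u * t)) / T (u * t))) \<longlongrightarrow> inverse ((1 / u) powr - \<alpha>)) at_top"
      by (rule tendsto_inverse) (use that in auto)
    then show ?thesis using that by (simp add: powr_minus powr_divide)
  qed
  then show ?thesis by (simp add: regular_tail_def T_def)
qed

section \<open>Polar convergence\<close>

text \<open>
  The approximants \<open>g\<close> and \<open>l\<close> may depend on the accuracy, as they do for discretisations and
  truncations.
\<close>

lemma tendsto_approx:
  fixes f :: "'t \<Rightarrow> real"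
  assumes "\<And>e. e > 0 \<Longrightarrow> \<exists>g l. (g \<longlongrightarrow> l) F \<and> eventually (\<lambda>x. \<bar>f x - g x\<bar> \<le> e) F \<and> \<bar>l - L\<bar> \<le> e"
  shows "(f \<longlongrightarrow> L) F"
proof (rule tendstoI)
  fix e :: real assume "e > 0"
  then obtain g l where g: "(g \<longlongrightarrow> l) F" "eventually (\<lambda>x. \<bar>f x - g x\<bar> \<le> e / 4) F" "\<bar>l - L\<bar> \<le> e / 4"
    using assms[of "e / 4"] by auto
  have "eventually (\<lambda>x. dist (g x) l < e / 4) F" using g(1) \<open>e > 0\<close> by (intro tendstoD) auto
  with g(2) show "eventually (\<lambda>x. dist (f x) L < e) F"
    by eventually_elim (use g(3) \<open>e > 0\<close> in \<open>unfold dist_real_def, linarith\<close>)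
qed

lemma integral_cond_direction:
  fixes X :: "'w \<Rightarrow> 'a::euclidean_space"
  assumes "prob_space M" "is_norm N" and [measurable]: "X \<in> borel_measurable M" "g \<in> borel_measurable borel"
    and "tail_prob N M X t > 0"
  shows "(\<integral>x. g x \<partial>cond_direction N M X t) =
    (\<integral>\<omega>. g (X \<omega> /\<^sub>R N (X \<omega>)) * indicator {t<..} (N (X \<omega>)) \<partial>M) / tail_prob N M X t"
proof -
  interpret prob_space M by fact
  have [measurable]: "N \<in> borel_measurable borel" by (rule is_norm_borel[OF assms(2)])
  let ?A = "{\<omega>\<in>space M. N (X \<omega>) > t}"
  let ?p = "tail_prob N M X t"
  have "uniform_measure M ?A = density M (\<lambda>\<omega>. ennreal (indicator ?A \<omega> / ?p))"
    unfolding uniform_measure_def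
    using assms(5) by (intro density_cong) (auto simp: emeasure_eq_measure divide_ennreal[symmetric] split: split_indicator)
  then have "(\<integral>x. g x \<partial>cond_direction N M X t) = (\<integral>\<omega>. (indicator ?A \<omega> / ?p) *\<^sub>R g (X \<omega> /\<^sub>R N (X \<omega>)) \<partial>M)"
    unfolding cond_direction_def by (simp add: integral_distr integral_density)
  also have "\<dots> = (\<integral>\<omega>. (g (X \<omega> /\<^sub>R N (X \<omega>)) * indicator {t<..} (N (X \<omega>))) / ?p \<partial>M)"
    by (intro Bochner_Integration.integral_cong) (auto split: split_indicator)
  finally show ?thesis by simp
qed

lemma spectral_lawD:
  assumes "spectral_law N M X S"
  shows "prob_space S" "sets S = sets borel" 
    "weak_conv_filter (cond_direction N M X) S at_top"
  using assms by (auto simp: spectral_law_def)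

lemma spectral_law_AE:
  fixes X :: "'w \<Rightarrow> 'a::euclidean_space"
  assumes "is_norm N" "spectral_law N M X S"
  shows "AE u in S. N u = 1"
proof -
  interpret prob_space S by (rule spectral_lawD[OF assms(2)])
  have [measurable_cong]: "sets S = sets borel" by (rule spectral_lawD[OF assms(2)])
  have [measurable]: "N \<in> borel_measurable borel" by (rule is_norm_borel[OF assms(1)])
  have "{x. N x = 1} = {x\<in>space S. N x = 1}"
    using sets_eq_imp_space_eq[OF spectral_lawD(2)[OF assms(2)]] by simp
  then have "emeasure S {x\<in>space S. N x = 1} = 1" using assms(2) by (simp add: spectral_law_def)
  then have "prob {x\<in>space S. N x = 1} = 1" by (simp add: measure_def)
  then show ?thesis by (subst (asm) prob_Collect_eq_1) auto
qed

text \<open>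
  Conditioning at the level \<open>u * t\<close> instead of \<open>t\<close> costs the ratio of the two tails, which
  tends to \<open>u powr - \<alpha>\<close>.
\<close>

lemma directional_convergence:
  fixes X :: "'w \<Rightarrow> 'a::euclidean_space"
  assumes "prob_space M" "is_norm N" "X \<in> borel_measurable M"
    and tail: "regular_tail \<alpha> (tail_prob N M X)" and spec: "spectral_law N M X S"
    and g: "continuous_on UNIV g" "bounded (range g)" and u: "u > 0"
  shows "((\<lambda>t. (\<integral>\<omega>. g (X \<omega> /\<^sub>R N (X \<omega>)) * indicator {u * t<..} (N (X \<omega>)) \<partial>M) / tail_prob N M X t)
    \<longlongrightarrow> u powr - \<alpha> * (\<integral>x. g x \<partial>S)) at_top"
proof -
  let ?T = "tail_prob N M X"
  have pos: "?T t > 0" for t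
    by (rule regular_tail_pos[OF tail antimono_tail_prob[OF assms(1-3)]]) auto
  have "((\<lambda>t. \<integral>x. g x \<partial>cond_direction N M X t) \<longlongrightarrow> (\<integral>x. g x \<partial>S)) at_top"
    using spectral_lawD(3)[OF spec] g unfolding weak_conv_filter_def by blast
  then have "((\<lambda>t. \<integral>x. g x \<partial>cond_direction N M X (u * t)) \<longlongrightarrow> (\<integral>x. g x \<partial>S)) at_top"
    by (rule filterlim_compose[OF _ filterlim_tendsto_pos_mult_at_top[OF tendsto_const]])
       (use u in \<open>auto simp: filterlim_ident\<close>)
  from tendsto_mult[OF regular_tailD[OF tail u] this] show ?thesis
    by (rule Lim_transform_eventually)
       (use pos in \<open>simp add: integral_cond_direction[OF assms(1-3) borel_measurable_continuous_onI[OF g(1)]] less_imp_neq[symmetric]\<close>)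
qed

text \<open>
  The function \<open>f\<close> in polar coordinates, with the radius rounded down to a grid of mesh
  \<open>K / m\<close> and cut off beyond \<open>K\<close>.  Indicators of shells are written as differences of indicators of
  half-lines, for which \<open>directional_convergence\<close> provides the limits.
\<close>

definition radial_step :: "('a::real_vector \<Rightarrow> real) \<Rightarrow> real \<Rightarrow> nat \<Rightarrow> real \<Rightarrow> 'a \<Rightarrow> real" where
  "radial_step f K m r u =
     (\<Sum>i<m. f ((K * real i / real m) *\<^sub>R u) * (indicator {K * real i / real m<..} r - indicator {K * real (Suc i) / real m<..} r))"

text \<open>
  On the ball of radius \<open>K\<close> the function \<open>f\<close> is uniformly continuous, so a fine grid achieves
  the accuracy \<open>\<epsilon>\<close>; beyond \<open>K\<close> only the bound \<open>B\<close> is available.  Below \<open>\<delta>\<close> both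
  functions vanish, which keeps the error integrable against the Pareto measure.
\<close>

lemma radial_step_approx:
  fixes N :: "'a::euclidean_space \<Rightarrow> real"
  assumes N: "is_norm N" and f: "test_fun N B \<delta> f" and K: "K > 0" and \<epsilon>: "\<epsilon> > 0"
  obtains m :: nat where "m > 0"
    "\<And>r u. 0 \<le> r \<Longrightarrow> (0 < r \<Longrightarrow> N u = 1) \<Longrightarrow>
       \<bar>f (r *\<^sub>R u) - radial_step f K m r u\<bar> \<le> \<epsilon> * indicator {\<delta><..} r + B * indicator {K<..} r"
proof -
  note tf = test_funD[OF f]
  have f0: "f 0 = 0" using tf(3) tf(7)[of 0] is_norm_zero[OF N] by simp
  obtain c where c: "c > 0" "\<And>x. norm x \<le> c * N x" using norm_le_is_norm[OF N] by blast
  have "uniformly_continuous_on {x. 0 \<le> N x \<and> N x \<le> K} f"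
    by (rule compact_uniformly_continuous[OF continuous_on_subset[OF tf(1)] compact_norm_shell[OF N]]) simp
  then obtain d where d: "d > 0" "\<And>x y. N x \<le> K \<Longrightarrow> N y \<le> K \<Longrightarrow> dist x y < d \<Longrightarrow> \<bar>f x - f y\<bar> < \<epsilon>"
    using \<epsilon> is_norm_nonneg[OF N] unfolding uniformly_continuous_on_def dist_real_def by (metis (lifting) mem_Collect_eq)
  obtain m0 :: nat where m0: "c * K / d < real m0" using reals_Archimedean2 by blast
  define m where "m = Suc m0"
  have m: "m > 0" "c * K / m < d" using m0 d(1) c(1) K by (auto simp: m_def field_simps)
  have "\<bar>f (r *\<^sub>R u) - radial_step f K m r u\<bar> \<le> \<epsilon> * indicator {\<delta><..} r + B * indicator {K<..} r"
    if r: "0 \<le> r" and u: "0 < r \<Longrightarrow> N u = 1" for r u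
  proof -
    define s where "s i = K * real i / real m" for i
    have s_mono: "s i \<le> s j" if "i \<le> j" for i j
      using that K unfolding s_def by (intro divide_right_mono mult_left_mono) auto
    have s0: "s i \<ge> 0" for i using K by (simp add: s_def)
    have step: "radial_step f K m r u = (\<Sum>i<m. f (s i *\<^sub>R u) * (indicator {s i<..} r - indicator {s (Suc i)<..} r))"
      by (simp add: radial_step_def s_def)
    consider "r = 0" | "0 < r" "r \<le> K" | "K < r" using r by linarith
    then show ?thesis
    proof cases
      case 1
      then have "radial_step f K m r u = 0" unfolding step using s0[THEN leD] by (auto intro!: sum.neutral simp: indicator_def)
      then show ?thesis using 1 f0 \<epsilon> tf(6) by simp
    next
      case 3
      have "s i < r" if "i \<le> m" for i
      proof -
        have "s i \<le> s m" using s_mono that .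
        also have "s m = K" using m by (simp add: s_def)
        finally show ?thesis using 3 by simp
      qed
      then have "radial_step f K m r u = 0" unfolding step by (auto intro!: sum.neutral simp: indicator_def)
      then show ?thesis using 3 tf(4)[of "r *\<^sub>R u"] tf(5)[of "r *\<^sub>R u"] \<epsilon> by (simp add: add_increasing)
    next
      case 2
      \<comment> \<open>The shells are open on the left and closed on the right, hence the ceiling.\<close>
      define i where "i = nat (\<lceil>r * m / K\<rceil> - 1)"
      have pos: "r * m / K > 0" using 2 K m by simp
      then have "\<lceil>r * m / K\<rceil> \<ge> 1" by linarith
      then have ri: "real i = of_int \<lceil>r * m / K\<rceil> - 1" by (simp add: i_def)
      have "real i < r * m / K" "r * m / K \<le> real i + 1" unfolding ri by linarith+
      then have si: "s i < r" "r \<le> s (Suc i)" using K m by (auto simp: s_def field_simps)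
      have "i < m"
      proof (rule ccontr)
        assume "\<not> i < m"
        then have "s m \<le> s i" by (intro s_mono) simp
        then show False using si 2 m by (simp add: s_def)
      qed
      have "radial_step f K m r u = (\<Sum>j<m. if j = i then f (s i *\<^sub>R u) else 0)"
        unfolding step
      proof (intro sum.cong refl)
        fix j
        consider "j = i" | "j < i" | "i < j" by linarith
        then show "f (s j *\<^sub>R u) * (indicator {s j<..} r - indicator {s (Suc j)<..} r) = (if j = i then f (s i *\<^sub>R u) else 0)"
        proof cases
          case 2 then show ?thesis using s_mono[of "Suc j" i] s_mono[of j i] si by (simp add: indicator_def)
        next
          case 3 then show ?thesis using s_mono[of "Suc i" j] s_mono[of "Suc i" "Suc j"] si by (simp add: indicator_def)
        qed (use si in \<open>simp add: indicator_def\<close>)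
      qed
      also have "\<dots> = f (s i *\<^sub>R u)" using \<open>i < m\<close> by simp
      finally have eq: "radial_step f K m r u = f (s i *\<^sub>R u)" .
      have Nu: "N u = 1" using u 2 by simp
      have N1: "N (r *\<^sub>R u) = r" "N (s i *\<^sub>R u) = s i" using 2 Nu s0 by (simp_all add: is_norm_scaleR[OF N])
      show ?thesis
      proof (cases "\<delta> < r")
        case False
        then have "f (r *\<^sub>R u) = 0" "f (s i *\<^sub>R u) = 0" using N1 si by (auto intro!: tf(7))
        then show ?thesis using eq 2 \<epsilon> tf(6) by simp
      next
        case True
        have "dist (r *\<^sub>R u) (s i *\<^sub>R u) = \<bar>r - s i\<bar> * norm u"
          by (simp add: dist_norm scaleR_diff_left[symmetric])
        also have "\<dots> \<le> K / m * c"
        proof (intro mult_mono)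
          have "s (Suc i) - s i = K / m" by (simp add: s_def diff_divide_distrib[symmetric] algebra_simps)
          then show "\<bar>r - s i\<bar> \<le> K / m" using si by simp
          show "norm u \<le> c" using c(2)[of u] Nu by simp
        qed (use K in auto)
        also have "\<dots> < d" using m by (simp add: mult.commute)
        finally have "\<bar>f (r *\<^sub>R u) - f (s i *\<^sub>R u)\<bar> < \<epsilon>" using N1 si 2 by (intro d(2)) auto
        then show ?thesis using eq True 2 by simp
      qed
    qed
  qed
  with m(1) show ?thesis using that by blast
qed

text \<open>
  The counterpart of \<open>radial_step_approx\<close> for the limit measure.
\<close>

lemma radial_integral_approx:
  fixes N :: "'a::euclidean_space \<Rightarrow> real"
  assumes N: "is_norm N" and \<alpha>: "\<alpha> > 0" and f: "test_fun N B \<delta> f" and K: "K > 0" and m: "m > 0"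
    and approx: "\<And>r. 0 < r \<Longrightarrow>
       \<bar>f (r *\<^sub>R u) - radial_step f K m r u\<bar> \<le> \<epsilon> * indicator {\<delta><..} r + B * indicator {K<..} r"
  shows "\<bar>(\<Sum>i<m. ((K * real i / real m) powr - \<alpha> - (K * real (Suc i) / real m) powr - \<alpha>) * f ((K * real i / real m) *\<^sub>R u))
    - radial_integral \<alpha> f u\<bar> \<le> \<epsilon> * \<delta> powr - \<alpha> + B * K powr - \<alpha>"
proof -
  note tf = test_funD[OF f]
  have f0: "f 0 = 0" using tf(3) tf(7)[of 0] is_norm_zero[OF N] by simp
  define s where "s i = K * real i / m" for i
  have s_pos: "s i > 0" if "i > 0" for i using that K m by (simp add: s_def)
  let ?l = "\<Sum>i<m. (s i powr - \<alpha> - s (Suc i) powr - \<alpha>) * f (s i *\<^sub>R u)"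
  have em: "emeasure (pareto \<alpha>) {a<..} = ennreal (a powr - \<alpha>)" "measure (pareto \<alpha>) {a<..} = a powr - \<alpha>" if "a > 0" for a
    using emeasure_pareto_greaterThan[OF \<alpha> that] measure_pareto_greaterThan[OF \<alpha> that] by auto
  have ii: "integrable (pareto \<alpha>) (\<lambda>r. indicator {a<..} r :: real)" if "a > 0" for a
    using em[OF that] by (intro integrable_real_indicator) auto
  have st: "has_bochner_integral (pareto \<alpha>) (\<lambda>r. f (s i *\<^sub>R u) * (indicator {s i<..} r - indicator {s (Suc i)<..} r))
     ((s i powr - \<alpha> - s (Suc i) powr - \<alpha>) * f (s i *\<^sub>R u))" for i
  proof (cases "i = 0")
    case True then show ?thesis by (simp add: s_def f0 has_bochner_integral_zero)
  next
    case False
    then have p: "s i > 0" "s (Suc i) > 0" using s_pos by auto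
    show ?thesis
      using p ii em by (simp add: has_bochner_integral_iff algebra_simps)
  qed
  have hs: "has_bochner_integral (pareto \<alpha>) (\<lambda>r. radial_step f K m r u) (?l)"
    unfolding radial_step_def s_def[symmetric] by (intro has_bochner_integral_sum st)
  have "\<bar>radial_integral \<alpha> f u - ?l\<bar> = \<bar>\<integral>r. f (r *\<^sub>R u) - radial_step f K m r u \<partial>pareto \<alpha>\<bar>"
    unfolding radial_integral_def using hs radial_integrable[OF \<alpha> N f, of u]
    by (simp add: has_bochner_integral_iff)
  also have "\<dots> \<le> (\<integral>r. \<bar>f (r *\<^sub>R u) - radial_step f K m r u\<bar> \<partial>pareto \<alpha>)"
    by (rule integral_abs_bound)
  also have "\<dots> \<le> (\<integral>r. \<epsilon> * indicator {\<delta><..} r + B * indicator {K<..} r \<partial>pareto \<alpha>)"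
  proof (rule integral_mono_AE)
    show "AE r in pareto \<alpha>. \<bar>f (r *\<^sub>R u) - radial_step f K m r u\<bar> \<le> \<epsilon> * indicator {\<delta><..} r + B * indicator {K<..} r"
      using AE_pareto_pos by eventually_elim (rule approx)
  qed (use hs radial_integrable[OF \<alpha> N f, of u] ii tf(3) K in \<open>auto simp: has_bochner_integral_iff\<close>)
  also have "\<dots> = \<epsilon> * \<delta> powr - \<alpha> + B * K powr - \<alpha>"
    using ii em tf(3) K by simp
  finally show ?thesis unfolding s_def by (simp add: abs_minus_commute)
qed

text \<open>
  The tail describes the radius and the spectral law the direction, and the point is that they
  combine to joint convergence.  For a radial step function this is a finite sum of instances of
  \<open>directional_convergence\<close>.  The error of replacing \<open>f\<close> by such a function is at most \<open>\<epsilon>\<close> on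
  radii above \<open>\<delta>\<close> and \<open>B\<close> on radii above \<open>K\<close>, both before and in the limit, and the limit
  measures of these two sets are \<open>\<delta> powr - \<alpha>\<close> and \<open>K powr - \<alpha>\<close>.
\<close>

theorem polar_convergence:
  fixes X :: "'w \<Rightarrow> 'a::euclidean_space"
  assumes "prob_space M" and N: "is_norm N" and X [measurable]: "X \<in> borel_measurable M" and \<alpha>: "\<alpha> > 0"
    and tail: "regular_tail \<alpha> (tail_prob N M X)" and spec: "spectral_law N M X S"
    and f: "test_fun N B \<delta> f"
  shows "((\<lambda>t. (\<integral>\<omega>. f (X \<omega> /\<^sub>R t) \<partial>M) / tail_prob N M X t) \<longlongrightarrow> (\<integral>u. radial_integral \<alpha> f u \<partial>S)) at_top"
proof (rule tendsto_approx)
  interpret prob_space M by fact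
  interpret S: prob_space S by (rule spectral_lawD[OF spec])
  interpret P: sigma_finite_measure "pareto \<alpha>" by (rule sigma_finite_pareto)
  note [measurable_cong] = spectral_lawD(2)[OF spec]
  have [measurable]: "N \<in> borel_measurable borel" by (rule is_norm_borel[OF N])
  note tf = test_funD[OF f]
  have [measurable]: "f \<in> borel_measurable borel" by (rule tf)
  have f0: "f 0 = 0" using tf(3) tf(7)[of 0] is_norm_zero[OF N] by simp
  define T where "T = tail_prob N M X"
  have T_pos: "T t > 0" for t
    unfolding T_def by (rule regular_tail_pos[OF tail antimono_tail_prob[OF assms(1-3)]]) auto
  fix \<eta> :: real assume \<eta>: "\<eta> > 0"
  let ?U = "\<lambda>\<omega>. X \<omega> /\<^sub>R N (X \<omega>)"
  \<comment> \<open>The radii above \<open>\<delta>\<close> have mass \<open>\<delta> powr - \<alpha>\<close>, so they contribute the error \<open>\<eta> / 4\<close>.\<close>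
  define \<epsilon> where "\<epsilon> = \<eta> * \<delta> powr \<alpha> / 4"
  have \<epsilon>: "\<epsilon> > 0" "\<epsilon> * \<delta> powr - \<alpha> = \<eta> / 4"
    using \<eta> tf(3) by (auto simp: \<epsilon>_def powr_minus field_simps)
  have "((\<lambda>K::real. B * K powr - \<alpha>) \<longlongrightarrow> B * 0) at_top"
    using \<alpha> by (intro tendsto_mult tendsto_const tendsto_neg_powr filterlim_ident) auto
  then have "eventually (\<lambda>K::real. B * K powr - \<alpha> < \<eta> / 4 \<and> K > 0) at_top"
    using \<eta> by (intro eventually_conj order_tendstoD(2) eventually_gt_at_top) auto
  then obtain K where K: "K > 0" "B * K powr - \<alpha> < \<eta> / 4" by (auto dest: eventually_happens)
  obtain m where m: "m > 0" 
    "\<And>r u. 0 \<le> r \<Longrightarrow> (0 < r \<Longrightarrow> N u = 1) \<Longrightarrow>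
       \<bar>f (r *\<^sub>R u) - radial_step f K m r u\<bar> \<le> \<epsilon> * indicator {\<delta><..} r + B * indicator {K<..} r"
    using radial_step_approx[OF N f K(1) \<epsilon>(1)] by metis
  define s where "s i = K * real i / real m" for i
  have s_pos: "s i > 0" if "i > 0" for i using that K m by (simp add: s_def)
  define g where "g t = (\<integral>\<omega>. radial_step f K m (N (X \<omega>) / t) (?U \<omega>) \<partial>M) / T t" for t
  define l where "l = (\<Sum>i<m. (s i powr - \<alpha> - s (Suc i) powr - \<alpha>) * (\<integral>u. f (s i *\<^sub>R u) \<partial>S))"
  have step_meas [measurable]: "(\<lambda>x. radial_step f K m (p x) (q x)) \<in> borel_measurable L" 
    if [measurable]: "p \<in> borel_measurable L" "q \<in> borel_measurable L" for L and p :: "'l \<Rightarrow> real" and q :: "'l \<Rightarrow> 'a"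
    unfolding radial_step_def by measurable
  have step_bd: "\<bar>radial_step f K m r u\<bar> \<le> m * B" for r u
  proof -
    have "\<bar>radial_step f K m r u\<bar> \<le> (\<Sum>i<m. B)"
      unfolding radial_step_def
    proof (rule order_trans[OF sum_abs sum_mono])
      fix i
      have "\<bar>f ((K * real i / real m) *\<^sub>R u)\<bar> * \<bar>indicator {K * real i / real m<..} r - indicator {K * real (Suc i) / real m<..} r\<bar> \<le> B * 1"
        using tf(4,5,6) by (intro mult_mono) (auto split: split_indicator)
      then show "\<bar>f ((K * real i / real m) *\<^sub>R u) * (indicator {K * real i / real m<..} r - indicator {K * real (Suc i) / real m<..} r)\<bar> \<le> B"
        by (simp add: abs_mult)
    qed
    then show ?thesis by simp
  qed
  have int: "integrable M h" if [measurable]: "h \<in> borel_measurable M" and "\<And>\<omega>. \<bar>h \<omega>\<bar> \<le> C" for h :: "'w \<Rightarrow> real" and C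
    using that by (intro integrable_const_bound[of _ C]) auto
  have intS: "integrable S h" if [measurable]: "h \<in> borel_measurable borel" and "\<And>\<omega>. \<bar>h \<omega>\<bar> \<le> C" for h :: "'a \<Rightarrow> real" and C
    using that by (intro S.integrable_const_bound[of _ C]) auto
  have fbd: "\<bar>f x\<bar> \<le> B" for x using tf(4,5) by simp
  have fs: "continuous_on UNIV (\<lambda>u. f (s i *\<^sub>R u))" "bounded (range (\<lambda>u. f (s i *\<^sub>R u)))" for i
  proof -
    show "continuous_on UNIV (\<lambda>u. f (s i *\<^sub>R u))"
      by (intro continuous_on_compose2[OF tf(1)] continuous_intros) auto
    show "bounded (range (\<lambda>u. f (s i *\<^sub>R u)))"
      using fbd by (intro boundedI[of _ B]) auto
  qed
  have "(g \<longlongrightarrow> l) at_top"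
  proof -
    let ?I = "\<lambda>i a t. (\<integral>\<omega>. f (s i *\<^sub>R (?U \<omega>)) * indicator {a * t<..} (N (X \<omega>)) \<partial>M) / T t"
    have term_lim: "((\<lambda>t. ?I i (s i) t - ?I i (s (Suc i)) t) \<longlongrightarrow> (s i powr - \<alpha> - s (Suc i) powr - \<alpha>) * (\<integral>u. f (s i *\<^sub>R u) \<partial>S)) at_top" for i
    proof (cases "i = 0")
      case True
      then show ?thesis by (simp add: s_def f0)
    next
      case False
      show ?thesis unfolding left_diff_distrib T_def
        by (intro tendsto_diff directional_convergence assms fs s_pos) (use False in auto)
    qed
    have "((\<lambda>t. \<Sum>i<m. ?I i (s i) t - ?I i (s (Suc i)) t) \<longlongrightarrow> l) at_top"
      unfolding l_def by (intro tendsto_sum term_lim)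
    moreover have "eventually (\<lambda>t. (\<Sum>i<m. ?I i (s i) t - ?I i (s (Suc i)) t) = g t) at_top"
      using eventually_gt_at_top[of 0]
    proof eventually_elim
      case (elim t)
      have "radial_step f K m (N (X \<omega>) / t) (?U \<omega>) = 
        (\<Sum>i<m. f (s i *\<^sub>R (?U \<omega>)) * indicator {s i * t<..} (N (X \<omega>)) -
           f (s i *\<^sub>R (?U \<omega>)) * indicator {s (Suc i) * t<..} (N (X \<omega>)))" for \<omega>
      proof -
        have ind: "indicator {a<..} (N (X \<omega>) / t) = (indicator {a * t<..} (N (X \<omega>)) :: real)" for a
          using elim by (auto split: split_indicator simp: pos_less_divide_eq)
        show ?thesis unfolding radial_step_def ind s_def by (simp add: right_diff_distrib)
      qed
      then have "(\<integral>\<omega>. radial_step f K m (N (X \<omega>) / t) (?U \<omega>) \<partial>M) =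
         (\<Sum>i<m. (\<integral>\<omega>. f (s i *\<^sub>R (?U \<omega>)) * indicator {s i * t<..} (N (X \<omega>)) \<partial>M) -
           (\<integral>\<omega>. f (s i *\<^sub>R (?U \<omega>)) * indicator {s (Suc i) * t<..} (N (X \<omega>)) \<partial>M))"
      proof (simp only:, subst Bochner_Integration.integral_sum)
        have i1: "integrable M (\<lambda>\<omega>. f (s i *\<^sub>R (?U \<omega>)) * indicator {a<..} (N (X \<omega>)))" for i a
          by (rule int[of _ B]) (use fbd tf(6) in \<open>auto simp: abs_mult split: split_indicator\<close>)
        show "integrable M (\<lambda>\<omega>. f (s i *\<^sub>R (?U \<omega>)) * indicator {s i * t<..} (N (X \<omega>)) -
           f (s i *\<^sub>R (?U \<omega>)) * indicator {s (Suc i) * t<..} (N (X \<omega>)))" for i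
          by (intro Bochner_Integration.integrable_diff i1)
        show "(\<Sum>i<m. \<integral>\<omega>. f (s i *\<^sub>R (?U \<omega>)) * indicator {s i * t<..} (N (X \<omega>)) -
           f (s i *\<^sub>R (?U \<omega>)) * indicator {s (Suc i) * t<..} (N (X \<omega>)) \<partial>M) = 
          (\<Sum>i<m. (\<integral>\<omega>. f (s i *\<^sub>R (?U \<omega>)) * indicator {s i * t<..} (N (X \<omega>)) \<partial>M) -
           (\<integral>\<omega>. f (s i *\<^sub>R (?U \<omega>)) * indicator {s (Suc i) * t<..} (N (X \<omega>)) \<partial>M))"
          by (intro sum.cong refl Bochner_Integration.integral_diff i1)
      qed
      then show ?case by (simp add: g_def sum_divide_distrib diff_divide_distrib)
    qed
    ultimately show ?thesis by (rule Lim_transform_eventually)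
  qed
  moreover have "eventually (\<lambda>t. \<bar>(\<integral>\<omega>. f (X \<omega> /\<^sub>R t) \<partial>M) / T t - g t\<bar> \<le> \<eta>) at_top"
  proof -
    have "((\<lambda>t. \<epsilon> * (T (\<delta> * t) / T t) + B * (T (K * t) / T t)) \<longlongrightarrow> \<epsilon> * \<delta> powr - \<alpha> + B * K powr - \<alpha>) at_top"
      unfolding T_def by (intro tendsto_intros regular_tailD[OF tail] tf K)
    then have "eventually (\<lambda>t. \<epsilon> * (T (\<delta> * t) / T t) + B * (T (K * t) / T t) < \<eta>) at_top"
      by (rule order_tendstoD(2)) (use \<epsilon> K \<eta> in linarith)
    then show ?thesis using eventually_gt_at_top[of 0]
    proof eventually_elim
      case (elim t)
      have i1: "integrable M (\<lambda>\<omega>. f (X \<omega> /\<^sub>R t))" by (rule int[OF _ fbd]) measurable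
      have i2: "integrable M (\<lambda>\<omega>. radial_step f K m (N (X \<omega>) / t) (?U \<omega>))"
        by (rule int[OF _ step_bd]) measurable
      have [simp]: "{\<omega>. a < N (X \<omega>)} \<inter> space M = {\<omega>\<in>space M. a < N (X \<omega>)}" for a by auto
      have ind: "(\<lambda>\<omega>. indicator {a<..} (N (X \<omega>))) = (\<lambda>\<omega>. indicator {\<omega>. a < N (X \<omega>)} \<omega> :: real)" for a
        by (auto split: split_indicator)
      have i3: "integrable M (\<lambda>\<omega>. indicator {a<..} (N (X \<omega>)) :: real)" 
        and e3: "(\<integral>\<omega>. indicator {a<..} (N (X \<omega>)) \<partial>M) = T a" for a
        by (rule int[of _ 1]; auto split: split_indicator) (simp add: ind T_def)
      have "\<bar>(\<integral>\<omega>. f (X \<omega> /\<^sub>R t) \<partial>M) - (\<integral>\<omega>. radial_step f K m (N (X \<omega>) / t) (?U \<omega>) \<partial>M)\<bar> 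
        = \<bar>\<integral>\<omega>. f (X \<omega> /\<^sub>R t) - radial_step f K m (N (X \<omega>) / t) (?U \<omega>) \<partial>M\<bar>"
        using i1 i2 by simp
      also have "\<dots> \<le> (\<integral>\<omega>. \<epsilon> * indicator {\<delta> * t<..} (N (X \<omega>)) + B * indicator {K * t<..} (N (X \<omega>)) \<partial>M)"
      proof (rule order_trans[OF integral_abs_bound integral_mono])
        show "integrable M (\<lambda>\<omega>. \<bar>f (X \<omega> /\<^sub>R t) - radial_step f K m (N (X \<omega>) / t) (?U \<omega>)\<bar>)"
          using i1 i2 by simp
        show "integrable M (\<lambda>\<omega>. \<epsilon> * indicator {\<delta> * t<..} (N (X \<omega>)) + B * indicator {K * t<..} (N (X \<omega>)))"
          using i3 by simp
        fix \<omega>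
        have ind: "indicator {a<..} (N (X \<omega>) / t) = (indicator {a * t<..} (N (X \<omega>)) :: real)" for a
          using elim by (auto split: split_indicator simp: pos_less_divide_eq)
        have eq: "X \<omega> /\<^sub>R t = (N (X \<omega>) / t) *\<^sub>R (?U \<omega>)"
          by (cases "X \<omega> = 0") (use is_norm_pos[OF N, of "X \<omega>"] in \<open>auto simp: divide_inverse\<close>)
        show "\<bar>f (X \<omega> /\<^sub>R t) - radial_step f K m (N (X \<omega>) / t) (?U \<omega>)\<bar> \<le> 
           \<epsilon> * indicator {\<delta> * t<..} (N (X \<omega>)) + B * indicator {K * t<..} (N (X \<omega>))"
          unfolding eq ind[symmetric]
        proof (rule m(2))
          show "0 \<le> N (X \<omega>) / t" using is_norm_nonneg[OF N] elim by simp
          assume "0 < N (X \<omega>) / t"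
          then have "X \<omega> \<noteq> 0" by (auto simp: is_norm_zero[OF N])
          then show "N (?U \<omega>) = 1" by (rule is_norm_normalize[OF N])
        qed
      qed
      also have "\<dots> = \<epsilon> * T (\<delta> * t) + B * T (K * t)"
        using i3 by (simp add: e3)
      finally have "\<bar>(\<integral>\<omega>. f (X \<omega> /\<^sub>R t) \<partial>M) / T t - g t\<bar> \<le> (\<epsilon> * T (\<delta> * t) + B * T (K * t)) / T t"
        unfolding g_def diff_divide_distrib[symmetric] abs_divide using T_pos[of t]
        by (simp add: divide_right_mono)
      also have "\<dots> < \<eta>" using elim by (simp add: add_divide_distrib)
      finally show ?case by simp
    qed
  qed
  moreover have "\<bar>l - (\<integral>u. radial_integral \<alpha> f u \<partial>S)\<bar> \<le> \<eta>"
  proof -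
    let ?l = "\<lambda>u. \<Sum>i<m. (s i powr - \<alpha> - s (Suc i) powr - \<alpha>) * f (s i *\<^sub>R u)"
    have i1: "integrable S (\<lambda>u. f (s i *\<^sub>R u))" for i by (rule intS[OF _ fbd]) measurable
    then have l_int: "l = (\<integral>u. ?l u \<partial>S)" "integrable S ?l"
      unfolding l_def by auto
    have i2: "integrable S (radial_integral \<alpha> f)"
    proof (rule S.integrable_const_bound)
      show "AE u in S. norm (radial_integral \<alpha> f u) \<le> B * (1 / \<delta>) powr \<alpha>"
        using spectral_law_AE[OF N spec]
      proof eventually_elim
        case (elim u)
        then show ?case using radial_integral_nonneg[OF \<alpha> N f, of u] radial_integral_le[OF \<alpha> N f, of u] by simp
      qed
    qed measurable
    have "\<bar>\<integral>u. ?l u - radial_integral \<alpha> f u \<partial>S\<bar> \<le> (\<integral>u. \<eta> \<partial>S)"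
    proof (rule order_trans[OF integral_abs_bound], rule integral_mono_AE)
      show "AE u in S. \<bar>?l u - radial_integral \<alpha> f u\<bar> \<le> \<eta>"
        using spectral_law_AE[OF N spec]
      proof eventually_elim
        case (elim u)
        have "\<bar>?l u - radial_integral \<alpha> f u\<bar> \<le> \<epsilon> * \<delta> powr - \<alpha> + B * K powr - \<alpha>"
          unfolding s_def by (rule radial_integral_approx[OF N \<alpha> f K(1) m(1)]) (rule m(2), use elim in auto)
        also have "\<dots> \<le> \<eta>" using \<epsilon> K \<eta> by simp
        finally show ?case .
      qed
    qed (use l_int i2 in auto)
    then show ?thesis using l_int i2 \<eta> by (simp add: S.prob_space)
  qed
  ultimately show "\<exists>g l. (g \<longlongrightarrow> l) at_top \<and> 
     eventually (\<lambda>t. \<bar>(\<integral>\<omega>. f (X \<omega> /\<^sub>R t) \<partial>M) / tail_prob N M X t - g t\<bar> \<le> \<eta>) at_top \<and>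
     \<bar>l - (\<integral>u. radial_integral \<alpha> f u \<partial>S)\<bar> \<le> \<eta>"
    unfolding T_def by blast
qed


text \<open>
  A test function of vague convergence may be discontinuous and take any value at the origin.
\<close>

lemma punctured_test_fun:
  fixes N :: "'a::euclidean_space \<Rightarrow> real"
  assumes N: "is_norm N" and f: "continuous_on (- {0}) f" "\<And>x. 0 \<le> f x"
    and K: "compact K" "K \<subseteq> - {0}" "\<And>x. x \<in> - {0} - K \<Longrightarrow> f x = 0"
  obtains B \<delta> where "test_fun N B \<delta> (\<lambda>x. if x = 0 then 0 else f x)"
proof -
  define h where "h x = (if x = 0 then 0 else f x)" for x
  obtain B where B: "B \<ge> 0" "\<And>x. x \<in> K \<Longrightarrow> f x \<le> B"
  proof (cases "K = {}")
    case False
    then obtain x where "x \<in> K" "\<And>y. y \<in> K \<Longrightarrow> f y \<le> f x"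
      using continuous_attains_sup[OF K(1) False continuous_on_subset[OF f(1) K(2)]] by blast
    then show ?thesis using that[of "f x"] f(2) by blast
  qed (use that[of 0] in auto)
  obtain \<delta> where \<delta>: "\<delta> > 0" "\<And>x. x \<in> K \<Longrightarrow> \<delta> < N x"
    using compact_punctured_bounded_away[OF N K(1,2)] by blast
  have h0: "h x = 0" if "x \<notin> K" for x using K(3)[of x] that by (auto simp: h_def)
  have "continuous_on ({x. N x < \<delta>} \<union> - {0}) h"
  proof (rule continuous_on_open_Un)
    show "open {x. N x < \<delta>}"
      by (intro open_Collect_less is_norm_continuous[OF N] continuous_intros)
    have "h x = 0" if "x \<in> {x. N x < \<delta>}" for x using \<delta>(2)[of x] that by (intro h0) auto
    then show "continuous_on {x. N x < \<delta>} h"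
      by (subst continuous_on_cong[OF refl, where g="\<lambda>_. 0"]) auto
    show "continuous_on (- {0}) h"
      using f(1) by (subst continuous_on_cong[OF refl, where g=f]) (auto simp: h_def)
  qed auto
  moreover have "{x. N x < \<delta>} \<union> - {0} = UNIV" using \<delta>(1) is_norm_zero[OF N] by auto
  moreover have "h x = 0" if "N x \<le> \<delta>" for x using \<delta>(2)[of x] that by (intro h0) auto
  moreover have "0 \<le> h x \<and> h x \<le> B" for x
    using f(2)[of x] B h0[of x] by (cases "x \<in> K") (auto simp: h_def)
  ultimately have "test_fun N B \<delta> h" using \<delta>(1) by (simp add: test_fun_def)
  then show ?thesis using that unfolding h_def[abs_def] by blast
qed

definition polar_measure :: "real \<Rightarrow> 'a::euclidean_space measure \<Rightarrow> 'a measure" where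
  "polar_measure \<alpha> S = restrict_space (distr (S \<Otimes>\<^sub>M pareto \<alpha>) borel (\<lambda>(u, r). r *\<^sub>R u)) (- {0})"

lemma sets_polar_measure: "sets (polar_measure \<alpha> S) = sets punctured_borel"
  unfolding polar_measure_def punctured_borel_def by (intro sets_restrict_space_cong) simp

lemma nn_integral_polar_measure:
  fixes S :: "'a::euclidean_space measure"
  assumes [measurable_cong]: "sets S = sets borel" and f [measurable]: "f \<in> borel_measurable borel" and "f 0 = 0"
  shows "(\<integral>\<^sup>+x. f x \<partial>polar_measure \<alpha> S) = (\<integral>\<^sup>+u. \<integral>\<^sup>+r. f (r *\<^sub>R u) \<partial>pareto \<alpha> \<partial>S)"
proof -
  interpret sigma_finite_measure "pareto \<alpha>" by (rule sigma_finite_pareto)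
  have [measurable]: "(\<lambda>(u, r). r *\<^sub>R u) \<in> S \<Otimes>\<^sub>M pareto \<alpha> \<rightarrow>\<^sub>M borel" by measurable
  have "(\<integral>\<^sup>+x. f x \<partial>polar_measure \<alpha> S) = (\<integral>\<^sup>+x. f x * indicator (- {0}) x \<partial>distr (S \<Otimes>\<^sub>M pareto \<alpha>) borel (\<lambda>(u, r). r *\<^sub>R u))"
    unfolding polar_measure_def by (subst nn_integral_restrict_space) auto
  also have "(\<lambda>x. f x * indicator (- {0}) x) = f" using assms(3) by (auto split: split_indicator)
  also have "(\<integral>\<^sup>+x. f x \<partial>distr (S \<Otimes>\<^sub>M pareto \<alpha>) borel (\<lambda>(u, r). r *\<^sub>R u)) = 
      (\<integral>\<^sup>+p. (\<lambda>(u, r). f (r *\<^sub>R u)) p \<partial>(S \<Otimes>\<^sub>M pareto \<alpha>))"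
    by (subst nn_integral_distr) (auto simp: case_prod_beta intro!: nn_integral_cong)
  also have "\<dots> = (\<integral>\<^sup>+u. \<integral>\<^sup>+r. f (r *\<^sub>R u) \<partial>pareto \<alpha> \<partial>S)"
    by (subst nn_integral_fst[symmetric]) auto
  finally show ?thesis .
qed

text \<open>
  Integration against \<open>polar_measure\<close> is integration of \<open>radial_integral\<close> against the spectral
  law, so vague convergence is an instance of \<open>polar_convergence\<close>, and homogeneity is inherited
  from the Pareto measure.
\<close>

theorem polar_imp_regularly_varying:
  fixes X :: "'w \<Rightarrow> 'a::euclidean_space"
  assumes "prob_space M" and N: "is_norm N" and X [measurable]: "X \<in> borel_measurable M" and \<alpha>: "\<alpha> > 0"
    and tail: "regular_tail \<alpha> (tail_prob N M X)" and spec: "spectral_law N M X S"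
  shows "regularly_varying N M X \<alpha> (polar_measure \<alpha> S)"
  unfolding regularly_varying_def
proof (intro conjI allI impI ballI)
  interpret prob_space M by fact
  interpret S: prob_space S by (rule spectral_lawD[OF spec])
  interpret P: sigma_finite_measure "pareto \<alpha>" by (rule sigma_finite_pareto)
  note sS [measurable_cong] = spectral_lawD(2)[OF spec]
  have [measurable]: "N \<in> borel_measurable borel" by (rule is_norm_borel[OF N])
  let ?\<mu> = "polar_measure \<alpha> S"
  have em: "emeasure ?\<mu> A = (\<integral>\<^sup>+u. \<integral>\<^sup>+r. indicator A (r *\<^sub>R u) \<partial>pareto \<alpha> \<partial>S)" if "A \<in> sets ?\<mu>" for A
  proof -
    have "A \<in> sets borel" "0 \<notin> A" using that by (auto simp: sets_polar_measure sets_punctured_borel)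
    then have "(indicator A :: 'a \<Rightarrow> ennreal) \<in> borel_measurable borel" by measurable
    with \<open>0 \<notin> A\<close> show ?thesis
      using nn_integral_polar_measure[OF sS, of "indicator A" \<alpha>] that by simp
  qed
  have tails: "emeasure ?\<mu> {x. a < N x} = ennreal (a powr - \<alpha>)" if "a > 0" for a
  proof -
    have "emeasure ?\<mu> {x. a < N x} = (\<integral>\<^sup>+u. \<integral>\<^sup>+r. indicator {x. a < N x} (r *\<^sub>R u) \<partial>pareto \<alpha> \<partial>S)"
      using that by (intro em) (simp add: sets_polar_measure sets_punctured_borel is_norm_zero[OF N])
    also have "\<dots> = (\<integral>\<^sup>+u. ennreal (a powr - \<alpha>) \<partial>S)"
    proof (rule nn_integral_cong_AE, use spectral_law_AE[OF N spec] in eventually_elim)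
      fix u assume u: "N u = 1"
      have "(\<integral>\<^sup>+r. indicator {x. a < N x} (r *\<^sub>R u) \<partial>pareto \<alpha>) = (\<integral>\<^sup>+r. indicator {a<..} r \<partial>pareto \<alpha>)"
        by (rule nn_integral_cong_AE, use AE_pareto_pos in eventually_elim)
           (auto simp: is_norm_scaleR[OF N] u split: split_indicator)
      then show "(\<integral>\<^sup>+r. indicator {x. a < N x} (r *\<^sub>R u) \<partial>pareto \<alpha>) = ennreal (a powr - \<alpha>)"
        using emeasure_pareto_greaterThan[OF \<alpha> that] by simp
    qed
    finally show ?thesis by (simp add: S.emeasure_space_1)
  qed
  show "\<alpha> > 0" "X \<in> borel_measurable M" by fact+
  show "radon_punctured ?\<mu>"
    unfolding radon_punctured_def
  proof (intro conjI allI impI)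
    show "sets ?\<mu> = sets punctured_borel" by (rule sets_polar_measure)
    fix K :: "'a set" assume "compact K \<and> K \<subseteq> - {0}"
    then have K: "compact K" "K \<subseteq> - {0}" by auto
    obtain \<delta> where \<delta>: "\<delta> > 0" "\<And>x. x \<in> K \<Longrightarrow> \<delta> < N x"
      using compact_punctured_bounded_away[OF N K] by blast
    have "emeasure ?\<mu> K \<le> emeasure ?\<mu> {x. \<delta> < N x}"
      using \<delta> by (intro emeasure_mono) (auto simp: sets_polar_measure sets_punctured_borel is_norm_zero[OF N])
    also have "\<dots> < \<infinity>" using tails[OF \<delta>(1)] by simp
    finally show "emeasure ?\<mu> K < \<infinity>" .
  qed
  show "emeasure ?\<mu> (space ?\<mu>) \<noteq> 0"
  proof -
    have "emeasure ?\<mu> {x. 1 < N x} \<le> emeasure ?\<mu> (space ?\<mu>)" by (rule emeasure_space)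
    then show ?thesis using tails[of 1] by auto
  qed
  show "vague_conv (tail_measure N M X) ?\<mu> at_top"
    unfolding vague_conv_def
  proof (intro allI impI, elim conjE exE)
    fix f :: "'a \<Rightarrow> real" and K
    assume f: "continuous_on (- {0}) f" "\<forall>x. 0 \<le> f x" "compact K" "K \<subseteq> - {0}" "\<forall>x\<in>- {0} - K. f x = 0"
    define h where "h x = (if x = 0 then 0 else f x)" for x
    obtain B \<delta> where h: "test_fun N B \<delta> h"
      using punctured_test_fun[OF N f(1) _ f(3,4)] f(2,5) unfolding h_def[abs_def] by metis
    note th = test_funD[OF h]
    have [measurable]: "h \<in> borel_measurable borel" by (rule th)
    have h0: "h 0 = 0" by (simp add: h_def)
    have "space (tail_measure N M X t) = - {0}" for t
      by (simp add: tail_measure_def space_scale_measure space_restrict_space)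
    then have 1: "(\<integral>\<^sup>+x. ennreal (f x) \<partial>tail_measure N M X t) = ennreal ((\<integral>\<omega>. h (X \<omega> /\<^sub>R t) \<partial>M) / tail_prob N M X t)" for t
    proof -
      assume sp: "\<And>t. space (tail_measure N M X t) = - {0}"
      have "(\<integral>\<^sup>+x. ennreal (f x) \<partial>tail_measure N M X t) = (\<integral>\<^sup>+x. ennreal (h x) \<partial>tail_measure N M X t)"
        by (intro nn_integral_cong) (auto simp: sp h_def)
      also have "\<dots> = ennreal (1 / tail_prob N M X t) * (\<integral>\<^sup>+\<omega>. ennreal (h (X \<omega> /\<^sub>R t)) \<partial>M)"
        using h0 by (subst nn_integral_tail_measure) auto
      also have "(\<integral>\<^sup>+\<omega>. ennreal (h (X \<omega> /\<^sub>R t)) \<partial>M) = ennreal (\<integral>\<omega>. h (X \<omega> /\<^sub>R t) \<partial>M)"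
        by (intro nn_integral_eq_integral integrable_const_bound[of _ B]) (use th in auto)
      finally show ?thesis by (simp add: ennreal_mult'[symmetric])
    qed
    have "space ?\<mu> = - {0}" by (simp add: polar_measure_def space_restrict_space)
    then have "(\<integral>\<^sup>+x. ennreal (f x) \<partial>?\<mu>) = (\<integral>\<^sup>+x. ennreal (h x) \<partial>?\<mu>)"
      by (intro nn_integral_cong) (auto simp: h_def)
    also have "\<dots> = (\<integral>\<^sup>+u. \<integral>\<^sup>+r. ennreal (h (r *\<^sub>R u)) \<partial>pareto \<alpha> \<partial>S)"
      using h0 by (subst nn_integral_polar_measure[OF sS]) auto
    also have "\<dots> = (\<integral>\<^sup>+u. ennreal (radial_integral \<alpha> h u) \<partial>S)"
      unfolding radial_integral_def
      by (intro nn_integral_cong nn_integral_eq_integral radial_integrable[OF \<alpha> N h]) (use th in auto)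
    also have "\<dots> = ennreal (\<integral>u. radial_integral \<alpha> h u \<partial>S)"
    proof (intro nn_integral_eq_integral S.integrable_const_bound)
      show "AE u in S. norm (radial_integral \<alpha> h u) \<le> B * (1 / \<delta>) powr \<alpha>"
        using spectral_law_AE[OF N spec]
      proof eventually_elim
        case (elim u)
        then show ?case using radial_integral_nonneg[OF \<alpha> N h, of u] radial_integral_le[OF \<alpha> N h, of u] by simp
      qed
      show "AE u in S. 0 \<le> radial_integral \<alpha> h u" by (simp add: radial_integral_nonneg[OF \<alpha> N h])
    qed measurable
    finally have 2: "(\<integral>\<^sup>+x. ennreal (f x) \<partial>?\<mu>) = ennreal (\<integral>u. radial_integral \<alpha> h u \<partial>S)" .
    show "((\<lambda>t. \<integral>\<^sup>+x. ennreal (f x) \<partial>tail_measure N M X t) \<longlongrightarrow> (\<integral>\<^sup>+x. ennreal (f x) \<partial>?\<mu>)) at_top"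
      unfolding 1 2 by (intro tendsto_ennrealI polar_convergence[OF assms h])
  qed
  fix t :: real and A assume t: "t > 0" and A: "A \<in> sets ?\<mu>"
  then have [measurable]: "A \<in> sets borel" and A0: "0 \<notin> A" by (auto simp: sets_polar_measure sets_punctured_borel)
  have img: "(\<lambda>x. t *\<^sub>R x) ` A = (\<lambda>x. x /\<^sub>R t) -` A"
    using t by (auto simp: image_iff intro!: bexI[of _ "_ /\<^sub>R t"])
  have "(\<lambda>x. x /\<^sub>R t) -` A \<in> sets borel"
    using measurable_sets[of "\<lambda>x. x /\<^sub>R t" borel borel A] by simp
  then have "(\<lambda>x. t *\<^sub>R x) ` A \<in> sets ?\<mu>" using A0 t unfolding img by (simp add: sets_polar_measure sets_punctured_borel)
  then have "emeasure ?\<mu> ((\<lambda>x. t *\<^sub>R x) ` A) = (\<integral>\<^sup>+u. \<integral>\<^sup>+r. indicator A ((inverse t * r) *\<^sub>R u) \<partial>pareto \<alpha> \<partial>S)"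
    by (subst em) (auto simp: img indicator_def intro!: nn_integral_cong)
  also have "\<dots> = (\<integral>\<^sup>+u. ennreal (inverse t powr \<alpha>) * (\<integral>\<^sup>+r. indicator A (r *\<^sub>R u) \<partial>pareto \<alpha>) \<partial>S)"
    using t by (intro nn_integral_cong nn_integral_pareto_scale) auto
  also have "\<dots> = ennreal (inverse t powr \<alpha>) * emeasure ?\<mu> A"
    unfolding em[OF A] by (intro nn_integral_cmult) measurable
  also have "inverse t powr \<alpha> = t powr - \<alpha>" using t by (simp add: powr_minus inverse_powr)
  finally show "emeasure ?\<mu> ((\<lambda>x. t *\<^sub>R x) ` A) = ennreal (t powr - \<alpha>) * emeasure ?\<mu> A" .
qed

section \<open>Tails of products of independent variables\<close>

text \<open>
  Independence of two random variables that may have values in different types.  The product form of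
  the joint law is what Fubini's theorem needs.
\<close>

definition (in prob_space) indep_pair where
  "indep_pair S G R X \<longleftrightarrow> G \<in> M \<rightarrow>\<^sub>M S \<and> X \<in> M \<rightarrow>\<^sub>M R \<and>
     distr M S G \<Otimes>\<^sub>M distr M R X = distr M (S \<Otimes>\<^sub>M R) (\<lambda>\<omega>. (G \<omega>, X \<omega>))"

lemma (in prob_space) indep_pair_compose:
  assumes "indep_pair S G R X" and [measurable]: "f \<in> S \<rightarrow>\<^sub>M S'" "g \<in> R \<rightarrow>\<^sub>M R'"
  shows "indep_pair S' (\<lambda>\<omega>. f (G \<omega>)) R' (\<lambda>\<omega>. g (X \<omega>))"
proof -
  have [measurable]: "G \<in> M \<rightarrow>\<^sub>M S" "X \<in> M \<rightarrow>\<^sub>M R"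
    and eq: "distr M S G \<Otimes>\<^sub>M distr M R X = distr M (S \<Otimes>\<^sub>M R) (\<lambda>\<omega>. (G \<omega>, X \<omega>))"
    using assms(1) by (auto simp: indep_pair_def)
  have "prob_space (distr (distr M R X) R' g)"
    by (intro prob_space.prob_space_distr prob_space_distr) auto
  then have "sigma_finite_measure (distr (distr M R X) R' g)"
    by (simp add: prob_space_imp_sigma_finite)
  then have "distr (distr M S G) S' f \<Otimes>\<^sub>M distr (distr M R X) R' g =
    distr (distr M S G \<Otimes>\<^sub>M distr M R X) (S' \<Otimes>\<^sub>M R') (\<lambda>(x, y). (f x, g y))"
    by (intro pair_measure_distr) auto
  then show ?thesis
    unfolding indep_pair_def eq by (simp add: distr_distr comp_def)
qed

lemma (in prob_space) indep_pair_restrict: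
  assumes "indep_vars M' X I" "A \<inter> B = {}" "A \<subseteq> I" "B \<subseteq> I"
  shows "indep_pair (PiM A M') (\<lambda>\<omega>. restrict (\<lambda>i. X i \<omega>) A) (PiM B M') (\<lambda>\<omega>. restrict (\<lambda>i. X i \<omega>) B)"
  using indep_var_restrict[OF assms] by (simp add: indep_pair_def indep_var_distribution_eq)

text \<open>
  Separates one member of an independent family from a function of other members.
\<close>

lemma (in prob_space) indep_pair_component:
  assumes "indep_vars M' X I" "j \<in> I" "B \<subseteq> I" "j \<notin> B" "f \<in> PiM B M' \<rightarrow>\<^sub>M S"
  shows "indep_pair S (\<lambda>\<omega>. f (restrict (\<lambda>i. X i \<omega>) B)) (M' j) (X j)"
proof -
  have "indep_pair (PiM B M') (\<lambda>\<omega>. restrict (\<lambda>i. X i \<omega>) B) (PiM {j} M') (\<lambda>\<omega>. restrict (\<lambda>i. X i \<omega>) {j})"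
    by (rule indep_pair_restrict[OF assms(1)]) (use assms in auto)
  from indep_pair_compose[OF this assms(5) measurable_component_singleton[of j]]
  show ?thesis by simp
qed

lemma (in prob_space) integral_indep_pair:
  fixes h :: "'b \<times> 'c \<Rightarrow> real"
  assumes ind: "indep_pair S G R X" and h: "h \<in> borel_measurable (S \<Otimes>\<^sub>M R)"
    and int: "integrable M (\<lambda>\<omega>. h (G \<omega>, X \<omega>))"
  shows "(\<integral>\<omega>. h (G \<omega>, X \<omega>) \<partial>M) = (\<integral>\<omega>. (\<integral>x. h (G \<omega>, x) \<partial>distr M R X) \<partial>M)"
proof -
  note [measurable] = h
  have rv [measurable]: "G \<in> M \<rightarrow>\<^sub>M S" "X \<in> M \<rightarrow>\<^sub>M R"
    and eq: "distr M S G \<Otimes>\<^sub>M distr M R X = distr M (S \<Otimes>\<^sub>M R) (\<lambda>x. (G x, X x))"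
    using ind by (auto simp: indep_pair_def)
  interpret A: prob_space "distr M S G" by (rule prob_space_distr) fact
  interpret B: prob_space "distr M R X" by (rule prob_space_distr) fact
  interpret pair_sigma_finite "distr M S G" "distr M R X" ..
  have i: "integrable (distr M S G \<Otimes>\<^sub>M distr M R X) h"
    unfolding eq using int by (subst integrable_distr_eq) auto
  have "(\<integral>\<omega>. h (G \<omega>, X \<omega>) \<partial>M) = integral\<^sup>L (distr M S G \<Otimes>\<^sub>M distr M R X) h"
    unfolding eq by (subst integral_distr) auto
  also have "\<dots> = (\<integral>g. (\<integral>x. h (g, x) \<partial>distr M R X) \<partial>distr M S G)"
    by (rule integral_fst'[OF i, symmetric])
  also have "\<dots> = (\<integral>\<omega>. (\<integral>x. h (G \<omega>, x) \<partial>distr M R X) \<partial>M)"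
    by (rule integral_distr) measurable
  finally show ?thesis .
qed

lemma (in prob_space) prob_mult_indep:
  fixes U V :: "'a \<Rightarrow> real"
  assumes ind: "indep_pair borel V borel U" and V: "\<And>\<omega>. V \<omega> > 0" and [measurable]: "B \<in> sets borel"
  shows "\<P>(\<omega> in M. U \<omega> * V \<omega> > t \<and> V \<omega> \<in> B) = (\<integral>\<omega>. indicator B (V \<omega>) * \<P>(\<omega>' in M. U \<omega>' > t / V \<omega>) \<partial>M)"
proof -
  have [measurable]: "U \<in> borel_measurable M" "V \<in> borel_measurable M"
    using ind by (auto simp: indep_pair_def)
  define h where "h = (\<lambda>(v, u). indicator B v * (indicator {t<..} (u * v)) :: real)"
  have [measurable]: "h \<in> borel_measurable (borel \<Otimes>\<^sub>M borel)" unfolding h_def by measurable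
  have "\<P>(\<omega> in M. U \<omega> * V \<omega> > t \<and> V \<omega> \<in> B) = (\<integral>\<omega>. indicator {\<omega>\<in>space M. U \<omega> * V \<omega> > t \<and> V \<omega> \<in> B} \<omega> \<partial>M)"
    by simp
  also have "\<dots> = (\<integral>\<omega>. h (V \<omega>, U \<omega>) \<partial>M)"
    by (intro Bochner_Integration.integral_cong) (auto simp: h_def split: split_indicator)
  also have "\<dots> = (\<integral>\<omega>. (\<integral>u. h (V \<omega>, u) \<partial>distr M borel U) \<partial>M)"
    by (rule integral_indep_pair[OF ind]) 
       (auto simp: h_def split: split_indicator intro!: integrable_const_bound[of _ 1])
  also have "\<dots> = (\<integral>\<omega>. indicator B (V \<omega>) * \<P>(\<omega>' in M. U \<omega>' > t / V \<omega>) \<partial>M)"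
  proof (rule Bochner_Integration.integral_cong[OF refl])
    fix \<omega>
    have "h (V \<omega>, u) = indicator B (V \<omega>) * indicator {t / V \<omega><..} u" for u
      using V[of \<omega>] by (auto simp: h_def pos_divide_less_eq split: split_indicator)
    then have "(\<integral>u. h (V \<omega>, u) \<partial>distr M borel U) = indicator B (V \<omega>) * (\<integral>u. indicator {t / V \<omega><..} u \<partial>distr M borel U)"
      by simp
    also have "(\<integral>u. indicator {t / V \<omega><..} u \<partial>distr M borel U) = \<P>(\<omega>' in M. U \<omega>' > t / V \<omega>)"
      by (simp add: measure_distr) (auto intro!: arg_cong[where f="measure M"])
    finally show "(\<integral>u. h (V \<omega>, u) \<partial>distr M borel U) = indicator B (V \<omega>) * \<P>(\<omega>' in M. U \<omega>' > t / V \<omega>)" .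
  qed
  finally show ?thesis .
qed

lemma (in prob_space) indep_pair_prod:
  fixes Z :: "nat \<Rightarrow> 'a \<Rightarrow> real"
  assumes "indep_vars (\<lambda>_. borel) Z I" "finite J" "J \<subseteq> I" "j \<in> I" "j \<notin> J"
  shows "indep_pair borel (Z j) borel (\<lambda>\<omega>. \<Prod>i\<in>J. Z i \<omega>)"
  using indep_vars_prod[OF assms(2,5), of Z] indep_vars_subset[OF assms(1), of "insert j J"] assms(3,4)
  by (simp add: indep_pair_def indep_var_distribution_eq)

lemma borel_measurable_antimono:
  fixes f :: "real \<Rightarrow> real"
  assumes "antimono f" shows "f \<in> borel_measurable borel"
proof -
  have "(\<lambda>s. - f s) \<in> borel_measurable borel"
    by (rule borel_measurable_mono) (use assms in \<open>auto simp: mono_def antimono_def\<close>)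
  then have "(\<lambda>s. - (- f s)) \<in> borel_measurable borel" by measurable
  then show ?thesis by simp
qed

text \<open>
  The scalar skeleton of the problem: \<open>Z i\<close> stands for the norm of the \<open>i\<close>-th factor, raised
  to at least \<open>1\<close>.  This leaves the tail beyond \<open>1\<close> unchanged and makes a product of factors
  increase with the set of its indices.
\<close>

locale iid_factors = prob_space M for M :: "'w measure" +
  fixes Z :: "nat \<Rightarrow> 'w \<Rightarrow> real" and D :: "real measure" and T :: "real \<Rightarrow> real" and \<alpha> :: real
  assumes indep: "indep_vars (\<lambda>_. borel) Z {1..}"
    and ident: "i \<ge> 1 \<Longrightarrow> distr M borel (Z i) = D"
    and Z_ge_1: "Z i \<omega> \<ge> 1"
    and T_eq: "T s = measure D {s<..}"
    and \<alpha>: "\<alpha> > 0"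
    and tail: "regular_tail \<alpha> T"
    and two_big: "e > 0 \<Longrightarrow> \<exists>L0. \<forall>L\<ge>L0. eventually (\<lambda>t.
       \<P>(\<omega> in M. Z 2 \<omega> * Z 1 \<omega> > t \<and> Z 1 \<omega> \<in> {L<..t / L}) \<le> e * T t) at_top"
begin

lemma Z_meas [measurable]: "i \<ge> 1 \<Longrightarrow> Z i \<in> borel_measurable M"
  using indep by (auto simp: indep_vars_def)

lemma Z_pos: "Z i \<omega> > 0" using Z_ge_1[of i \<omega>] by simp

lemma tail_Z: "i \<ge> 1 \<Longrightarrow> \<P>(\<omega> in M. Z i \<omega> > s) = T s"
  unfolding T_eq ident[symmetric, of i]
  by (subst measure_distr) (auto intro!: arg_cong[where f="measure M"])

lemma T_nonneg: "T s \<ge> 0" by (simp add: T_eq)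

lemma T_antimono: "antimono T"
proof (rule antimonoI)
  fix s t :: real assume "s \<le> t"
  then show "T t \<le> T s" 
    unfolding tail_Z[of 1, symmetric, simplified] by (intro finite_measure_mono) auto
qed

lemma T_pos: "T s > 0"
  by (rule regular_tail_pos[OF tail T_antimono T_nonneg])

lemma sets_D [measurable_cong]: "sets D = sets borel"
  using ident[of 1] by auto

lemma T_meas [measurable]: "T \<in> borel_measurable borel"
  by (rule borel_measurable_antimono[OF T_antimono])

lemma T_divide_le:
  assumes "L > 0"
  shows "eventually (\<lambda>t. T (t / L) \<le> 2 * L powr \<alpha> * T t) at_top"
proof -
  have "((\<lambda>t. T (1 / L * t) / T t) \<longlongrightarrow> (1 / L) powr - \<alpha>) at_top"
    by (rule regular_tailD[OF tail]) (use assms in simp)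
  then have "eventually (\<lambda>t. T (1 / L * t) / T t < 2 * L powr \<alpha>) at_top"
    by (rule order_tendstoD) (use assms in \<open>simp add: powr_minus powr_divide\<close>)
  then show ?thesis
  proof eventually_elim
    case (elim t)
    then show ?case using T_pos[of t] by (simp add: pos_divide_less_eq)
  qed
qed

lemma two_big_integral: 
  "\<P>(\<omega> in M. Z 2 \<omega> * Z 1 \<omega> > t \<and> Z 1 \<omega> \<in> {a<..b}) = (\<integral>z. indicator {a<..b} z * T (t / z) \<partial>D)"
proof -
  have "indep_pair borel (Z 1) borel (\<lambda>\<omega>. \<Prod>i\<in>{2}. Z i \<omega>)"
    by (rule indep_pair_prod[OF indep]) auto
  then have "\<P>(\<omega> in M. Z 2 \<omega> * Z 1 \<omega> > t \<and> Z 1 \<omega> \<in> {a<..b}) = 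
     (\<integral>\<omega>. indicator {a<..b} (Z 1 \<omega>) * \<P>(\<omega>' in M. Z 2 \<omega>' > t / Z 1 \<omega>) \<partial>M)"
    by (intro prob_mult_indep Z_pos) auto
  also have "\<dots> = (\<integral>\<omega>. indicator {a<..b} (Z 1 \<omega>) * T (t / Z 1 \<omega>) \<partial>M)"
    by (simp add: tail_Z)
  also have "\<dots> = (\<integral>z. indicator {a<..b} z * T (t / z) \<partial>D)"
    unfolding ident[symmetric, of 1, simplified] by (subst integral_distr) auto
  finally show ?thesis .
qed

lemma AE_D: "AE z in D. z \<ge> 1"
  unfolding ident[symmetric, of 1, simplified] by (subst AE_distr_iff) (auto simp: Z_ge_1)

lemma prob_space_D: "prob_space D"
  unfolding ident[symmetric, of 1, simplified] by (rule prob_space_distr) simp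

text \<open>
  Fatou's lemma, applied to the hypothesis on two factors.  Divided by \<open>T t\<close>, the probability
  there is the integral over \<open>{L<..t / L}\<close> of \<open>T (t / z) / T t\<close>, which tends to \<open>z powr \<alpha>\<close>.
  As it stays bounded, the moment over \<open>{L<..}\<close> is finite.
\<close>

lemma moment_finite: "(\<integral>\<^sup>+z. ennreal (z powr \<alpha>) \<partial>D) < \<infinity>"
proof -
  interpret D: prob_space D by (rule prob_space_D)
  obtain L0 where L0: "\<And>L. L \<ge> L0 \<Longrightarrow> eventually (\<lambda>t.
       \<P>(\<omega> in M. Z 2 \<omega> * Z 1 \<omega> > t \<and> Z 1 \<omega> \<in> {L<..t / L}) \<le> 1 * T t) at_top"
    using two_big[of 1] by auto
  define L where "L = max 1 L0"
  have L: "L \<ge> 1" "L \<ge> L0" by (auto simp: L_def)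
  define u where "u n z = ennreal (indicator {L<..real n / L} z * T (real n / z) / T (real n))" for n z
  have [measurable]: "u n \<in> borel_measurable D" for n unfolding u_def by measurable
  have "eventually (\<lambda>n. (\<integral>\<^sup>+z. u n z \<partial>D) \<le> 1) sequentially"
    using eventually_compose_filterlim[OF L0[OF L(2)] filterlim_real_sequentially]
  proof eventually_elim
    case (elim n)
    have "(\<integral>\<^sup>+z. u n z \<partial>D) = ennreal (\<integral>z. indicator {L<..real n / L} z * T (real n / z) / T (real n) \<partial>D)"
      unfolding u_def
    proof (intro nn_integral_eq_integral D.integrable_const_bound[of _ "1 / T (real n)"])
      have "T s \<le> 1" for s by (simp add: T_eq)
      then show "AE z in D. norm (indicator {L<..real n / L} z * T (real n / z) / T (real n)) \<le> 1 / T (real n)"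
        using T_nonneg T_pos by (auto split: split_indicator simp: divide_right_mono)
    qed (use T_nonneg in auto)
    also have "\<dots> = ennreal ((\<integral>z. indicator {L<..real n / L} z * T (real n / z) \<partial>D) / T (real n))"
      by simp
    also have "\<dots> \<le> ennreal 1"
      using elim T_pos[of "real n"] unfolding two_big_integral by (intro ennreal_leI) (simp add: pos_divide_le_eq)
    finally show ?case by simp
  qed
  then have "liminf (\<lambda>n. \<integral>\<^sup>+z. u n z \<partial>D) \<le> 1"
    by (intro order_trans[OF Liminf_le_Limsup Limsup_bounded]) auto
  then have fatou: "(\<integral>\<^sup>+z. liminf (\<lambda>n. u n z) \<partial>D) \<le> 1"
    by (intro order_trans[OF nn_integral_liminf]) auto
  have "(\<integral>\<^sup>+z. ennreal (z powr \<alpha>) \<partial>D) \<le> (\<integral>\<^sup>+z. ennreal (L powr \<alpha>) + liminf (\<lambda>n. u n z) \<partial>D)"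
  proof (rule nn_integral_mono_AE, use AE_D in eventually_elim)
    fix z :: real assume z: "z \<ge> 1"
    show "ennreal (z powr \<alpha>) \<le> ennreal (L powr \<alpha>) + liminf (\<lambda>n. u n z)"
    proof (cases "z \<le> L")
      case True
      then have "ennreal (z powr \<alpha>) \<le> ennreal (L powr \<alpha>)" using z \<alpha> by (intro ennreal_leI powr_mono2) auto
      then show ?thesis by (simp add: add_increasing2)
    next
      case False
      have "((\<lambda>n. T (1 / z * real n) / T (real n)) \<longlongrightarrow> (1 / z) powr - \<alpha>) sequentially"
        by (rule filterlim_compose[OF regular_tailD[OF tail] filterlim_real_sequentially]) (use z in simp)
      then have "((\<lambda>n. ennreal (T (1 / z * real n) / T (real n))) \<longlongrightarrow> ennreal ((1 / z) powr - \<alpha>)) sequentially"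
        by (rule tendsto_ennrealI)
      moreover have "eventually (\<lambda>n. ennreal (T (1 / z * real n) / T (real n)) = u n z) sequentially"
      proof -
        have "eventually (\<lambda>n. real n \<ge> z * L) sequentially"
          using filterlim_real_sequentially by (simp add: filterlim_at_top)
        then show ?thesis
        proof eventually_elim
          case (elim n)
          then have "z \<le> real n / L" using L by (simp add: pos_le_divide_eq)
          then show ?case using False by (simp add: u_def)
        qed
      qed
      ultimately have "((\<lambda>n. u n z) \<longlongrightarrow> ennreal ((1 / z) powr - \<alpha>)) sequentially"
        by (rule Lim_transform_eventually)
      then have "liminf (\<lambda>n. u n z) = ennreal ((1 / z) powr - \<alpha>)" by (intro lim_imp_Liminf) auto
      also have "(1 / z) powr - \<alpha> = z powr \<alpha>" using z by (simp add: powr_minus powr_divide)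
      finally show ?thesis by (simp add: add_increasing)
    qed
  qed
  also have "\<dots> = ennreal (L powr \<alpha>) + (\<integral>\<^sup>+z. liminf (\<lambda>n. u n z) \<partial>D)"
    by (subst nn_integral_add) (auto simp: D.emeasure_space_1)
  also have "\<dots> \<le> ennreal (L powr \<alpha>) + 1" using fatou by (intro add_left_mono)
  also have "\<dots> < \<infinity>" by (simp add: ennreal_add_less_top)
  finally show ?thesis .
qed

text \<open>
  The expression is at most the part of the finite moment above \<open>L\<close>.
\<close>

lemma tail_moment_tendsto_0: "((\<lambda>L. T L * L powr \<alpha>) \<longlongrightarrow> 0) at_top"
proof -
  interpret D: prob_space D by (rule prob_space_D)
  have int: "integrable D (\<lambda>z. z powr \<alpha>)"
    using moment_finite by (intro integrableI_nonneg) auto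
  have "((\<lambda>L. \<integral>z. indicator {L<..} z * z powr \<alpha> \<partial>D) \<longlongrightarrow> (\<integral>z. 0 \<partial>D)) at_top"
  proof (rule integral_dominated_convergence_at_top[OF _ _ int])
    show "AE z in D. ((\<lambda>L. indicator {L<..} z * z powr \<alpha>) \<longlongrightarrow> 0) at_top"
    proof (rule AE_I2)
      fix z :: real
      have "eventually (\<lambda>L. 0 = indicator {L<..} z * z powr \<alpha>) at_top"
        using eventually_ge_at_top[of z] by eventually_elim simp
      then show "((\<lambda>L. indicator {L<..} z * z powr \<alpha>) \<longlongrightarrow> 0) at_top"
        by (rule Lim_transform_eventually[OF tendsto_const])
    qed
    show "eventually (\<lambda>L. AE z in D. norm (indicator {L<..} z * z powr \<alpha>) \<le> z powr \<alpha>) at_top"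
      by (auto split: split_indicator)
  qed auto
  then have lim: "((\<lambda>L. \<integral>z. indicator {L<..} z * z powr \<alpha> \<partial>D) \<longlongrightarrow> 0) at_top" by simp
  show ?thesis
  proof (rule tendsto_sandwich[OF _ _ tendsto_const lim])
    show "eventually (\<lambda>L. T L * L powr \<alpha> \<le> (\<integral>z. indicator {L<..} z * z powr \<alpha> \<partial>D)) at_top"
      using eventually_gt_at_top[of 0]
    proof eventually_elim
      case (elim L)
      have "T L * L powr \<alpha> = (\<integral>z. indicator {L<..} z * L powr \<alpha> \<partial>D)"
        by (simp add: T_eq)
      also have "\<dots> \<le> (\<integral>z. indicator {L<..} z * z powr \<alpha> \<partial>D)"
      proof (rule integral_mono)
        show "integrable D (\<lambda>z. indicator {L<..} z * L powr \<alpha>)"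
          by (intro D.integrable_const_bound[of _ "L powr \<alpha>"]) (auto split: split_indicator)
        show "integrable D (\<lambda>z. indicator {L<..} z * z powr \<alpha>)"
          by (rule Bochner_Integration.integrable_bound[OF int]) (auto split: split_indicator)
        show "indicator {L<..} z * L powr \<alpha> \<le> indicator {L<..} z * z powr \<alpha>" for z
          using elim \<alpha> by (auto split: split_indicator intro: powr_mono2)
      qed
      finally show ?case .
    qed
  qed (simp add: T_nonneg)
qed

lemma prod_Z_ge_1: "(\<Prod>i\<in>J. Z i \<omega>) \<ge> 1"
  by (intro prod_ge_1 Z_ge_1)

text \<open>
  Let \<open>W\<close> be the product over \<open>J\<close>.  If \<open>Z j \<le> t / L\<close>, condition on \<open>Z j\<close>: at the cost
  of the constant \<open>C\<close> the tail of \<open>W\<close> is replaced by that of a single factor, which leads back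
  to the hypothesis on two factors.  If \<open>Z j > t / L\<close>, independence bounds the probability by
  \<open>C * T L * T (t / L)\<close>, and this is a small multiple of \<open>T t\<close> by \<open>tail_moment_tendsto_0\<close>.
\<close>

lemma two_factors_large:
  assumes J: "finite J" "J \<subseteq> {1..}" "j \<ge> 1" "j \<notin> J"
    and C: "\<And>s. \<P>(\<omega> in M. (\<Prod>i\<in>J. Z i \<omega>) > s) \<le> C * T s" and e: "e > 0"
  shows "eventually (\<lambda>L. eventually (\<lambda>t. 
     \<P>(\<omega> in M. (\<Prod>i\<in>J. Z i \<omega>) * Z j \<omega> > t \<and> (\<Prod>i\<in>J. Z i \<omega>) > L \<and> Z j \<omega> > L) \<le> e * T t) at_top) at_top"
proof -
  let ?W = "\<lambda>\<omega>. \<Prod>i\<in>J. Z i \<omega>"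
  have [measurable]: "?W \<in> borel_measurable M" using J by (intro borel_measurable_prod Z_meas) auto
  have [measurable]: "Z j \<in> borel_measurable M" using J by simp
  have C0: "C \<ge> 0"
    using order_trans[OF measure_nonneg C[of 0]] T_pos[of 0] by (simp add: zero_le_mult_iff)
  \<comment> \<open>The summand \<open>1\<close> avoids a division by zero when \<open>C = 0\<close>.\<close>
  define c where "c = e / (4 * (C + 1))"
  have c: "c > 0" "C * c \<le> e / 4" using e C0 by (auto simp: c_def field_simps)
  obtain L0 where L0: "\<And>L. L \<ge> L0 \<Longrightarrow> eventually (\<lambda>t.
       \<P>(\<omega> in M. Z 2 \<omega> * Z 1 \<omega> > t \<and> Z 1 \<omega> \<in> {L<..t / L}) \<le> c * T t) at_top"
    using two_big[OF c(1)] by auto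
  have "eventually (\<lambda>L. T L * L powr \<alpha> < c) at_top"
    using c by (intro order_tendstoD(2)[OF tail_moment_tendsto_0])
  then show ?thesis using eventually_ge_at_top[of L0] eventually_gt_at_top[of 0]
  proof eventually_elim
    case (elim L)
    from L0[OF elim(2)] T_divide_le[OF elim(3)] show ?case
    proof eventually_elim
      case el: (elim t)
      note TL = el(2)
      have ind: "indep_pair borel (Z j) borel ?W"
        by (rule indep_pair_prod[OF indep]) (use J in auto)
      have "\<P>(\<omega> in M. ?W \<omega> * Z j \<omega> > t \<and> ?W \<omega> > L \<and> Z j \<omega> > L) \<le>
        \<P>(\<omega> in M. ?W \<omega> * Z j \<omega> > t \<and> Z j \<omega> \<in> {L<..t / L}) + \<P>(\<omega> in M. ?W \<omega> > L \<and> Z j \<omega> > t / L)"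
        by (intro order_trans[OF finite_measure_mono measure_Un_le]) auto
      also have "\<P>(\<omega> in M. ?W \<omega> * Z j \<omega> > t \<and> Z j \<omega> \<in> {L<..t / L}) = 
         (\<integral>\<omega>. indicator {L<..t / L} (Z j \<omega>) * \<P>(\<omega>' in M. ?W \<omega>' > t / Z j \<omega>) \<partial>M)"
        by (rule prob_mult_indep[OF ind Z_pos]) simp
      also have "\<dots> \<le> (\<integral>\<omega>. indicator {L<..t / L} (Z j \<omega>) * (C * T (t / Z j \<omega>)) \<partial>M)"
      proof (rule integral_mono)
        have T1: "T s \<le> 1" for s using prob_space.prob_le_1[OF prob_space_D] by (simp add: T_eq)
        show "integrable M (\<lambda>\<omega>. indicator {L<..t / L} (Z j \<omega>) * (C * T (t / Z j \<omega>)))"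
          using C0 T1 T_nonneg by (intro integrable_const_bound[of _ C]) 
            (auto split: split_indicator simp: abs_mult mult_left_le)
        have [measurable]: "(\<lambda>s. \<P>(\<omega> in M. ?W \<omega> > s)) \<in> borel_measurable borel"
          by (rule borel_measurable_antimono) (auto simp: antimono_def intro!: finite_measure_mono)
        have "(\<lambda>\<omega>. \<P>(\<omega>' in M. ?W \<omega>' > t / Z j \<omega>)) \<in> borel_measurable M"
          by (rule measurable_compose[of "\<lambda>\<omega>. t / Z j \<omega>" M borel "\<lambda>s. \<P>(\<omega> in M. ?W \<omega> > s)"]) measurable
        then show "integrable M (\<lambda>\<omega>. indicator {L<..t / L} (Z j \<omega>) * \<P>(\<omega>' in M. ?W \<omega>' > t / Z j \<omega>))"
          by (intro integrable_const_bound[of _ 1]) (auto split: split_indicator)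
        show "indicator {L<..t / L} (Z j \<omega>) * \<P>(\<omega>' in M. ?W \<omega>' > t / Z j \<omega>) \<le> 
            indicator {L<..t / L} (Z j \<omega>) * (C * T (t / Z j \<omega>))" for \<omega>
          by (intro mult_left_mono C) auto
      qed
      also have "\<dots> = C * (\<integral>\<omega>. indicator {L<..t / L} (Z j \<omega>) * T (t / Z j \<omega>) \<partial>M)"
        by (subst integral_mult_right_zero[symmetric]) (simp add: mult.left_commute)
      also have "(\<integral>\<omega>. indicator {L<..t / L} (Z j \<omega>) * T (t / Z j \<omega>) \<partial>M) = 
           \<P>(\<omega> in M. Z 2 \<omega> * Z 1 \<omega> > t \<and> Z 1 \<omega> \<in> {L<..t / L})"
        unfolding two_big_integral ident[symmetric, OF \<open>j \<ge> 1\<close>] by (subst integral_distr) auto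
      also have "C * \<dots> \<le> C * (c * T t)" using el C0 by (intro mult_left_mono) auto
      also have "\<dots> \<le> e / 4 * T t" using mult_right_mono[OF c(2) T_nonneg[of t]] by simp
      also have "\<P>(\<omega> in M. ?W \<omega> > L \<and> Z j \<omega> > t / L) = 
          \<P>(\<omega> in M. ?W \<omega> > L) * \<P>(\<omega> in M. Z j \<omega> > t / L)"
      proof -
        \<comment> \<open>Independence of the two events, read off from a rectangle under the joint law.\<close>
        have "emeasure (distr M borel (Z j) \<Otimes>\<^sub>M distr M borel ?W) ({t / L<..} \<times> {L<..}) = 
          emeasure (distr M borel (Z j)) {t / L<..} * emeasure (distr M borel ?W) {L<..}"
          by (intro sigma_finite_measure.emeasure_pair_measure_Times prob_space_imp_sigma_finite prob_space_distr) auto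
        also have "distr M borel (Z j) \<Otimes>\<^sub>M distr M borel ?W = distr M (borel \<Otimes>\<^sub>M borel) (\<lambda>\<omega>. (Z j \<omega>, ?W \<omega>))"
          using ind by (simp add: indep_pair_def)
        finally have "emeasure M {\<omega>\<in>space M. ?W \<omega> > L \<and> Z j \<omega> > t / L} = 
           emeasure M {\<omega>\<in>space M. Z j \<omega> > t / L} * emeasure M {\<omega>\<in>space M. ?W \<omega> > L}"
          by (simp add: emeasure_distr vimage_def Int_def conj_commute)
        then show ?thesis by (simp add: emeasure_eq_measure ennreal_mult''[symmetric] mult.commute)
      qed
      also have "\<dots> \<le> (C * T L) * (2 * L powr \<alpha> * T t)"
        using C[of L] TL C0 T_nonneg tail_Z[OF \<open>j \<ge> 1\<close>] by (intro mult_mono) auto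
      also have "\<dots> = 2 * (C * (T L * L powr \<alpha>)) * T t" by simp
      also have "\<dots> \<le> 2 * (C * c) * T t"
        using elim C0 T_nonneg by (intro mult_right_mono mult_left_mono) auto
      also have "\<dots> \<le> 2 * (e / 4) * T t"
        using c T_nonneg by (intro mult_right_mono mult_left_mono) auto
      also have "e / 4 * T t + 2 * (e / 4) * T t \<le> e * T t"
        using mult_nonneg_nonneg[OF less_imp_le[OF e] T_nonneg[of t]] by simp
      finally show ?case by simp
    qed
  qed
qed

text \<open>
  If \<open>W * Z j > t\<close> then both factors exceed a fixed level \<open>L\<close>, or one of them is at most \<open>L\<close>
  and the other exceeds \<open>t / L\<close>.  The first case is \<open>two_factors_large\<close>, whose premise is the
  induction hypothesis.  This settles large \<open>t\<close>; for the others the constant \<open>1 / T t0\<close> makes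
  the right-hand side at least \<open>1\<close>.
\<close>

lemma prod_tail_bound:
  assumes "finite J" "J \<subseteq> {1..}"
  shows "\<exists>C. \<forall>s. \<P>(\<omega> in M. (\<Prod>i\<in>J. Z i \<omega>) > s) \<le> C * T s"
  using assms
proof (induction J)
  case empty
  have "\<P>(\<omega> in M. 1 > s) \<le> 1 / T 1 * T s" for s :: real
  proof (cases "s < 1")
    case True
    then have "T 1 \<le> T s" using antimonoD[OF T_antimono, of s 1] by simp
    then have "1 \<le> 1 / T 1 * T s" using T_pos[of 1] by (simp add: field_simps)
    then show ?thesis using prob_le_1 order_trans by blast
  qed (use T_nonneg in auto)
  then show ?case by (intro exI[of _ "1 / T 1"]) simp
next
  case (insert j J)
  let ?W = "\<lambda>\<omega>. \<Prod>i\<in>J. Z i \<omega>"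
  have [measurable]: "?W \<in> borel_measurable M" using insert by (intro borel_measurable_prod Z_meas) auto
  have [measurable]: "Z j \<in> borel_measurable M" using insert by simp
  obtain C where C: "\<And>s. \<P>(\<omega> in M. ?W \<omega> > s) \<le> C * T s" using insert by auto
  have C0: "C \<ge> 0"
    using order_trans[OF measure_nonneg C[of 0]] T_pos[of 0] by (simp add: zero_le_mult_iff)
  have "eventually (\<lambda>L. eventually (\<lambda>t. 
     \<P>(\<omega> in M. ?W \<omega> * Z j \<omega> > t \<and> ?W \<omega> > L \<and> Z j \<omega> > L) \<le> 1 * T t) at_top) at_top"
    by (rule two_factors_large[OF _ _ _ _ C]) (use insert in auto)
  then have "eventually (\<lambda>L. L > 0 \<and> eventually (\<lambda>t. 
     \<P>(\<omega> in M. ?W \<omega> * Z j \<omega> > t \<and> ?W \<omega> > L \<and> Z j \<omega> > L) \<le> 1 * T t) at_top) at_top"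
    by (intro eventually_conj eventually_gt_at_top)
  then obtain L where L: "L > 0" and ev: "eventually (\<lambda>t. 
     \<P>(\<omega> in M. ?W \<omega> * Z j \<omega> > t \<and> ?W \<omega> > L \<and> Z j \<omega> > L) \<le> 1 * T t) at_top"
    by (auto dest: eventually_happens)
  from ev T_divide_le[OF L] have "eventually (\<lambda>t. \<P>(\<omega> in M. (\<Prod>i\<in>insert j J. Z i \<omega>) > t) \<le> (1 + (1 + C) * (2 * L powr \<alpha>)) * T t) at_top"
  proof eventually_elim
    case (elim t)
    note TL = elim(2)
    have big: "t / L < y" if "t < x * y" "x \<le> L" "y > 0" for x y :: real
    proof -
      have "t < L * y" using that by (meson less_le_trans mult_right_mono less_imp_le)
      then show ?thesis using L by (simp add: pos_divide_less_eq mult.commute)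
    qed
    have W_pos: "?W \<omega> > 0" for \<omega> using prod_Z_ge_1[where J=J and \<omega>=\<omega>] by linarith
    have sub: "{\<omega>\<in>space M. (\<Prod>i\<in>insert j J. Z i \<omega>) > t} \<subseteq>
      {\<omega>\<in>space M. ?W \<omega> * Z j \<omega> > t \<and> ?W \<omega> > L \<and> Z j \<omega> > L} \<union>
        ({\<omega>\<in>space M. Z j \<omega> > t / L} \<union> {\<omega>\<in>space M. ?W \<omega> > t / L})"
    proof
      fix \<omega> assume "\<omega> \<in> {\<omega>\<in>space M. (\<Prod>i\<in>insert j J. Z i \<omega>) > t}"
      then have *: "\<omega> \<in> space M" "t < ?W \<omega> * Z j \<omega>" "t < Z j \<omega> * ?W \<omega>"
        using insert(1,2) by (auto simp: mult.commute)
      show "\<omega> \<in> {\<omega>\<in>space M. ?W \<omega> * Z j \<omega> > t \<and> ?W \<omega> > L \<and> Z j \<omega> > L} \<union>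
        ({\<omega>\<in>space M. Z j \<omega> > t / L} \<union> {\<omega>\<in>space M. ?W \<omega> > t / L})"
        using * big[OF *(2) _ Z_pos] big[OF *(3) _ W_pos] by (cases "?W \<omega> \<le> L"; cases "Z j \<omega> \<le> L") simp_all
    qed
    have "\<P>(\<omega> in M. (\<Prod>i\<in>insert j J. Z i \<omega>) > t) \<le> 
       \<P>(\<omega> in M. ?W \<omega> * Z j \<omega> > t \<and> ?W \<omega> > L \<and> Z j \<omega> > L) + 
       (\<P>(\<omega> in M. Z j \<omega> > t / L) + \<P>(\<omega> in M. ?W \<omega> > t / L))"
      (is "measure M ?A \<le> measure M ?B1 + (measure M ?B2 + measure M ?B3)")
    proof -
      have m: "?B1 \<in> sets M" "?B2 \<in> sets M" "?B3 \<in> sets M" by measurable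
      have "measure M ?A \<le> measure M (?B1 \<union> (?B2 \<union> ?B3))"
        by (rule finite_measure_mono) (use sub m in \<open>auto simp del: prod.insert\<close>)
      also have "\<dots> \<le> measure M ?B1 + measure M (?B2 \<union> ?B3)" by (intro measure_Un_le m sets.Un)
      also have "measure M (?B2 \<union> ?B3) \<le> measure M ?B2 + measure M ?B3" by (intro measure_Un_le m)
      finally show ?thesis by simp
    qed
    also have "\<dots> \<le> 1 * T t + (T (t / L) + C * T (t / L))"
      using elim(1) C tail_Z[of j] insert(4) by (intro add_mono) auto
    also have "\<dots> = 1 * T t + (1 + C) * T (t / L)" by (simp add: algebra_simps)
    also have "\<dots> \<le> 1 * T t + (1 + C) * (2 * L powr \<alpha> * T t)"
      using TL C0 by (intro add_left_mono mult_left_mono) auto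
    finally show ?case by (simp add: algebra_simps)
  qed
  then obtain t0 where t0: "\<And>t. t \<ge> t0 \<Longrightarrow> \<P>(\<omega> in M. (\<Prod>i\<in>insert j J. Z i \<omega>) > t) \<le> (1 + (1 + C) * (2 * L powr \<alpha>)) * T t"
    by (auto simp: eventually_at_top_linorder)
  have "\<P>(\<omega> in M. (\<Prod>i\<in>insert j J. Z i \<omega>) > t) \<le> max (1 + (1 + C) * (2 * L powr \<alpha>)) (1 / T t0) * T t" for t
  proof (cases "t \<ge> t0")
    case True
    then show ?thesis using t0[of t] T_nonneg[of t] by (meson order_trans max.cobounded1 mult_right_mono)
  next
    case False
    then have "T t0 \<le> T t" using antimonoD[OF T_antimono, of t t0] by simp
    then have "1 \<le> 1 / T t0 * T t" using T_pos[of t0] by (simp add: field_simps)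
    also have "\<dots> \<le> max (1 + (1 + C) * (2 * L powr \<alpha>)) (1 / T t0) * T t"
      using T_nonneg by (intro mult_right_mono) auto
    finally show ?thesis using prob_le_1 order_trans by blast
  qed
  then show ?case by blast
qed

lemma integrable_prod_powr:
  assumes "finite J" "J \<subseteq> {1..}"
  shows "integrable M (\<lambda>\<omega>. (\<Prod>i\<in>J. Z i \<omega>) powr \<alpha>)"
proof (rule integrableI_nonneg)
  have [measurable]: "(\<lambda>\<omega>. \<Prod>i\<in>J. Z i \<omega>) \<in> borel_measurable M" using assms by (intro borel_measurable_prod Z_meas) auto
  show "(\<lambda>\<omega>. (\<Prod>i\<in>J. Z i \<omega>) powr \<alpha>) \<in> borel_measurable M" by measurable
  have "(\<integral>\<^sup>+\<omega>. ennreal ((\<Prod>i\<in>J. Z i \<omega>) powr \<alpha>) \<partial>M) = (\<integral>\<^sup>+\<omega>. (\<Prod>i\<in>J. ennreal (Z i \<omega> powr \<alpha>)) \<partial>M)"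
    by (intro nn_integral_cong) (simp add: prod_powr_distrib less_imp_le[OF Z_pos] prod_ennreal)
  also have "\<dots> = (\<Prod>i\<in>J. \<integral>\<^sup>+\<omega>. ennreal (Z i \<omega> powr \<alpha>) \<partial>M)"
    by (intro indep_vars_nn_integral indep_vars_compose2[OF indep_vars_subset[OF indep assms(2)]] assms) auto
  also have "\<dots> = (\<Prod>i\<in>J. \<integral>\<^sup>+z. ennreal (z powr \<alpha>) \<partial>D)"
  proof (rule prod.cong[OF refl])
    fix i assume "i \<in> J"
    then have "i \<ge> 1" using assms by auto
    then show "(\<integral>\<^sup>+\<omega>. ennreal (Z i \<omega> powr \<alpha>) \<partial>M) = (\<integral>\<^sup>+z. ennreal (z powr \<alpha>) \<partial>D)"
      unfolding ident[OF \<open>i \<ge> 1\<close>, symmetric] by (subst nn_integral_distr) auto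
  qed
  also have "\<dots> < \<infinity>" using moment_finite by (simp add: power_eq_top_ennreal flip: less_top)
  finally show "(\<integral>\<^sup>+\<omega>. ennreal ((\<Prod>i\<in>J. Z i \<omega>) powr \<alpha>) \<partial>M) < \<infinity>" .
qed auto

end

section \<open>One large factor\<close>

lemma scaleR_matrix_middle:
  fixes p q x :: "real^'n^'n"
  shows "p ** (r *\<^sub>R x) ** q = r *\<^sub>R (p ** x ** q)"
  by (simp add: bounded_bilinear.scaleR_right[OF bounded_bilinear_matrix_mult]
      bounded_bilinear.scaleR_left[OF bounded_bilinear_matrix_mult])

text \<open>
  Given the surroundings \<open>P\<close>, \<open>Q\<close> and their size \<open>W\<close>, the function \<open>x \<mapsto> f (P ** x ** Q)\<close>
  is again a test function, and \<open>polar_convergence\<close> gives the limit of the conditional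
  expectation.  The truncation of \<open>W\<close> provides a constant that dominates the conditional
  expectations.  In the limit, the integral over the spectral law is that over \<open>\<theta>\<close>, by
  independence of \<open>\<theta>\<close> from the surroundings.
\<close>

lemma (in prob_space) single_jump_limit:
  fixes X0 X \<theta> P Q :: "'a \<Rightarrow> real^'n^'n" and W :: "'a \<Rightarrow> real"
  assumes N: "is_norm N" and \<alpha>: "\<alpha> > 0" and X0 [measurable]: "X0 \<in> borel_measurable M"
    and tail: "regular_tail \<alpha> (tail_prob N M X0)" and spec: "spectral_law N M X0 S"
    and f: "test_fun N B \<delta> f"
    and same: "distr M borel X = distr M borel X0" and th: "distr M borel \<theta> = S"
    and ind: "indep_pair (borel \<Otimes>\<^sub>M borel \<Otimes>\<^sub>M borel) (\<lambda>\<omega>. (P \<omega>, Q \<omega>, W \<omega>)) borel X"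
    and ind_th: "indep_pair (borel \<Otimes>\<^sub>M borel \<Otimes>\<^sub>M borel) (\<lambda>\<omega>. (P \<omega>, Q \<omega>, W \<omega>)) borel \<theta>"
    and W: "\<And>\<omega>. W \<omega> \<ge> 1" and \<kappa>: "\<kappa> > 0" and PQ: "\<And>\<omega> x. N (P \<omega> ** x ** Q \<omega>) \<le> \<kappa> * W \<omega> * N x"
    and L: "L > 0"
  shows "((\<lambda>t. (\<integral>\<omega>. f ((P \<omega> ** X \<omega> ** Q \<omega>) /\<^sub>R t) * indicator {..L} (W \<omega>) \<partial>M) / tail_prob N M X0 t)
    \<longlongrightarrow> (\<integral>\<omega>. radial_integral \<alpha> f (P \<omega> ** \<theta> \<omega> ** Q \<omega>) * indicator {..L} (W \<omega>) \<partial>M)) at_top"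
proof -
  note tf = test_funD[OF f]
  have [measurable]: "f \<in> borel_measurable borel" by (rule tf)
  have [measurable]: "N \<in> borel_measurable borel" by (rule is_norm_borel[OF N])
  have X [measurable]: "X \<in> borel_measurable M" and \<theta> [measurable]: "\<theta> \<in> borel_measurable M"
    using ind ind_th by (auto simp: indep_pair_def)
  have G: "(\<lambda>\<omega>. (P \<omega>, Q \<omega>, W \<omega>)) \<in> M \<rightarrow>\<^sub>M borel \<Otimes>\<^sub>M borel \<Otimes>\<^sub>M borel"
    using ind by (auto simp: indep_pair_def)
  have [measurable]: "P \<in> borel_measurable M" "Q \<in> borel_measurable M" "W \<in> borel_measurable M"
    using measurable_compose[OF G measurable_fst] measurable_compose[OF measurable_compose[OF G measurable_snd] measurable_fst]
      measurable_compose[OF measurable_compose[OF G measurable_snd] measurable_snd] by simp_all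
  define T where "T = tail_prob N M X0"
  have T_pos: "T t > 0" for t
    unfolding T_def by (rule regular_tail_pos[OF tail antimono_tail_prob[OF prob_space_axioms N X0]]) auto
  have W_pos: "W \<omega> > 0" for \<omega> using W[of \<omega>] by simp
  have spos: "\<delta> / (\<kappa> * L) > 0" using tf(3) \<kappa> L by simp
  define H where "H t \<omega> = (\<integral>\<omega>'. f ((P \<omega> ** X0 \<omega>' ** Q \<omega>) /\<^sub>R t) \<partial>M)" for t \<omega>
  have fubini1: "(\<integral>\<omega>. f ((P \<omega> ** X \<omega> ** Q \<omega>) /\<^sub>R t) * indicator {..L} (W \<omega>) \<partial>M) = (\<integral>\<omega>. H t \<omega> * indicator {..L} (W \<omega>) \<partial>M)" for t
  proof -
    define h :: "((real^'n^'n) \<times> (real^'n^'n) \<times> real) \<times> (real^'n^'n) \<Rightarrow> real" where "h = (\<lambda>z. f ((fst (fst z) ** snd z ** fst (snd (fst z))) /\<^sub>R t) * indicator {..L} (snd (snd (fst z))) :: real)"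
    have [measurable]: "h \<in> borel_measurable ((borel \<Otimes>\<^sub>M borel \<Otimes>\<^sub>M borel) \<Otimes>\<^sub>M borel)"
      unfolding h_def by measurable
    have "(\<integral>\<omega>. h ((P \<omega>, Q \<omega>, W \<omega>), X \<omega>) \<partial>M) = (\<integral>\<omega>. (\<integral>x. h ((P \<omega>, Q \<omega>, W \<omega>), x) \<partial>distr M borel X) \<partial>M)"
    proof (rule integral_indep_pair[OF ind])
      have "(\<lambda>\<omega>. h ((P \<omega>, Q \<omega>, W \<omega>), X \<omega>)) \<in> borel_measurable M" by measurable
      then show "integrable M (\<lambda>\<omega>. h ((P \<omega>, Q \<omega>, W \<omega>), X \<omega>))"
        by (intro integrable_const_bound[of _ B]) (use tf(4-6) in \<open>auto simp: h_def split: split_indicator\<close>)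
    qed measurable
    also have "\<dots> = (\<integral>\<omega>. H t \<omega> * indicator {..L} (W \<omega>) \<partial>M)"
      unfolding same H_def by (subst integral_distr) (auto simp: h_def)
    finally show ?thesis by (simp add: h_def)
  qed
  have H_meas [measurable]: "H t \<in> borel_measurable M" for t
    unfolding H_def by measurable
  have fubini2: "(\<integral>\<omega>. radial_integral \<alpha> f (P \<omega> ** \<theta> \<omega> ** Q \<omega>) * indicator {..L} (W \<omega>) \<partial>M) = 
     (\<integral>\<omega>. (\<integral>y. radial_integral \<alpha> f (P \<omega> ** y ** Q \<omega>) \<partial>S) * indicator {..L} (W \<omega>) \<partial>M)"
  proof -
    define h :: "((real^'n^'n) \<times> (real^'n^'n) \<times> real) \<times> (real^'n^'n) \<Rightarrow> real" where "h = (\<lambda>z. radial_integral \<alpha> f (fst (fst z) ** snd z ** fst (snd (fst z))) * indicator {..L} (snd (snd (fst z))) :: real)"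
    have [measurable]: "h \<in> borel_measurable ((borel \<Otimes>\<^sub>M borel \<Otimes>\<^sub>M borel) \<Otimes>\<^sub>M borel)"
      unfolding h_def by measurable
    have "(\<integral>\<omega>. h ((P \<omega>, Q \<omega>, W \<omega>), \<theta> \<omega>) \<partial>M) = (\<integral>\<omega>. (\<integral>x. h ((P \<omega>, Q \<omega>, W \<omega>), x) \<partial>distr M borel \<theta>) \<partial>M)"
    proof (rule integral_indep_pair[OF ind_th])
      have "AE x in distr M borel \<theta>. N x = 1" unfolding th by (rule spectral_law_AE[OF N spec])
      then have "AE \<omega> in M. N (\<theta> \<omega>) = 1" by (subst (asm) AE_distr_iff) auto
      then have "AE \<omega> in M. norm (h ((P \<omega>, Q \<omega>, W \<omega>), \<theta> \<omega>)) \<le> B * (\<kappa> * L / \<delta>) powr \<alpha>"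
      proof eventually_elim
        case (elim \<omega>)
        show ?case
        proof (cases "W \<omega> \<le> L")
          case True
          have "N (P \<omega> ** \<theta> \<omega> ** Q \<omega>) \<le> \<kappa> * W \<omega> * N (\<theta> \<omega>)" by (rule PQ)
          also have "\<dots> \<le> \<kappa> * L" using True elim \<kappa> by simp
          finally have "B * (N (P \<omega> ** \<theta> \<omega> ** Q \<omega>) / \<delta>) powr \<alpha> \<le> B * (\<kappa> * L / \<delta>) powr \<alpha>"
            using tf(3,6) \<alpha> is_norm_nonneg[OF N] by (intro mult_left_mono powr_mono2 divide_right_mono) auto
          then show ?thesis 
            using True radial_integral_nonneg[OF \<alpha> N f] order_trans[OF radial_integral_le[OF \<alpha> N f]] by (simp add: h_def)
        next
          case False
          then show ?thesis using tf(6) by (simp add: h_def)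
        qed
      qed
      moreover have "(\<lambda>\<omega>. h ((P \<omega>, Q \<omega>, W \<omega>), \<theta> \<omega>)) \<in> borel_measurable M" by measurable
      ultimately show "integrable M (\<lambda>\<omega>. h ((P \<omega>, Q \<omega>, W \<omega>), \<theta> \<omega>))"
        by (intro integrable_const_bound)
    qed measurable
    then show ?thesis unfolding th by (simp add: h_def)
  qed
  have test: "test_fun N B (\<delta> / (\<kappa> * W \<omega>)) (\<lambda>x. f (P \<omega> ** x ** Q \<omega>))" for \<omega>
    unfolding test_fun_def
  proof (intro conjI allI impI)
    show "continuous_on UNIV (\<lambda>x. f (P \<omega> ** x ** Q \<omega>))"
      by (intro continuous_on_compose2[OF tf(1)] bounded_bilinear.continuous_on[OF bounded_bilinear_matrix_mult] continuous_intros) auto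
    show "0 < \<delta> / (\<kappa> * W \<omega>)" using tf(3) \<kappa> W_pos by simp
    fix x assume "N x \<le> \<delta> / (\<kappa> * W \<omega>)"
    then have "\<kappa> * W \<omega> * N x \<le> \<delta>" using \<kappa> W_pos[of \<omega>] by (simp add: pos_le_divide_eq mult.commute)
    then show "f (P \<omega> ** x ** Q \<omega>) = 0" using PQ[of \<omega> x] by (intro tf(7)) simp
  qed (use tf in auto)
  have H_lim: "((\<lambda>t. H t \<omega> / T t) \<longlongrightarrow> (\<integral>y. radial_integral \<alpha> f (P \<omega> ** y ** Q \<omega>) \<partial>S)) at_top" for \<omega>
    using polar_convergence[OF prob_space_axioms N X0 \<alpha> tail spec test[of \<omega>]]
    unfolding H_def T_def radial_integral_def by (simp add: scaleR_matrix_middle)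
  interpret S: prob_space S by (rule spectral_lawD[OF spec])
  note [measurable_cong] = spectral_lawD(2)[OF spec]
  have [measurable]: "(\<lambda>\<omega>. \<integral>y. radial_integral \<alpha> f (P \<omega> ** y ** Q \<omega>) \<partial>S) \<in> borel_measurable M"
    by measurable
  have "((\<lambda>t. \<integral>\<omega>. H t \<omega> / T t * indicator {..L} (W \<omega>) \<partial>M) \<longlongrightarrow> 
     (\<integral>\<omega>. (\<integral>y. radial_integral \<alpha> f (P \<omega> ** y ** Q \<omega>) \<partial>S) * indicator {..L} (W \<omega>) \<partial>M)) at_top"
  proof (rule integral_dominated_convergence_at_top)
    show "integrable M (\<lambda>\<omega>. B * ((\<delta> / (\<kappa> * L)) powr - \<alpha> + 1))" by simp
    show "AE \<omega> in M. ((\<lambda>t. H t \<omega> / T t * indicator {..L} (W \<omega>)) \<longlongrightarrow> (\<integral>y. radial_integral \<alpha> f (P \<omega> ** y ** Q \<omega>) \<partial>S) * indicator {..L} (W \<omega>)) at_top"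
      by (intro AE_I2 tendsto_mult H_lim tendsto_const)
    have "((\<lambda>t. T (\<delta> / (\<kappa> * L) * t) / T t) \<longlongrightarrow> (\<delta> / (\<kappa> * L)) powr - \<alpha>) at_top"
      unfolding T_def by (rule regular_tailD[OF tail spos])
    then have "eventually (\<lambda>t. T (\<delta> / (\<kappa> * L) * t) / T t < (\<delta> / (\<kappa> * L)) powr - \<alpha> + 1) at_top"
      by (rule order_tendstoD) simp
    then show "eventually (\<lambda>t. AE \<omega> in M. norm (H t \<omega> / T t * indicator {..L} (W \<omega>)) \<le> B * ((\<delta> / (\<kappa> * L)) powr - \<alpha> + 1)) at_top"
      using eventually_gt_at_top[of 0]
    proof eventually_elim
      case (elim t)
      show ?case
      proof (rule AE_I2)
        fix \<omega>
        show "norm (H t \<omega> / T t * indicator {..L} (W \<omega>)) \<le> B * ((\<delta> / (\<kappa> * L)) powr - \<alpha> + 1)"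
        proof (cases "W \<omega> \<le> L")
          case True
          let ?s = "\<delta> / (\<kappa> * L) * t"
          have "H t \<omega> \<le> (\<integral>\<omega>'. B * indicator {\<omega>'\<in>space M. ?s < N (X0 \<omega>')} \<omega>' \<partial>M)"
            unfolding H_def
          proof (rule integral_mono)
            show "integrable M (\<lambda>\<omega>'. f ((P \<omega> ** X0 \<omega>' ** Q \<omega>) /\<^sub>R t))"
              by (intro integrable_const_bound[of _ B]) (use tf(4,5) in auto)
            show "integrable M (\<lambda>\<omega>'. B * indicator {\<omega>'\<in>space M. ?s < N (X0 \<omega>')} \<omega>')"
              by (intro integrable_mult_right integrable_real_indicator) (auto simp: emeasure_eq_measure)
            fix \<omega>' assume "\<omega>' \<in> space M"
            show "f ((P \<omega> ** X0 \<omega>' ** Q \<omega>) /\<^sub>R t) \<le> B * indicator {\<omega>'\<in>space M. ?s < N (X0 \<omega>')} \<omega>'"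
            proof (cases "?s < N (X0 \<omega>')")
              case True then show ?thesis using tf(5) \<open>\<omega>' \<in> space M\<close> by simp
            next
              case False
              have "N (P \<omega> ** X0 \<omega>' ** Q \<omega>) \<le> \<kappa> * W \<omega> * N (X0 \<omega>')" by (rule PQ)
              also have "\<dots> \<le> (\<kappa> * L) * ?s" using False True \<kappa> W_pos[of \<omega>] L is_norm_nonneg[OF N]
                by (intro mult_mono) auto
              also have "\<dots> = \<delta> * t" using \<kappa> L by simp
              finally have "f ((P \<omega> ** X0 \<omega>' ** Q \<omega>) /\<^sub>R t) = 0"
                using elim(2) by (intro tf(7)) (simp add: is_norm_scaleR[OF N] field_simps)
              then show ?thesis using tf(6) by simp
            qed
          qed
          also have "\<dots> = B * T ?s" by (simp add: T_def)
          finally have "H t \<omega> / T t \<le> B * (T ?s / T t)" using T_pos[of t] by (simp add: divide_right_mono)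
          also have "\<dots> \<le> B * ((\<delta> / (\<kappa> * L)) powr - \<alpha> + 1)" using elim(1) tf(6) by (intro mult_left_mono) auto
          finally have "H t \<omega> / T t \<le> B * ((\<delta> / (\<kappa> * L)) powr - \<alpha> + 1)" .
          moreover have "H t \<omega> \<ge> 0" unfolding H_def using tf(4) by (intro integral_nonneg_AE) auto
          ultimately show ?thesis using True T_pos[of t] by simp
        next
          case False
          then show ?thesis using tf(6) by simp
        qed
      qed
    qed
  qed measurable
  then show ?thesis
    unfolding fubini1 fubini2 T_def by (simp flip: Bochner_Integration.integral_divide_zero)
qed

section \<open>Matrix products\<close>

lemma foldr_matrix_mult:
  fixes z :: "real^'n^'n"
  shows "foldr (**) xs z = foldr (**) xs (mat 1) ** z"
  by (induction xs) (auto simp: matrix_mul_assoc[symmetric])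

lemma mat_prod_split:
  assumes "1 \<le> k" "k \<le> n"
  shows "mat_prod a 1 n = mat_prod a 1 (k - 1) ** a k ** mat_prod a (k + 1) n"
proof -
  have "[1..<Suc n] = [1..<k] @ k # [k + 1..<Suc n]"
    using assms upt_add_eq_append[of 1 k "Suc n - k"] by (simp add: upt_rec[of k] del: upt_Suc)
  then have "map a [1..<Suc n] = map a [1..<k] @ a k # map a [k + 1..<Suc n]" by simp
  moreover have "Suc (k - 1) = k" using assms by simp
  ultimately show ?thesis
    unfolding mat_prod_def
    by (simp add: foldr_matrix_mult[of "map a [Suc 0..<k]" "a k ** _"] matrix_mul_assoc del: upt_Suc)
qed

lemma mat_prod_cong: "(\<And>l. i \<le> l \<Longrightarrow> l \<le> j \<Longrightarrow> a l = b l) \<Longrightarrow> mat_prod a i j = mat_prod b i j"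
  unfolding mat_prod_def by (intro arg_cong[where f="\<lambda>l. foldr (**) l (mat 1)"]) auto

lemma measurable_mat_prod:
  assumes "\<And>l. i \<le> l \<Longrightarrow> l \<le> j \<Longrightarrow> (\<lambda>\<omega>. a \<omega> l) \<in> borel_measurable M"
  shows "(\<lambda>\<omega>. mat_prod (a \<omega>) i j) \<in> borel_measurable M"
proof -
  have "(\<lambda>\<omega>. foldr (**) (map (a \<omega>) xs) (mat 1)) \<in> borel_measurable M" if "\<And>l. l \<in> set xs \<Longrightarrow> (\<lambda>\<omega>. a \<omega> l) \<in> borel_measurable M" for xs
    using that by (induction xs) (auto intro!: borel_measurable_matrix_mult)
  from this[of "[i..<Suc j]"] show ?thesis unfolding mat_prod_def using assms by (auto simp del: upt_Suc)
qed

text \<open>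
  The norm need not be submultiplicative, so every multiplication may cost a factor \<open>c\<close>.  The
  exponent \<open>m\<close> allows one constant for products of different lengths.
\<close>

lemma mat_prod_norm_le:
  fixes N :: "real^'n^'n \<Rightarrow> real"
  assumes N: "is_norm N" and c: "c \<ge> 1" "\<And>x y :: real^'n^'n. N (x ** y) \<le> c * (N x * N y)"
    and len: "Suc j - i \<le> m"
  shows "N (mat_prod a i j) \<le> N (mat 1) * c ^ m * (\<Prod>l=i..j. max 1 (N (a l)))"
proof -
  have list: "N (foldr (**) (map a xs) (mat 1)) \<le> N (mat 1) * c ^ length xs * prod_list (map (\<lambda>l. max 1 (N (a l))) xs)" for xs
  proof (induction xs)
    case (Cons x xs)
    let ?R = "N (mat 1) * c ^ length xs * prod_list (map (\<lambda>l. max 1 (N (a l))) xs)"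
    have "N (foldr (**) (map a (x # xs)) (mat 1)) \<le> c * (N (a x) * N (foldr (**) (map a xs) (mat 1)))"
      using c(2) by simp
    also have "\<dots> \<le> c * (max 1 (N (a x)) * ?R)"
      using c(1) Cons is_norm_nonneg[OF N] by (intro mult_left_mono mult_mono) auto
    finally show ?case by (simp add: ac_simps)
  qed simp
  have "prod_list (map (\<lambda>l. max 1 (N (a l))) [i..<Suc j]) = (\<Prod>l\<in>set [i..<Suc j]. max 1 (N (a l)))"
    by (rule prod.distinct_set_conv_list[symmetric]) simp
  also have "set [i..<Suc j] = {i..j}" by auto
  finally have "N (mat_prod a i j) \<le> N (mat 1) * c ^ (Suc j - i) * (\<Prod>l=i..j. max 1 (N (a l)))"
    using list[of "[i..<Suc j]"] unfolding mat_prod_def by (simp del: upt_Suc)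
  also have "\<dots> \<le> N (mat 1) * c ^ m * (\<Prod>l=i..j. max 1 (N (a l)))"
    using c(1) len is_norm_nonneg[OF N]
    by (intro mult_right_mono mult_left_mono power_increasing prod_nonneg) (auto simp: le_max_iff_disj)
  finally show ?thesis .
qed

section \<open>The factors of the product and their surroundings\<close>

text \<open>
  The situation of the theorem, except that the regular variation of \<open>A0\<close> enters through the tail of
  its norm and its spectral law.
\<close>

locale matrix_factors = prob_space M for M :: "'w measure" +
  fixes N :: "real^'n^'n \<Rightarrow> real"
    and A :: "nat \<Rightarrow> 'w \<Rightarrow> real^'n^'n"
    and A0 :: "'w \<Rightarrow> real^'n^'n"
    and \<theta> :: "nat \<Rightarrow> 'w \<Rightarrow> real^'n^'n"
    and S :: "(real^'n^'n) measure"
    and \<alpha> :: real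
    and n :: nat
  assumes N: "is_norm N"
    and indep: "indep_vars (\<lambda>_. borel) A {1..}"
    and ident: "i \<ge> 1 \<Longrightarrow> distr M borel (A i) = distr M borel A0"
    and A0 [measurable]: "A0 \<in> borel_measurable M"
    and \<alpha>: "\<alpha> > 0"
    and tail: "regular_tail \<alpha> (tail_prob N M A0)"
    and product_condition:
      "((\<lambda>L. Limsup at_top (\<lambda>t.
           ereal (\<P>(\<omega> in M. N (A 1 \<omega>) * N (A 2 \<omega>) > t \<and> L < N (A 1 \<omega>) \<and> N (A 1 \<omega>) \<le> t / L)
                  / tail_prob N M A0 t))) \<longlongrightarrow> 0) (at_top :: real filter)"
    and spectral: "spectral_law N M A0 S"
    and theta_copies: "k \<ge> 1 \<Longrightarrow> distr M borel (\<theta> k) = S"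
    and theta_indep: "k \<ge> 1 \<Longrightarrow> indep_vars (\<lambda>_. borel) (\<lambda>i. if i = 0 then \<theta> k else A i) UNIV"
    and n: "n \<ge> 1"
begin

lemma N_meas [measurable]: "N \<in> borel_measurable borel" by (rule is_norm_borel[OF N])

lemma A_meas [measurable]: "i \<ge> 1 \<Longrightarrow> A i \<in> borel_measurable M"
  using indep by (auto simp: indep_vars_def)

lemma theta_meas [measurable]: "k \<ge> 1 \<Longrightarrow> \<theta> k \<in> borel_measurable M"
proof -
  assume "k \<ge> 1"
  from theta_indep[OF this] have "(if (0::nat) = 0 then \<theta> k else A 0) \<in> borel_measurable M"
    unfolding indep_vars_def by blast
  then show ?thesis by simp
qed

definition T :: "real \<Rightarrow> real" where "T t = tail_prob N M A0 t"

lemma tail_T: "regular_tail \<alpha> T"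
  using tail by (simp add: T_def[abs_def])

lemma T_pos: "T t > 0"
  unfolding T_def by (rule regular_tail_pos[OF tail antimono_tail_prob[OF prob_space_axioms N A0]]) auto

definition Z :: "nat \<Rightarrow> 'w \<Rightarrow> real" where "Z i \<omega> = max 1 (N (A i \<omega>))"

definition D :: "real measure" where "D = distr M borel (\<lambda>\<omega>. max 1 (N (A0 \<omega>)))"

lemma D_tail: "measure D {s<..} = (if s < 1 then 1 else T s)"
proof -
  have "measure D {s<..} = \<P>(\<omega> in M. s < max 1 (N (A0 \<omega>)))"
    unfolding D_def by (subst measure_distr) (auto intro!: arg_cong[where f="measure M"])
  also have "\<dots> = (if s < 1 then 1 else T s)"
    by (auto simp: T_def less_max_iff_disj prob_space intro!: arg_cong[where f="measure M"])
  finally show ?thesis .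
qed

lemma product_condition_eventually:
  assumes "e > 0"
  shows "eventually (\<lambda>L. eventually (\<lambda>t. 
    \<P>(\<omega> in M. N (A 1 \<omega>) * N (A 2 \<omega>) > t \<and> L < N (A 1 \<omega>) \<and> N (A 1 \<omega>) \<le> t / L) \<le> e * T t) at_top) at_top"
proof -
  have "eventually (\<lambda>L. Limsup at_top (\<lambda>t.
           ereal (\<P>(\<omega> in M. N (A 1 \<omega>) * N (A 2 \<omega>) > t \<and> L < N (A 1 \<omega>) \<and> N (A 1 \<omega>) \<le> t / L)
                  / tail_prob N M A0 t)) < ereal e) at_top"
    using assms by (intro order_tendstoD(2)[OF product_condition]) simp
  then show ?thesis
  proof eventually_elim
    case (elim L)
    then have "eventually (\<lambda>t. ereal (\<P>(\<omega> in M. N (A 1 \<omega>) * N (A 2 \<omega>) > t \<and> L < N (A 1 \<omega>) \<and> N (A 1 \<omega>) \<le> t / L)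
                  / tail_prob N M A0 t) < ereal e) at_top"
      by (rule Limsup_lessD)
    then show ?case
    proof eventually_elim
      case (elim t)
      then show ?case using T_pos[of t] by (simp add: T_def pos_divide_less_eq less_imp_le)
    qed
  qed
qed

text \<open>
  For \<open>L \<ge> 1\<close> the event about two factors forces both norms to exceed \<open>1\<close>, so it is the same
  for the norms and for their maxima with \<open>1\<close>.
\<close>

sublocale iid: iid_factors M Z D "\<lambda>s. measure D {s<..}" \<alpha>
proof
  have "indep_vars (\<lambda>_. borel) (\<lambda>i \<omega>. max 1 (N (A i \<omega>))) {1..}"
    by (rule indep_vars_compose2[OF indep, where Y="\<lambda>_ x. max 1 (N x)"]) measurable
  then show "indep_vars (\<lambda>_. borel) Z {1..}" unfolding Z_def[abs_def] .
  show "distr M borel (Z i) = D" if "1 \<le> i" for i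
  proof -
    have "distr M borel (Z i) = distr (distr M borel (A i)) borel (\<lambda>x. max 1 (N x))"
      using that by (subst distr_distr) (auto simp: Z_def[abs_def] comp_def)
    also have "\<dots> = D" unfolding ident[OF that] D_def by (subst distr_distr) (auto simp: comp_def)
    finally show ?thesis .
  qed
  show "1 \<le> Z i \<omega>" for i \<omega> by (simp add: Z_def)
  show "measure D {s<..} = measure D {s<..}" for s ..
  show "0 < \<alpha>" by (rule \<alpha>)
  show "regular_tail \<alpha> (\<lambda>s. measure D {s<..})"
    unfolding regular_tail_def
  proof (intro allI impI)
    fix u :: real assume u: "u > 0"
    have "eventually (\<lambda>t. T (u * t) / T t = measure D {u * t<..} / measure D {t<..}) at_top"
      using eventually_ge_at_top[of 1] eventually_ge_at_top[of "1 / u"]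
    proof eventually_elim
      case (elim t)
      then have "u * t \<ge> 1" using u by (simp add: field_simps)
      with elim show ?case by (simp add: D_tail)
    qed
    then show "((\<lambda>t. measure D {u * t<..} / measure D {t<..}) \<longlongrightarrow> u powr - \<alpha>) at_top"
      by (rule Lim_transform_eventually[OF regular_tailD[OF tail_T u]])
  qed
  show "\<exists>L0. \<forall>L\<ge>L0. eventually (\<lambda>t.
       \<P>(\<omega> in M. Z 2 \<omega> * Z 1 \<omega> > t \<and> Z 1 \<omega> \<in> {L<..t / L}) \<le> e * measure D {t<..}) at_top" if "e > 0" for e
  proof -
    from product_condition_eventually[OF that] obtain L0 where L0: "\<And>L. L \<ge> L0 \<Longrightarrow> eventually (\<lambda>t. 
    \<P>(\<omega> in M. N (A 1 \<omega>) * N (A 2 \<omega>) > t \<and> L < N (A 1 \<omega>) \<and> N (A 1 \<omega>) \<le> t / L) \<le> e * T t) at_top"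
      by (auto simp: eventually_at_top_linorder)
    show ?thesis
    proof (intro exI[of _ "max 1 L0"] allI impI)
      fix L assume "max 1 L0 \<le> L"
      then have L: "L \<ge> 1" "L \<ge> L0" by auto
      show "eventually (\<lambda>t. \<P>(\<omega> in M. Z 2 \<omega> * Z 1 \<omega> > t \<and> Z 1 \<omega> \<in> {L<..t / L}) \<le> e * measure D {t<..}) at_top"
        using L0[OF L(2)] eventually_ge_at_top[of 1]
      proof eventually_elim
        case (elim t)
        have "\<P>(\<omega> in M. Z 2 \<omega> * Z 1 \<omega> > t \<and> Z 1 \<omega> \<in> {L<..t / L}) \<le> 
           \<P>(\<omega> in M. N (A 1 \<omega>) * N (A 2 \<omega>) > t \<and> L < N (A 1 \<omega>) \<and> N (A 1 \<omega>) \<le> t / L)"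
        proof (rule finite_measure_mono)
          show "{\<omega>\<in>space M. Z 2 \<omega> * Z 1 \<omega> > t \<and> Z 1 \<omega> \<in> {L<..t / L}} \<subseteq>
             {\<omega>\<in>space M. N (A 1 \<omega>) * N (A 2 \<omega>) > t \<and> L < N (A 1 \<omega>) \<and> N (A 1 \<omega>) \<le> t / L}"
          proof
            fix \<omega> assume *: "\<omega> \<in> {\<omega>\<in>space M. Z 2 \<omega> * Z 1 \<omega> > t \<and> Z 1 \<omega> \<in> {L<..t / L}}"
            then have Z1: "Z 1 \<omega> = N (A 1 \<omega>)" using L by (auto simp: Z_def)
            have "\<not> Z 2 \<omega> \<le> 1"
            proof
              assume "Z 2 \<omega> \<le> 1"
              then have "Z 2 \<omega> * Z 1 \<omega> \<le> 1 * Z 1 \<omega>" by (intro mult_right_mono) (auto simp: Z_def)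
              also have "\<dots> \<le> t / L" using * by simp
              also have "\<dots> \<le> t" using L elim(2) by (simp add: field_simps mult_le_cancel_left1)
              finally show False using * by simp
            qed
            then have "Z 2 \<omega> = N (A 2 \<omega>)" by (auto simp: Z_def)
            with * Z1 show "\<omega> \<in> {\<omega>\<in>space M. N (A 1 \<omega>) * N (A 2 \<omega>) > t \<and> L < N (A 1 \<omega>) \<and> N (A 1 \<omega>) \<le> t / L}"
              by (simp add: mult.commute)
          qed
          have [measurable]: "A 1 \<in> borel_measurable M" "A 2 \<in> borel_measurable M" by auto
          show "{\<omega>\<in>space M. N (A 1 \<omega>) * N (A 2 \<omega>) > t \<and> L < N (A 1 \<omega>) \<and> N (A 1 \<omega>) \<le> t / L} \<in> sets M"
            by measurable
        qed
        also have "\<dots> \<le> e * T t" by (rule elim)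
        also have "T t = measure D {t<..}" using elim by (simp add: D_tail)
        finally show ?case .
      qed
    qed
  qed
qed

text \<open>
  The size of the surroundings of the \<open>k\<close>-th factor.
\<close>

definition W :: "nat \<Rightarrow> 'w \<Rightarrow> real" where "W k \<omega> = (\<Prod>i\<in>{1..n} - {k}. Z i \<omega>)"

definition Prd :: "'w \<Rightarrow> real^'n^'n" where "Prd \<omega> = mat_prod (\<lambda>i. A i \<omega>) 1 n"

abbreviation R :: "nat \<Rightarrow> 'w \<Rightarrow> real^'n^'n" where "R \<equiv> repl_prod A \<theta> n"

abbreviation Lf :: "nat \<Rightarrow> 'w \<Rightarrow> real^'n^'n" where "Lf k \<omega> \<equiv> mat_prod (\<lambda>i. A i \<omega>) 1 (k - 1)"
abbreviation Rt :: "nat \<Rightarrow> 'w \<Rightarrow> real^'n^'n" where "Rt k \<omega> \<equiv> mat_prod (\<lambda>i. A i \<omega>) (k + 1) n"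

abbreviation dir :: "real^'n^'n \<Rightarrow> real^'n^'n" where "dir x \<equiv> x /\<^sub>R N x"

lemma Prd_split: "k \<in> {1..n} \<Longrightarrow> Prd \<omega> = Lf k \<omega> ** A k \<omega> ** Rt k \<omega>"
  unfolding Prd_def by (rule mat_prod_split) auto

lemma R_eq: "R k \<omega> = Lf k \<omega> ** \<theta> k \<omega> ** Rt k \<omega>"
  by (simp add: repl_prod_def)

lemma W_ge_1: "W k \<omega> \<ge> 1" unfolding W_def by (rule iid.prod_Z_ge_1)

lemma W_Z: "k \<in> {1..n} \<Longrightarrow> W k \<omega> * Z k \<omega> = (\<Prod>i=1..n. Z i \<omega>)"
  unfolding W_def by (subst prod.remove[of "{1..n}" k]) (auto simp: mult.commute)

lemma Lf_meas [measurable]: "Lf k \<in> borel_measurable M"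
  by (rule measurable_mat_prod) auto

lemma Rt_meas [measurable]: "Rt k \<in> borel_measurable M"
  by (rule measurable_mat_prod) auto

lemma Prd_meas [measurable]: "Prd \<in> borel_measurable M"
  unfolding Prd_def[abs_def] by (rule measurable_mat_prod) auto

lemma R_meas [measurable]: "k \<ge> 1 \<Longrightarrow> R k \<in> borel_measurable M"
  unfolding R_eq[abs_def] by measurable

lemma W_meas [measurable]: "W k \<in> borel_measurable M"
  unfolding W_def[abs_def] by (intro borel_measurable_prod iid.Z_meas) auto

text \<open>
  Some constant that works for all positions \<open>k\<close> at once, so that the influence of the surroundings
  is measured by \<open>W k\<close> alone.
\<close>

definition \<kappa> :: real where
  "\<kappa> = (SOME \<kappa>. \<kappa> > 0 \<and> (\<forall>k\<in>{1..n}. \<forall>\<omega> x. N (Lf k \<omega> ** x ** Rt k \<omega>) \<le> \<kappa> * W k \<omega> * N x))"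

lemma kappa_props: "\<kappa> > 0" "k \<in> {1..n} \<Longrightarrow> N (Lf k \<omega> ** x ** Rt k \<omega>) \<le> \<kappa> * W k \<omega> * N x"
proof -
  obtain c where c: "c \<ge> 1" "\<And>x y :: real^'n^'n. N (x ** y) \<le> c * (N x * N y)"
    using is_norm_matrix_mult[OF N] by metis
  let ?b = "N (mat 1) * c ^ n"
  have b0: "?b \<ge> 0" using c(1) is_norm_nonneg[OF N] by simp
  have bound: "N (Lf k \<omega> ** x ** Rt k \<omega>) \<le> (c * c * ?b * ?b + 1) * W k \<omega> * N x" if k: "k \<in> {1..n}" for k \<omega> x
  proof -
    let ?p = "\<Prod>i=1..k - 1. Z i \<omega>" and ?q = "\<Prod>i=k + 1..n. Z i \<omega>"
    have l: "N (Lf k \<omega>) \<le> ?b * ?p" unfolding Z_def using k by (intro mat_prod_norm_le[OF N c]) auto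
    have r: "N (Rt k \<omega>) \<le> ?b * ?q" unfolding Z_def using k by (intro mat_prod_norm_le[OF N c]) auto
    have pq: "?p * ?q = W k \<omega>"
    proof -
      have "{1..n} - {k} = {1..k - 1} \<union> {k + 1..n}" using k by auto
      then show ?thesis unfolding W_def by (simp add: prod.union_disjoint)
    qed
    have p: "?p \<ge> 0" "?q \<ge> 0" by (auto intro!: prod_nonneg simp: Z_def)
    have "N (Lf k \<omega> ** x ** Rt k \<omega>) \<le> c * (N (Lf k \<omega> ** x) * N (Rt k \<omega>))" by (rule c)
    also have "\<dots> \<le> c * ((c * (N (Lf k \<omega>) * N x)) * N (Rt k \<omega>))"
      using c is_norm_nonneg[OF N] by (intro mult_left_mono mult_right_mono) auto
    also have "\<dots> \<le> c * ((c * ((?b * ?p) * N x)) * (?b * ?q))"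
      using c(1) l r is_norm_nonneg[OF N] b0 p by (intro mult_left_mono mult_mono) auto
    also have "\<dots> = (c * c * ?b * ?b) * (?p * ?q) * N x" by (simp add: ac_simps)
    also have "\<dots> \<le> (c * c * ?b * ?b + 1) * W k \<omega> * N x"
      unfolding pq using W_ge_1[of k \<omega>] is_norm_nonneg[OF N] by (intro mult_right_mono) auto
    finally show ?thesis .
  qed
  have "c * c * ?b * ?b + 1 > 0" using c(1) b0 by (intro add_nonneg_pos) auto
  with bound have "\<exists>\<kappa>. \<kappa> > 0 \<and> (\<forall>k\<in>{1..n}. \<forall>\<omega> x. N (Lf k \<omega> ** x ** Rt k \<omega>) \<le> \<kappa> * W k \<omega> * N x)"
    by blast
  from someI_ex[OF this] show "\<kappa> > 0" "k \<in> {1..n} \<Longrightarrow> N (Lf k \<omega> ** x ** Rt k \<omega>) \<le> \<kappa> * W k \<omega> * N x"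
    unfolding \<kappa>_def[symmetric] by blast+
qed

text \<open>
  The surroundings are one function of the factors other than the \<open>k\<close>-th, for both independence
  hypotheses: in \<open>theta_indep\<close> the direction \<open>\<theta> k\<close> occupies index \<open>0\<close>.
\<close>

lemma indep_rest:
  assumes k: "k \<in> {1..n}"
  shows "indep_pair (borel \<Otimes>\<^sub>M borel \<Otimes>\<^sub>M borel) (\<lambda>\<omega>. (Lf k \<omega>, Rt k \<omega>, W k \<omega>)) borel (A k)"
    and "indep_pair (borel \<Otimes>\<^sub>M borel \<Otimes>\<^sub>M borel) (\<lambda>\<omega>. (Lf k \<omega>, Rt k \<omega>, W k \<omega>)) borel (\<theta> k)"
proof -
  let ?J = "{1..n} - {k}"
  define F where "F g = (mat_prod g 1 (k - 1), mat_prod g (k + 1) n, \<Prod>i\<in>?J. max 1 (N (g i)))" for g :: "nat \<Rightarrow> real^'n^'n"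
  have comp: "(\<lambda>g. g l) \<in> borel_measurable (PiM ?J (\<lambda>_. borel))" if "l \<in> ?J" for l
    using measurable_component_singleton[OF that] by simp
  have F: "F \<in> PiM ?J (\<lambda>_. borel) \<rightarrow>\<^sub>M borel \<Otimes>\<^sub>M borel \<Otimes>\<^sub>M borel"
    unfolding F_def[abs_def]
    by (intro measurable_Pair measurable_mat_prod borel_measurable_prod borel_measurable_max borel_measurable_const
        measurable_compose[OF comp N_meas] comp) (use k in auto)
  have FX: "F (restrict (\<lambda>i. X i \<omega>) ?J) = (Lf k \<omega>, Rt k \<omega>, W k \<omega>)" if "\<And>i. i \<in> ?J \<Longrightarrow> X i = A i" for X \<omega>
  proof -
    have "mat_prod (restrict (\<lambda>i. X i \<omega>) ?J) 1 (k - 1) = Lf k \<omega>"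
      by (rule mat_prod_cong) (use that k in auto)
    moreover have "mat_prod (restrict (\<lambda>i. X i \<omega>) ?J) (k + 1) n = Rt k \<omega>"
      by (rule mat_prod_cong) (use that k in auto)
    ultimately show ?thesis using that unfolding F_def W_def Z_def by simp
  qed
  show "indep_pair (borel \<Otimes>\<^sub>M borel \<Otimes>\<^sub>M borel) (\<lambda>\<omega>. (Lf k \<omega>, Rt k \<omega>, W k \<omega>)) borel (A k)"
  proof -
    have "k \<in> {1..}" "?J \<subseteq> {1..}" "k \<notin> ?J" using k by auto
    from indep_pair_component[OF indep this F] show ?thesis by (simp only: FX)
  qed
  have "k \<ge> 1" using k by simp
  then show "indep_pair (borel \<Otimes>\<^sub>M borel \<Otimes>\<^sub>M borel) (\<lambda>\<omega>. (Lf k \<omega>, Rt k \<omega>, W k \<omega>)) borel (\<theta> k)"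
    using indep_pair_component[OF theta_indep _ _ _ F, of k 0] FX[of "\<lambda>i. if i = 0 then \<theta> k else A i"] by simp
qed

lemma AE_theta: "k \<ge> 1 \<Longrightarrow> AE \<omega> in M. N (\<theta> k \<omega>) = 1"
proof -
  assume k: "k \<ge> 1"
  have "AE x in distr M borel (\<theta> k). N x = 1" 
    unfolding theta_copies[OF k] by (rule spectral_law_AE[OF N spectral])
  then show ?thesis using k by (subst (asm) AE_distr_iff) auto
qed

lemma R_bound: "k \<in> {1..n} \<Longrightarrow> AE \<omega> in M. N (R k \<omega>) powr \<alpha> \<le> \<kappa> powr \<alpha> * W k \<omega> powr \<alpha>"
proof -
  assume k: "k \<in> {1..n}"
  then have "k \<ge> 1" by simp
  from AE_theta[OF this] show ?thesis
  proof eventually_elim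
    case (elim \<omega>)
    have "N (R k \<omega>) \<le> \<kappa> * W k \<omega>" using kappa_props(2)[OF k, of \<omega> "\<theta> k \<omega>"] elim by (simp add: R_eq)
    then have "N (R k \<omega>) powr \<alpha> \<le> (\<kappa> * W k \<omega>) powr \<alpha>"
      using \<alpha> is_norm_nonneg[OF N] by (intro powr_mono2) auto
    then show ?case using kappa_props(1) W_ge_1[of k \<omega>] by (simp add: powr_mult)
  qed
qed

lemma integrable_W: "integrable M (\<lambda>\<omega>. W k \<omega> powr \<alpha>)"
  unfolding W_def by (rule iid.integrable_prod_powr) auto

lemma integrable_R: 
  assumes k: "k \<in> {1..n}" shows "integrable M (\<lambda>\<omega>. N (R k \<omega>) powr \<alpha>)"
proof (rule Bochner_Integration.integrable_bound[OF integrable_mult_right[OF integrable_W]])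
  have [measurable]: "R k \<in> borel_measurable M" using k by simp
  show "(\<lambda>\<omega>. N (R k \<omega>) powr \<alpha>) \<in> borel_measurable M" by measurable
  show "AE \<omega> in M. norm (N (R k \<omega>) powr \<alpha>) \<le> norm (\<kappa> powr \<alpha> * W k \<omega> powr \<alpha>)"
    using R_bound[OF k] by eventually_elim simp
qed

lemma W_le_Z: "k \<in> {1..n} \<Longrightarrow> l \<in> {1..n} \<Longrightarrow> l \<noteq> k \<Longrightarrow> Z k \<omega> \<le> W l \<omega>"
proof -
  assume *: "k \<in> {1..n}" "l \<in> {1..n}" "l \<noteq> k"
  have "W l \<omega> = Z k \<omega> * (\<Prod>i\<in>{1..n} - {l} - {k}. Z i \<omega>)"
    unfolding W_def using * by (intro prod.remove) auto
  moreover have "Z k \<omega> * 1 \<le> Z k \<omega> * (\<Prod>i\<in>{1..n} - {l} - {k}. Z i \<omega>)"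
    by (intro mult_left_mono iid.prod_Z_ge_1 less_imp_le[OF iid.Z_pos])
  ultimately show ?thesis by simp
qed

abbreviation two_large :: "nat \<Rightarrow> real \<Rightarrow> real \<Rightarrow> 'w set" where
  "two_large k s L \<equiv> {\<omega>\<in>space M. W k \<omega> * Z k \<omega> > s \<and> W k \<omega> > L \<and> Z k \<omega> > L}"

text \<open>
  On the event in question, \<open>W k \<le> L\<close> for exactly one \<open>k\<close>, unless some \<open>W k\<close> and \<open>Z k\<close> both
  exceed \<open>L\<close>.  If \<open>W k \<le> L\<close> and \<open>W l \<le> L\<close> for distinct \<open>k\<close> and \<open>l\<close>, then also
  \<open>Z k \<le> W l \<le> L\<close> and the whole product is at most \<open>L ^ 2\<close>.  If there is no such \<open>k\<close>, some
  \<open>Z k\<close> exceeds \<open>L\<close>, since otherwise the product is at most \<open>L ^ n\<close>.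
\<close>

lemma single_jump_split:
  assumes s: "s \<ge> L ^ 2" "s \<ge> L ^ n" and big: "(\<Prod>i=1..n. Z i \<omega>) > s" and L: "L \<ge> 1"
  shows "\<bar>1 - (\<Sum>k=1..n. indicator {..L} (W k \<omega>))\<bar> \<le> 
    (\<Sum>k=1..n. indicator {\<omega>. W k \<omega> * Z k \<omega> > s \<and> W k \<omega> > L \<and> Z k \<omega> > L} \<omega> :: real)"
proof (cases "\<exists>k\<in>{1..n}. W k \<omega> \<le> L")
  case True
  then obtain k where k: "k \<in> {1..n}" "W k \<omega> \<le> L" by auto
  have other: "\<not> W l \<omega> \<le> L" if "l \<in> {1..n}" "l \<noteq> k" for l
  proof
    assume "W l \<omega> \<le> L"
    then have "Z k \<omega> \<le> L" using W_le_Z[OF k(1) that, of \<omega>] by simp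
    then have "W k \<omega> * Z k \<omega> \<le> L * L" using k(2) L by (intro mult_mono less_imp_le[OF iid.Z_pos]) auto
    then show False using big s(1) W_Z[OF k(1), of \<omega>] by (simp add: power2_eq_square)
  qed
  have "(\<Sum>l=1..n. indicator {..L} (W l \<omega>)) = (\<Sum>l=1..n. if l = k then 1 else 0 :: real)"
    by (intro sum.cong refl) (use other k in auto)
  also have "\<dots> = 1" using k by simp
  finally show ?thesis by (simp add: sum_nonneg)
next
  case False
  then have z: "(\<Sum>l=1..n. indicator {..L} (W l \<omega>)) = (0::real)" by (intro sum.neutral) auto
  have "\<exists>k\<in>{1..n}. Z k \<omega> > L"
  proof (rule ccontr)
    assume "\<not> (\<exists>k\<in>{1..n}. Z k \<omega> > L)"
    then have "(\<Prod>i=1..n. Z i \<omega>) \<le> (\<Prod>i=1..n. L)" 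
      by (intro prod_mono) (auto simp: not_less less_imp_le[OF iid.Z_pos])
    then show False using big s(2) by simp
  qed
  then obtain k where k: "k \<in> {1..n}" "Z k \<omega> > L" by auto
  have Wk: "W k \<omega> > L" using False k(1) not_le by blast
  have "\<omega> \<in> {\<omega>. W k \<omega> * Z k \<omega> > s \<and> W k \<omega> > L \<and> Z k \<omega> > L}" 
    using Wk k(2) big W_Z[OF k(1), of \<omega>] by auto
  then have "(1::real) \<le> indicator {\<omega>. W k \<omega> * Z k \<omega> > s \<and> W k \<omega> > L \<and> Z k \<omega> > L} \<omega>" by simp
  also have "\<dots> \<le> (\<Sum>k=1..n. indicator {\<omega>. W k \<omega> * Z k \<omega> > s \<and> W k \<omega> > L \<and> Z k \<omega> > L} \<omega>)"
    using k by (intro member_le_sum) auto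
  finally show ?thesis unfolding z by simp
qed

text \<open>
  This is \<open>two_factors_large\<close> for all positions at once.  The constant \<open>c\<close> absorbs the norm
  constants by which the product of matrices differs from the product of their norms.
\<close>

lemma two_large_negligible:
  assumes "c > 0" "e > 0"
  shows "eventually (\<lambda>L. eventually (\<lambda>t. \<forall>k\<in>{1..n}. 
    prob (two_large k (c * t) L) \<le> e * T t) at_top) at_top"
proof -
  \<comment> \<open>The summand \<open>1\<close> leaves room to replace \<open>T (c * t) / T t\<close> by its limit.\<close>
  define e' where "e' = e / (c powr - \<alpha> + 1)"
  have e': "e' > 0" "e' * (c powr - \<alpha> + 1) = e" using assms(2) add_nonneg_pos[OF powr_ge_zero[of c "- \<alpha>"], of 1] by (auto simp: e'_def)
  have "eventually (\<lambda>L. \<forall>k\<in>{1..n}. eventually (\<lambda>t. 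
    prob (two_large k t L) \<le> e' * measure D {t<..}) at_top) at_top"
  proof (rule eventually_ball_finite)
    show "\<forall>k\<in>{1..n}. eventually (\<lambda>L. eventually (\<lambda>t. 
      prob (two_large k t L) \<le> e' * measure D {t<..}) at_top) at_top"
    proof
      fix k assume k: "k \<in> {1..n}"
      have sub: "{1..n} - {k} \<subseteq> {1..}" by auto
      obtain C where C: "\<And>s. \<P>(\<omega> in M. (\<Prod>i\<in>{1..n} - {k}. Z i \<omega>) > s) \<le> C * measure D {s<..}"
        using iid.prod_tail_bound[OF finite_Diff[OF finite_atLeastAtMost] sub] by blast
      show "eventually (\<lambda>L. eventually (\<lambda>t. 
      prob (two_large k t L) \<le> e' * measure D {t<..}) at_top) at_top"
        unfolding W_def by (rule iid.two_factors_large[OF _ _ _ _ C e'(1)]) (use k in auto)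
    qed
  qed simp
  then show ?thesis
  proof eventually_elim
    case (elim L)
    have ct: "filterlim (\<lambda>t. c * t) at_top at_top"
      by (rule filterlim_tendsto_pos_mult_at_top[OF tendsto_const assms(1) filterlim_ident])
    have "eventually (\<lambda>t. \<forall>k\<in>{1..n}. 
      prob (two_large k t L) \<le> e' * measure D {t<..}) at_top"
      using elim by (intro eventually_ball_finite) auto
    from eventually_compose_filterlim[OF this ct]
    have 1: "eventually (\<lambda>t. \<forall>k\<in>{1..n}. 
      prob (two_large k (c * t) L) \<le> e' * measure D {c * t<..}) at_top" .
    have 2: "eventually (\<lambda>t. T (c * t) / T t < c powr - \<alpha> + 1) at_top"
      by (rule order_tendstoD(2)[OF regular_tailD[OF tail_T assms(1)]]) simp
    have 3: "eventually (\<lambda>t. c * t \<ge> 1) at_top" using ct by (simp add: filterlim_at_top)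
    from 1 2 3 show ?case
    proof eventually_elim
      case (elim t)
      have "measure D {c * t<..} \<le> (c powr - \<alpha> + 1) * T t"
        using elim(2,3) T_pos[of t] by (simp add: D_tail pos_divide_less_eq)
      then have "e' * measure D {c * t<..} \<le> e' * ((c powr - \<alpha> + 1) * T t)"
        using e' by (intro mult_left_mono) auto
      also have "\<dots> = e * T t" using e'(2) by (simp flip: mult.assoc)
      finally show ?case using elim(1) by (auto intro: order_trans)
    qed
  qed
qed

end

section \<open>Test functions for the direction\<close>

lemma pareto_ramp:
  assumes "\<alpha> > 0" "0 < a" "a < b"
  shows "integrable (pareto \<alpha>) (ramp a b)"
    and "b powr - \<alpha> \<le> (\<integral>r. ramp a b r \<partial>pareto \<alpha>)" "(\<integral>r. ramp a b r \<partial>pareto \<alpha>) \<le> a powr - \<alpha>"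
proof -
  note r = ramp_props[OF assms(3)]
  have em: "emeasure (pareto \<alpha>) {c<..} = ennreal (c powr - \<alpha>)" "measure (pareto \<alpha>) {c<..} = c powr - \<alpha>" if "c > 0" for c
    using emeasure_pareto_greaterThan[OF assms(1) that] measure_pareto_greaterThan[OF assms(1) that] by auto
  have ii: "integrable (pareto \<alpha>) (\<lambda>r. indicator {c<..} r :: real)" if "c > 0" for c
    using em[OF that] by (intro integrable_real_indicator) auto
  have up: "ramp a b x \<le> indicator {a<..} x" for x
    using r(2,3)[of x] by (auto split: split_indicator)
  have lo: "indicator {b<..} x \<le> ramp a b x" for x
    using r(1,4)[of x] by (auto split: split_indicator)
  show i: "integrable (pareto \<alpha>) (ramp a b)"
    by (rule Bochner_Integration.integrable_bound[OF ii[OF assms(2)]]) (use up r(1) in auto)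
  show "b powr - \<alpha> \<le> (\<integral>r. ramp a b r \<partial>pareto \<alpha>)"
    using integral_mono[OF ii i lo] assms em[of b] by simp
  show "(\<integral>r. ramp a b r \<partial>pareto \<alpha>) \<le> a powr - \<alpha>"
    using integral_mono[OF i ii up] assms em[of a] by simp
qed

text \<open>
  The cutoff hides the discontinuity of the direction at the origin, and when \<open>a\<close> and \<open>b\<close>
  approach \<open>1\<close> it approximates the indicator of \<open>N x > 1\<close>.
\<close>

definition directional_test :: "('a::real_vector \<Rightarrow> real) \<Rightarrow> ('a \<Rightarrow> real) \<Rightarrow> real \<Rightarrow> real \<Rightarrow> 'a \<Rightarrow> real" where
  "directional_test N g a b x = g (x /\<^sub>R N x) * ramp a b (N x)"

lemma directional_test_fun:
  fixes N :: "'a::euclidean_space \<Rightarrow> real"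
  assumes N: "is_norm N" and g: "continuous_on UNIV g" "\<And>x. 0 \<le> g x" "\<And>x. g x \<le> C" and ab: "0 < a" "a < b"
  shows "test_fun N C a (directional_test N g a b)"
  unfolding test_fun_def
proof (intro conjI allI impI)
  note r = ramp_props[OF ab(2)]
  show "directional_test N g a b x = 0" if "N x \<le> a" for x
    using r(3)[OF that] by (simp add: directional_test_def)
  show "0 \<le> directional_test N g a b x" for x
    using g(2) r(1) by (simp add: directional_test_def)
  show "directional_test N g a b x \<le> C" for x
  proof -
    have "directional_test N g a b x \<le> C * 1"
      unfolding directional_test_def using g(2,3) r(1,2) order_trans[OF g(2) g(3)] by (intro mult_mono) auto
    then show ?thesis by simp
  qed
  have "continuous_on ({x. N x < a} \<union> - {0}) (directional_test N g a b)"
  proof (rule continuous_on_open_Un)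
    show "open {x. N x < a}"
      by (intro open_Collect_less is_norm_continuous[OF N] continuous_intros)
    show "continuous_on {x. N x < a} (directional_test N g a b)"
      by (subst continuous_on_cong[OF refl, where g="\<lambda>_. 0"]) (auto simp: directional_test_def r(3))
    show "continuous_on (- {0}) (directional_test N g a b)"
      unfolding directional_test_def
      by (intro continuous_on_mult continuous_on_compose2[OF g(1)] continuous_on_compose2[OF continuous_ramp[of UNIV]]
          continuous_intros is_norm_continuous[OF N]) (auto simp: is_norm_eq_0[OF N])
  qed auto
  moreover have "{x. N x < a} \<union> - {0} = UNIV" using ab(1) is_norm_zero[OF N] by auto
  ultimately show "continuous_on UNIV (directional_test N g a b)" by simp
qed (use ab in auto)

lemma direction_scaleR:
  assumes "is_norm N" "r > 0"
  shows "(r *\<^sub>R x) /\<^sub>R N (r *\<^sub>R x) = x /\<^sub>R N x"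
proof -
  have "inverse (r * N x) * r = inverse (N x)" using assms(2) by (simp add: field_simps)
  then show ?thesis using assms by (simp add: is_norm_scaleR)
qed

lemma directional_test_scaleR:
  assumes "is_norm N" "r > 0"
  shows "directional_test N g a b (r *\<^sub>R x) = g (x /\<^sub>R N x) * ramp a b (r * N x)"
  using assms(2) unfolding directional_test_def direction_scaleR[OF assms] by (simp add: is_norm_scaleR[OF assms(1)])

text \<open>
  The direction is constant along the ray through \<open>y\<close>, and rescaling the radius by \<open>N y\<close> produces
  the factor \<open>N y powr \<alpha>\<close>.
\<close>

lemma radial_integral_directional:
  fixes N :: "'a::euclidean_space \<Rightarrow> real"
  assumes N: "is_norm N" and \<alpha>: "\<alpha> > 0" and ab: "0 < a" "a < b"
    and [measurable]: "g \<in> borel_measurable borel"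
  shows "radial_integral \<alpha> (directional_test N g a b) y = 
    (\<integral>r. ramp a b r \<partial>pareto \<alpha>) * (N y powr \<alpha> * g (y /\<^sub>R N y))"
proof (cases "y = 0")
  case True
  then show ?thesis using ramp_props(3)[OF ab(2), of 0] ab
    by (simp add: radial_integral_def directional_test_def is_norm_zero[OF N])
next
  case False
  then have Ny: "N y > 0" by (rule is_norm_pos[OF N])
  have [measurable]: "N \<in> borel_measurable borel" by (rule is_norm_borel[OF N])
  have "radial_integral \<alpha> (directional_test N g a b) y = (\<integral>r. g (y /\<^sub>R N y) * ramp a b (N y * r) \<partial>pareto \<alpha>)"
    unfolding radial_integral_def
  proof (rule integral_cong_AE)
    have eq: "directional_test N g a b (r *\<^sub>R y) = g (y /\<^sub>R N y) * ramp a b (N y * r)" if "r > 0" for r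
      using that by (simp add: directional_test_scaleR[OF N] mult.commute)
    show "AE r in pareto \<alpha>. directional_test N g a b (r *\<^sub>R y) = g (y /\<^sub>R N y) * ramp a b (N y * r)"
      using AE_pareto_pos[of \<alpha>] by eventually_elim (rule eq)
    show "(\<lambda>r. g (y /\<^sub>R N y) * ramp a b (N y * r)) \<in> borel_measurable (pareto \<alpha>)" by measurable
    show "(\<lambda>r. directional_test N g a b (r *\<^sub>R y)) \<in> borel_measurable (pareto \<alpha>)"
      unfolding directional_test_def by measurable
  qed
  also have "\<dots> = g (y /\<^sub>R N y) * (\<integral>r. ramp a b (N y * r) \<partial>pareto \<alpha>)" by simp
  also have "(\<integral>r. ramp a b (N y * r) \<partial>pareto \<alpha>) = enn2real (\<integral>\<^sup>+r. ennreal (ramp a b (N y * r)) \<partial>pareto \<alpha>)"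
    by (intro integral_eq_nn_integral) (auto simp: ramp_props(1)[OF ab(2)])
  also have "(\<integral>\<^sup>+r. ennreal (ramp a b (N y * r)) \<partial>pareto \<alpha>) = ennreal (N y powr \<alpha>) * (\<integral>\<^sup>+r. ennreal (ramp a b r) \<partial>pareto \<alpha>)"
    by (rule nn_integral_pareto_scale[OF Ny]) measurable
  also have "(\<integral>\<^sup>+r. ennreal (ramp a b r) \<partial>pareto \<alpha>) = ennreal (\<integral>r. ramp a b r \<partial>pareto \<alpha>)"
    by (intro nn_integral_eq_integral pareto_ramp(1)[OF \<alpha> ab]) (auto simp: ramp_props(1)[OF ab(2)])
  finally show ?thesis by (simp add: enn2real_mult ramp_props(1)[OF ab(2)])
qed

section \<open>The single big jump\<close>

context matrix_factors
begin

text \<open>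
  The truncation of the surroundings can be removed in the limit, because \<open>W k powr \<alpha>\<close> dominates
  and is integrable.
\<close>

lemma radial_truncation_limit:
  assumes f: "test_fun N B \<delta> f" and k: "k \<in> {1..n}"
  shows "((\<lambda>L. \<integral>\<omega>. radial_integral \<alpha> f (R k \<omega>) * indicator {..L} (W k \<omega>) \<partial>M) \<longlongrightarrow>
    (\<integral>\<omega>. radial_integral \<alpha> f (R k \<omega>) \<partial>M)) at_top"
proof -
  note tf = test_funD[OF f]
  have [measurable]: "f \<in> borel_measurable borel" by (rule tf)
  have [measurable]: "R k \<in> borel_measurable M" using k by simp
  let ?ri = "\<lambda>\<omega>. radial_integral \<alpha> f (R k \<omega>)"
  have ri_le: "AE \<omega> in M. norm (?ri \<omega>) \<le> B * (\<kappa> / \<delta>) powr \<alpha> * W k \<omega> powr \<alpha>"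
    using R_bound[OF k]
  proof eventually_elim
    case (elim \<omega>)
    have "?ri \<omega> \<le> B * (N (R k \<omega>) / \<delta>) powr \<alpha>" by (rule radial_integral_le[OF \<alpha> N f])
    also have "\<dots> = B * (N (R k \<omega>) powr \<alpha> / \<delta> powr \<alpha>)" using tf(3) is_norm_nonneg[OF N] by (simp add: powr_divide)
    also have "\<dots> \<le> B * (\<kappa> powr \<alpha> * W k \<omega> powr \<alpha> / \<delta> powr \<alpha>)"
      using elim tf(6) by (intro mult_left_mono divide_right_mono) auto
    finally show ?case using radial_integral_nonneg[OF \<alpha> N f] kappa_props(1) tf(3) by (simp add: powr_divide)
  qed
  have int_ri: "integrable M ?ri"
  proof (rule Bochner_Integration.integrable_bound[OF integrable_mult_right[OF integrable_W]])
    show "?ri \<in> borel_measurable M" by measurable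
    show "AE \<omega> in M. norm (?ri \<omega>) \<le> norm (B * (\<kappa> / \<delta>) powr \<alpha> * W k \<omega> powr \<alpha>)"
      using ri_le by eventually_elim (use tf(6) in simp)
  qed
  show "((\<lambda>L. \<integral>\<omega>. ?ri \<omega> * indicator {..L} (W k \<omega>) \<partial>M) \<longlongrightarrow> (\<integral>\<omega>. ?ri \<omega> \<partial>M)) at_top"
  proof (rule integral_dominated_convergence_at_top)
    show "?ri \<in> borel_measurable M" "\<And>L. (\<lambda>\<omega>. ?ri \<omega> * indicator {..L} (W k \<omega>)) \<in> borel_measurable M"
      by measurable
    show "integrable M (\<lambda>\<omega>. norm (?ri \<omega>))" using int_ri by simp
    show "AE \<omega> in M. ((\<lambda>L. ?ri \<omega> * indicator {..L} (W k \<omega>)) \<longlongrightarrow> ?ri \<omega>) at_top"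
    proof (rule AE_I2)
      fix \<omega>
      have "eventually (\<lambda>L. ?ri \<omega> = ?ri \<omega> * indicator {..L} (W k \<omega>)) at_top"
        using eventually_ge_at_top[of "W k \<omega>"] by eventually_elim simp
      then show "((\<lambda>L. ?ri \<omega> * indicator {..L} (W k \<omega>)) \<longlongrightarrow> ?ri \<omega>) at_top"
        by (rule Lim_transform_eventually[OF tendsto_const])
    qed
    show "eventually (\<lambda>L. AE \<omega> in M. norm (?ri \<omega> * indicator {..L} (W k \<omega>)) \<le> norm (?ri \<omega>)) at_top"
      by (auto split: split_indicator)
  qed
qed

lemma Prd_norm_le: "N (Prd \<omega>) \<le> \<kappa> * (\<Prod>i=1..n. Z i \<omega>)"
proof -
  have "N (Prd \<omega>) \<le> \<kappa> * W 1 \<omega> * N (A 1 \<omega>)"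
    using Prd_split[of 1 \<omega>] kappa_props(2)[of 1 \<omega> "A 1 \<omega>"] n by simp
  also have "\<dots> \<le> \<kappa> * W 1 \<omega> * Z 1 \<omega>"
    using kappa_props(1) W_ge_1[of 1 \<omega>] by (intro mult_left_mono) (auto simp: Z_def)
  also have "\<dots> = \<kappa> * (\<Prod>i=1..n. Z i \<omega>)" using W_Z[of 1 \<omega>] n by simp
  finally show ?thesis .
qed

text \<open>
  Fix a large \<open>L\<close> and then let \<open>t\<close> grow.  On \<open>W k \<le> L\<close> the limit is \<open>single_jump_limit\<close> with the
  \<open>k\<close>-th factor as the large one.  By \<open>single_jump_split\<close> these events cover the support of
  \<open>f (Prd \<omega> /\<^sub>R t)\<close> exactly once, up to events with two large parts, which
  \<open>two_large_negligible\<close> controls.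
\<close>

theorem big_jump_limit:
  assumes f: "test_fun N B \<delta> f"
  shows "((\<lambda>t. (\<integral>\<omega>. f (Prd \<omega> /\<^sub>R t) \<partial>M) / T t) \<longlongrightarrow> (\<Sum>k=1..n. \<integral>\<omega>. radial_integral \<alpha> f (R k \<omega>) \<partial>M)) at_top"
proof (rule tendsto_approx)
  note tf = test_funD[OF f]
  have [measurable]: "f \<in> borel_measurable borel" by (rule tf)
  fix e :: real assume e: "e > 0"
  let ?ri = "\<lambda>k \<omega>. radial_integral \<alpha> f (R k \<omega>)"
  have "((\<lambda>L. \<Sum>k=1..n. \<integral>\<omega>. ?ri k \<omega> * indicator {..L} (W k \<omega>) \<partial>M) \<longlongrightarrow> (\<Sum>k=1..n. \<integral>\<omega>. ?ri k \<omega> \<partial>M)) at_top"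
    by (intro tendsto_sum radial_truncation_limit[OF f]) simp
  then have ev1: "eventually (\<lambda>L. dist (\<Sum>k=1..n. \<integral>\<omega>. ?ri k \<omega> * indicator {..L} (W k \<omega>) \<partial>M) (\<Sum>k=1..n. \<integral>\<omega>. ?ri k \<omega> \<partial>M) < e) at_top"
    by (rule tendstoD) fact
  define c where "c = \<delta> / \<kappa>"
  have c: "c > 0" using tf(3) kappa_props(1) by (simp add: c_def)
  \<comment> \<open>There are \<open>n\<close> events with two large parts, each with weight at most \<open>B\<close>, which may be zero.\<close>
  define e' where "e' = e / ((B + 1) * n)"
  have e': "e' > 0" "B * (n * e') \<le> e"
  proof -
    have B: "B + 1 > 0" using tf(6) by simp
    then show "e' > 0" unfolding e'_def using e n by (intro divide_pos_pos mult_pos_pos) auto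
    have "n * e' = e / (B + 1)" using n by (simp add: e'_def)
    then show "B * (n * e') \<le> e" using B e by (simp add: pos_divide_le_eq)
  qed
  have "eventually (\<lambda>L. L \<ge> 1 \<and> 
      dist (\<Sum>k=1..n. \<integral>\<omega>. ?ri k \<omega> * indicator {..L} (W k \<omega>) \<partial>M) (\<Sum>k=1..n. \<integral>\<omega>. ?ri k \<omega> \<partial>M) < e \<and>
      eventually (\<lambda>t. \<forall>k\<in>{1..n}. prob (two_large k (c * t) L) \<le> e' * T t) at_top) at_top"
    by (intro eventually_conj eventually_ge_at_top ev1 two_large_negligible[OF c e'(1)])
  then obtain L where L: "L \<ge> 1" 
    and L1: "dist (\<Sum>k=1..n. \<integral>\<omega>. ?ri k \<omega> * indicator {..L} (W k \<omega>) \<partial>M) (\<Sum>k=1..n. \<integral>\<omega>. ?ri k \<omega> \<partial>M) < e"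
    and L2: "eventually (\<lambda>t. \<forall>k\<in>{1..n}. prob (two_large k (c * t) L) \<le> e' * T t) at_top"
    by (auto dest: eventually_happens)
  define g where "g t = (\<Sum>k=1..n. (\<integral>\<omega>. f (Prd \<omega> /\<^sub>R t) * indicator {..L} (W k \<omega>) \<partial>M) / T t)" for t
  have "(g \<longlongrightarrow> (\<Sum>k=1..n. \<integral>\<omega>. ?ri k \<omega> * indicator {..L} (W k \<omega>) \<partial>M)) at_top"
    unfolding g_def
  proof (intro tendsto_sum)
    fix k assume k: "k \<in> {1..n}"
    then have k1: "k \<ge> 1" by simp
    show "((\<lambda>t. (\<integral>\<omega>. f (Prd \<omega> /\<^sub>R t) * indicator {..L} (W k \<omega>) \<partial>M) / T t) \<longlongrightarrow> 
       (\<integral>\<omega>. ?ri k \<omega> * indicator {..L} (W k \<omega>) \<partial>M)) at_top"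
      unfolding Prd_split[OF k] R_eq T_def
      by (rule single_jump_limit[OF N \<alpha> A0 tail spectral f ident[OF k1] theta_copies[OF k1] indep_rest[OF k] W_ge_1 kappa_props(1) kappa_props(2)[OF k]])
         (use L in simp)
  qed
  moreover have "eventually (\<lambda>t. \<bar>(\<integral>\<omega>. f (Prd \<omega> /\<^sub>R t) \<partial>M) / T t - g t\<bar> \<le> e) at_top"
  proof -
    have ct: "filterlim (\<lambda>t. c * t) at_top at_top"
      by (rule filterlim_tendsto_pos_mult_at_top[OF tendsto_const c filterlim_ident])
    have "eventually (\<lambda>t. c * t \<ge> L ^ 2 \<and> c * t \<ge> L ^ n) at_top"
      using ct by (intro eventually_conj) (auto simp: filterlim_at_top)
    from L2 this eventually_gt_at_top[of 0] show ?thesis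
    proof eventually_elim
      case (elim t)
      let ?E = "\<lambda>k. two_large k (c * t) L"
      have E: "?E k \<in> sets M" if "k \<in> {1..n}" for k
      proof -
        have [measurable]: "Z k \<in> borel_measurable M" using that by (intro iid.Z_meas) simp
        show ?thesis by measurable
      qed
      have i1: "integrable M (\<lambda>\<omega>. f (Prd \<omega> /\<^sub>R t))"
        by (intro integrable_const_bound[of _ B]) (use tf(4,5) in auto)
      have i2: "integrable M (\<lambda>\<omega>. f (Prd \<omega> /\<^sub>R t) * indicator {..L} (W k \<omega>))" for k
        by (intro integrable_const_bound[of _ B]) (use tf(4-6) in \<open>auto split: split_indicator\<close>)
      have i3: "integrable M (\<lambda>\<omega>. indicator (?E k) \<omega> :: real)" if "k \<in> {1..n}" for k
        using E[OF that] by (intro integrable_real_indicator) (auto simp: emeasure_eq_measure)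
      have "\<bar>(\<integral>\<omega>. f (Prd \<omega> /\<^sub>R t) \<partial>M) - (\<Sum>k=1..n. \<integral>\<omega>. f (Prd \<omega> /\<^sub>R t) * indicator {..L} (W k \<omega>) \<partial>M)\<bar> = 
        \<bar>\<integral>\<omega>. f (Prd \<omega> /\<^sub>R t) - (\<Sum>k=1..n. f (Prd \<omega> /\<^sub>R t) * indicator {..L} (W k \<omega>)) \<partial>M\<bar>"
        by (subst Bochner_Integration.integral_diff[OF i1 Bochner_Integration.integrable_sum[OF i2]],
            subst Bochner_Integration.integral_sum[OF i2]) simp
      also have "\<dots> \<le> (\<integral>\<omega>. B * (\<Sum>k=1..n. indicator (?E k) \<omega>) \<partial>M)"
      proof (rule order_trans[OF integral_abs_bound integral_mono])
        show "integrable M (\<lambda>\<omega>. \<bar>f (Prd \<omega> /\<^sub>R t) - (\<Sum>k=1..n. f (Prd \<omega> /\<^sub>R t) * indicator {..L} (W k \<omega>))\<bar>)"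
          by (intro integrable_abs Bochner_Integration.integrable_diff i1 Bochner_Integration.integrable_sum i2)
        show "integrable M (\<lambda>\<omega>. B * (\<Sum>k=1..n. indicator (?E k) \<omega>))" using i3 by auto
        fix \<omega> assume \<omega>: "\<omega> \<in> space M"
        show "\<bar>f (Prd \<omega> /\<^sub>R t) - (\<Sum>k=1..n. f (Prd \<omega> /\<^sub>R t) * indicator {..L} (W k \<omega>))\<bar> \<le> B * (\<Sum>k=1..n. indicator (?E k) \<omega>)"
        proof (cases "f (Prd \<omega> /\<^sub>R t) = 0")
          case True
          then show ?thesis using tf(6) by (simp add: sum_nonneg)
        next
          case False
          have "\<not> N (Prd \<omega> /\<^sub>R t) \<le> \<delta>" using False tf(7) by blast
          then have "\<delta> * t < N (Prd \<omega>)" using elim(3) by (simp add: is_norm_scaleR[OF N] field_simps)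
          also have "\<dots> \<le> \<kappa> * (\<Prod>i=1..n. Z i \<omega>)" by (rule Prd_norm_le)
          finally have big: "(\<Prod>i=1..n. Z i \<omega>) > c * t"
            using kappa_props(1) by (simp add: c_def field_simps)
          have "\<bar>f (Prd \<omega> /\<^sub>R t) - (\<Sum>k=1..n. f (Prd \<omega> /\<^sub>R t) * indicator {..L} (W k \<omega>))\<bar> =
            \<bar>f (Prd \<omega> /\<^sub>R t) * (1 - (\<Sum>k=1..n. indicator {..L} (W k \<omega>)))\<bar>"
            by (simp add: right_diff_distrib sum_distrib_left)
          also have "\<dots> \<le> B * (\<Sum>k=1..n. indicator {\<omega>. W k \<omega> * Z k \<omega> > c * t \<and> W k \<omega> > L \<and> Z k \<omega> > L} \<omega>)"
            unfolding abs_mult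
            by (intro mult_mono single_jump_split big L) (use tf(4-6) elim in auto)
          also have "\<dots> = B * (\<Sum>k=1..n. indicator (?E k) \<omega>)"
            using \<omega> by (intro arg_cong[where f="\<lambda>x. B * x"] sum.cong) (auto split: split_indicator)
          finally show ?thesis .
        qed
      qed
      also have "\<dots> = B * (\<Sum>k=1..n. measure M (?E k))"
        using i3 E by (simp add: Int_absorb1 sets.sets_into_space)
      also have "\<dots> \<le> B * (\<Sum>k=1..n. e' * T t)"
        using elim(1) tf(6) by (intro mult_left_mono sum_mono) auto
      also have "\<dots> = (B * (n * e')) * T t" by simp
      also have "\<dots> \<le> e * T t" using e'(2) T_pos[of t] by (intro mult_right_mono) auto
      finally have "\<bar>(\<integral>\<omega>. f (Prd \<omega> /\<^sub>R t) \<partial>M) - (\<Sum>k=1..n. \<integral>\<omega>. f (Prd \<omega> /\<^sub>R t) * indicator {..L} (W k \<omega>) \<partial>M)\<bar> / T t \<le> e"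
        using T_pos[of t] by (simp add: pos_divide_le_eq)
      then show ?case
        unfolding g_def using T_pos[of t] by (simp add: abs_divide diff_divide_distrib[symmetric] sum_divide_distrib[symmetric])
    qed
  qed
  ultimately show "\<exists>g l. (g \<longlongrightarrow> l) at_top \<and> eventually (\<lambda>t. \<bar>(\<integral>\<omega>. f (Prd \<omega> /\<^sub>R t) \<partial>M) / T t - g t\<bar> \<le> e) at_top \<and>
     \<bar>l - (\<Sum>k=1..n. \<integral>\<omega>. ?ri k \<omega> \<partial>M)\<bar> \<le> e"
    using L1 unfolding dist_real_def by (intro exI conjI) (auto simp: less_imp_le)
qed

text \<open>
  The limit in \<open>directional_limit\<close>; divided by its value at the constant \<open>1\<close> it is the
  integral against the spectral law of the product.
\<close>

definition weighted :: "(real^'n^'n \<Rightarrow> real) \<Rightarrow> real" where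
  "weighted g = (\<Sum>k=1..n. \<integral>\<omega>. N (R k \<omega>) powr \<alpha> * g (dir (R k \<omega>)) \<partial>M)"

lemma integrable_weighted:
  assumes k: "k \<in> {1..n}" and [measurable]: "g \<in> borel_measurable borel" and bd: "\<And>x. \<bar>g x\<bar> \<le> C"
  shows "integrable M (\<lambda>\<omega>. N (R k \<omega>) powr \<alpha> * g (dir (R k \<omega>)))"
proof (rule Bochner_Integration.integrable_bound[OF integrable_mult_right[OF integrable_R[OF k]]])
  have [measurable]: "R k \<in> borel_measurable M" using k by simp
  show "(\<lambda>\<omega>. N (R k \<omega>) powr \<alpha> * g (dir (R k \<omega>))) \<in> borel_measurable M" by measurable
  have "C \<ge> 0" using order_trans[OF abs_ge_zero bd] .
  then show "AE \<omega> in M. norm (N (R k \<omega>) powr \<alpha> * g (dir (R k \<omega>))) \<le> norm (C * N (R k \<omega>) powr \<alpha>)"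
    using bd by (intro AE_I2) (simp add: abs_mult mult.commute[of C] mult_left_mono)
qed

text \<open>
  The indicator of \<open>N x > t\<close> lies between a ramp that starts at \<open>t\<close> and one that ends at
  \<open>t\<close>.  The Pareto integrals of the corresponding ramps for \<open>t = 1\<close> tend to \<open>1\<close> when their
  widths tend to \<open>0\<close>.
\<close>

lemma directional_limit_nonneg:
  assumes g: "continuous_on UNIV g" "\<And>x. 0 \<le> g x" "\<And>x. g x \<le> C"
  shows "((\<lambda>t. (\<integral>\<omega>. g (dir (Prd \<omega>)) * indicator {t<..} (N (Prd \<omega>)) \<partial>M) / T t) \<longlongrightarrow> weighted g) at_top"
proof -
  have [measurable]: "g \<in> borel_measurable borel" by (rule borel_measurable_continuous_onI[OF g(1)])
  let ?Q = "\<lambda>t. (\<integral>\<omega>. g (dir (Prd \<omega>)) * indicator {t<..} (N (Prd \<omega>)) \<partial>M) / T t"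
  let ?F = "\<lambda>a b t. (\<integral>\<omega>. directional_test N g a b (Prd \<omega> /\<^sub>R t) \<partial>M) / T t"
  have w0: "weighted g \<ge> 0" unfolding weighted_def using g(2) by (intro sum_nonneg integral_nonneg_AE) auto
  have lim: "(?F a b \<longlongrightarrow> (\<integral>r. ramp a b r \<partial>pareto \<alpha>) * weighted g) at_top" if "0 < a" "a < b" for a b
    using big_jump_limit[OF directional_test_fun[OF N g that]]
    unfolding radial_integral_directional[OF N \<alpha> that \<open>g \<in> borel_measurable borel\<close>] weighted_def by (simp add: sum_distrib_left)
  have C0: "C \<ge> 0" using order_trans[OF g(2,3)] .
  have iQ: "integrable M (\<lambda>\<omega>. g (dir (Prd \<omega>)) * indicator {t<..} (N (Prd \<omega>)))" for t
    by (intro integrable_const_bound[of _ C]) (use g(2,3) C0 in \<open>auto split: split_indicator\<close>)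
  have iF: "integrable M (\<lambda>\<omega>. directional_test N g a b (Prd \<omega> /\<^sub>R t))" if "0 < a" "a < b" for a b t
  proof -
    note tf = test_funD[OF directional_test_fun[OF N g that]]
    have [measurable]: "directional_test N g a b \<in> borel_measurable borel" by (rule tf)
    show ?thesis by (intro integrable_const_bound[of _ C]) (use tf(4,5) in auto)
  qed
  have dt: "directional_test N g a b (x /\<^sub>R t) = g (x /\<^sub>R N x) * ramp a b (N x / t)" if "t > 0" for a b x t
    using that directional_test_scaleR[OF N, of "inverse t" g a b x] by (simp add: divide_inverse mult.commute)
  have lo: "?F 1 b t \<le> ?Q t" if "1 < b" "t > 0" for b t
  proof (rule divide_right_mono[OF integral_mono])
    fix \<omega>
    show "directional_test N g 1 b (Prd \<omega> /\<^sub>R t) \<le> g (dir (Prd \<omega>)) * indicator {t<..} (N (Prd \<omega>))"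
      unfolding dt[OF that(2)]
      using ramp_props(2,3)[OF that(1), of "N (Prd \<omega>) / t"] g(2) that(2)
      by (intro mult_left_mono) (auto split: split_indicator simp: pos_divide_le_eq)
  qed (use iF iQ that T_pos in \<open>auto simp: less_imp_le\<close>)
  have up: "?Q t \<le> ?F a 1 t" if "0 < a" "a < 1" "t > 0" for a t
  proof (rule divide_right_mono[OF integral_mono])
    fix \<omega>
    show "g (dir (Prd \<omega>)) * indicator {t<..} (N (Prd \<omega>)) \<le> directional_test N g a 1 (Prd \<omega> /\<^sub>R t)"
      unfolding dt[OF that(3)]
      using ramp_props(1,4)[OF that(2), of "N (Prd \<omega>) / t"] g(2) that(3)
      by (intro mult_left_mono) (auto split: split_indicator simp: pos_le_divide_eq)
  qed (use iF iQ that T_pos in \<open>auto simp: less_imp_le\<close>)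
  have cont: "((\<lambda>b. b powr - \<alpha> * weighted g) \<longlongrightarrow> weighted g) (at 1 within X)" for X
    by (rule tendsto_eq_intros refl | simp)+
  show ?thesis
  proof (rule order_tendstoI)
    fix y assume "y < weighted g"
    then have "eventually (\<lambda>b. y < b powr - \<alpha> * weighted g) (at_right 1)"
      by (rule order_tendstoD(1)[OF cont])
    then have "eventually (\<lambda>b. y < b powr - \<alpha> * weighted g \<and> 1 < b) (at_right 1)"
      using eventually_at_right_less by eventually_elim auto
    then obtain b where b: "y < b powr - \<alpha> * weighted g" "1 < b" by (auto dest: eventually_happens)
    note b(1)
    also have "b powr - \<alpha> * weighted g \<le> (\<integral>r. ramp 1 b r \<partial>pareto \<alpha>) * weighted g"
      using pareto_ramp(2)[OF \<alpha> _ b(2)] w0 by (intro mult_right_mono) auto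
    finally have "eventually (\<lambda>t. y < ?F 1 b t) at_top" 
      using b by (intro order_tendstoD(1)[OF lim]) auto
    then show "eventually (\<lambda>t. y < ?Q t) at_top" using eventually_gt_at_top[of 0]
      by eventually_elim (use lo[OF b(2)] in \<open>auto intro: less_le_trans\<close>)
  next
    fix y assume "weighted g < y"
    then have "eventually (\<lambda>a. a powr - \<alpha> * weighted g < y) (at_left 1)"
      by (rule order_tendstoD(2)[OF cont])
    moreover have "eventually (\<lambda>a. a \<in> {0<..<1}) (at_left (1::real))"
      by (rule eventually_at_leftI[of 0]) auto
    ultimately have "eventually (\<lambda>a. a powr - \<alpha> * weighted g < y \<and> a \<in> {0<..<1}) (at_left 1)"
      by eventually_elim auto
    then obtain a where a: "a powr - \<alpha> * weighted g < y" "0 < a" "a < 1" by (auto dest: eventually_happens)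
    have "(\<integral>r. ramp a 1 r \<partial>pareto \<alpha>) * weighted g \<le> a powr - \<alpha> * weighted g"
      using pareto_ramp(3)[OF \<alpha> a(2,3)] w0 by (intro mult_right_mono) auto
    also note a(1)
    finally have "eventually (\<lambda>t. ?F a 1 t < y) at_top" 
      using a by (intro order_tendstoD(2)[OF lim]) auto
    then show "eventually (\<lambda>t. ?Q t < y) at_top" using eventually_gt_at_top[of 0]
      by eventually_elim (use up[OF a(2,3)] in \<open>auto intro: le_less_trans\<close>)
  qed
qed

lemma weighted_1: "weighted (\<lambda>_. 1) = (\<Sum>k=1..n. norm_moment N M \<alpha> (R k))"
  by (simp add: weighted_def norm_moment_def)

theorem tail_limit:
  "((\<lambda>t. tail_prob N M Prd t / T t) \<longlongrightarrow> (\<Sum>k=1..n. norm_moment N M \<alpha> (R k))) at_top"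
proof -
  have "(\<integral>\<omega>. (1::real) * indicator {t<..} (N (Prd \<omega>)) \<partial>M) = tail_prob N M Prd t" for t
  proof -
    have "(\<integral>\<omega>. (1::real) * indicator {t<..} (N (Prd \<omega>)) \<partial>M) = (\<integral>\<omega>. indicator {\<omega>\<in>space M. N (Prd \<omega>) > t} \<omega> \<partial>M)"
      by (intro Bochner_Integration.integral_cong) (auto split: split_indicator)
    then show ?thesis by simp
  qed
  then show ?thesis
    using directional_limit_nonneg[of "\<lambda>_. 1" 1] unfolding weighted_1 by simp
qed

text \<open>
  Adding a constant makes \<open>g\<close> non-negative.
\<close>

theorem directional_limit:
  assumes g: "continuous_on UNIV g" "bounded (range g)"
  shows "((\<lambda>t. (\<integral>\<omega>. g (dir (Prd \<omega>)) * indicator {t<..} (N (Prd \<omega>)) \<partial>M) / T t) \<longlongrightarrow> weighted g) at_top"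
proof -
  have [measurable]: "g \<in> borel_measurable borel" by (rule borel_measurable_continuous_onI[OF g(1)])
  obtain C where C: "\<And>x. \<bar>g x\<bar> \<le> C" using g(2) unfolding bounded_iff by auto
  have C0: "C \<ge> 0" using order_trans[OF abs_ge_zero C] .
  let ?Q = "\<lambda>g t. (\<integral>\<omega>. g (dir (Prd \<omega>)) * indicator {t<..} (N (Prd \<omega>)) \<partial>M) / T t"
  have 1: "(?Q (\<lambda>x. g x + C) \<longlongrightarrow> weighted (\<lambda>x. g x + C)) at_top"
  proof (rule directional_limit_nonneg[of _ "2 * C"])
    show "0 \<le> g x + C" "g x + C \<le> 2 * C" for x using C[of x] by auto
  qed (intro continuous_intros g)
  have 2: "(?Q (\<lambda>x. C) \<longlongrightarrow> weighted (\<lambda>x. C)) at_top"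
    by (rule directional_limit_nonneg[of _ C]) (use C0 in auto)
  have i: "integrable M (\<lambda>\<omega>. h (dir (Prd \<omega>)) * indicator {t<..} (N (Prd \<omega>)))" 
    if [measurable]: "h \<in> borel_measurable borel" and h: "\<And>x. \<bar>h x\<bar> \<le> C" for h :: "_ \<Rightarrow> real" and t
    by (intro integrable_const_bound[of _ C]) (use h C0 in \<open>auto split: split_indicator\<close>)
  have "?Q (\<lambda>x. g x + C) t - ?Q (\<lambda>x. C) t = ?Q g t" for t
    using i[of g t] i[of "\<lambda>_. C" t] C C0 by (simp add: distrib_right add_divide_distrib)
  moreover have "weighted (\<lambda>x. g x + C) - weighted (\<lambda>x. C) = weighted g"
    unfolding weighted_def sum_subtractf[symmetric]
  proof (rule sum.cong[OF refl])
    fix k assume k: "k \<in> {1..n}"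
    show "(\<integral>\<omega>. N (R k \<omega>) powr \<alpha> * (g (dir (R k \<omega>)) + C) \<partial>M) - (\<integral>\<omega>. N (R k \<omega>) powr \<alpha> * C \<partial>M) = 
       (\<integral>\<omega>. N (R k \<omega>) powr \<alpha> * g (dir (R k \<omega>)) \<partial>M)"
      using integrable_weighted[OF k, of g C] integrable_R[OF k] C by (simp add: distrib_left)
  qed
  ultimately show ?thesis using tendsto_diff[OF 1 2] by simp
qed


section \<open>The spectral law of the product\<close>

definition mass :: real where "mass = (\<Sum>k=1..n. norm_moment N M \<alpha> (R k))"

text \<open>
  The mixture over the position \<open>k\<close> of the large factor is realised on the product of the index set
  with the sample space.  The weight vanishes where \<open>R k \<omega> = 0\<close>, so the meaningless direction
  \<open>0\<close> of the zero matrix is not charged.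
\<close>

definition product_spectral :: "(real^'n^'n) measure" where
  "product_spectral = distr
     (density (count_space {1..n} \<Otimes>\<^sub>M M) (\<lambda>(k, \<omega>). ennreal (N (R k \<omega>) powr \<alpha> / mass)))
     borel (\<lambda>(k, \<omega>). dir (R k \<omega>))"

lemma weighted_mass: "weighted (\<lambda>_. 1) = mass"
  by (simp only: weighted_1 mass_def)

lemma norm_moment_nonneg: "norm_moment N M \<alpha> (R k) \<ge> 0"
  unfolding norm_moment_def by (intro integral_nonneg_AE) auto

lemma mass_nonneg: "mass \<ge> 0"
  unfolding mass_def by (intro sum_nonneg norm_moment_nonneg)

lemma sets_product_spectral [simp, measurable_cong]: "sets product_spectral = sets borel"
  by (simp add: product_spectral_def)

lemma measurable_indexed:
  assumes "\<And>k. k \<in> {1..n} \<Longrightarrow> (\<lambda>\<omega>. h (k, \<omega>)) \<in> M \<rightarrow>\<^sub>M K"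
  shows "h \<in> count_space {1..n} \<Otimes>\<^sub>M M \<rightarrow>\<^sub>M K"
  by (rule measurable_pair_measure_countable1) (use assms in auto)

lemma product_spectral_meas:
  "(\<lambda>(k, \<omega>). N (R k \<omega>) powr \<alpha> / mass) \<in> borel_measurable (count_space {1..n} \<Otimes>\<^sub>M M)"
  "(\<lambda>(k, \<omega>). dir (R k \<omega>)) \<in> borel_measurable (count_space {1..n} \<Otimes>\<^sub>M M)"
  by (rule measurable_indexed, simp)+

lemma nn_integral_product_spectral:
  assumes [measurable]: "h \<in> borel_measurable borel"
  shows "(\<integral>\<^sup>+x. h x \<partial>product_spectral) = 
    (\<Sum>k=1..n. \<integral>\<^sup>+\<omega>. ennreal (N (R k \<omega>) powr \<alpha> / mass) * h (dir (R k \<omega>)) \<partial>M)"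
proof -
  have m: "(\<lambda>(k, \<omega>). ennreal (N (R k \<omega>) powr \<alpha> / mass)) \<in> borel_measurable (count_space {1..n} \<Otimes>\<^sub>M M)"
    using measurable_compose[OF product_spectral_meas(1) measurable_ennreal] by (simp add: case_prod_beta)
  have m2: "(\<lambda>p. h (case p of (k, \<omega>) \<Rightarrow> dir (R k \<omega>))) \<in> borel_measurable (count_space {1..n} \<Otimes>\<^sub>M M)"
    by (rule measurable_compose[OF product_spectral_meas(2) assms])
  let ?H = "\<lambda>p. (case p of (k, \<omega>) \<Rightarrow> ennreal (N (R k \<omega>) powr \<alpha> / mass)) * h (case p of (k, \<omega>) \<Rightarrow> dir (R k \<omega>))"
  have "(\<integral>\<^sup>+x. h x \<partial>product_spectral) = (\<integral>\<^sup>+p. ?H p \<partial>(count_space {1..n} \<Otimes>\<^sub>M M))"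
    unfolding product_spectral_def using m m2 product_spectral_meas(2)
    by (subst nn_integral_distr; simp?) (subst nn_integral_density; simp)
  also have "\<dots> = (\<integral>\<^sup>+k. \<integral>\<^sup>+\<omega>. ?H (k, \<omega>) \<partial>M \<partial>count_space {1..n})"
    by (rule nn_integral_fst[symmetric]) (intro borel_measurable_times_ennreal m m2)
  also have "\<dots> = (\<Sum>k=1..n. \<integral>\<^sup>+\<omega>. ?H (k, \<omega>) \<partial>M)"
    by (rule nn_integral_count_space_finite) simp
  finally show ?thesis by simp
qed

lemma integral_product_spectral:
  assumes [measurable]: "g \<in> borel_measurable borel" and nn: "\<And>x. 0 \<le> g x" and bd: "\<And>x. g x \<le> C"
  shows "(\<integral>\<^sup>+x. ennreal (g x) \<partial>product_spectral) = ennreal (weighted g / mass)"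
    and "(\<integral>x. g x \<partial>product_spectral) = weighted g / mass"
proof -
  have w: "ennreal (weighted g / mass) = (\<Sum>k=1..n. ennreal ((\<integral>\<omega>. N (R k \<omega>) powr \<alpha> * g (dir (R k \<omega>)) \<partial>M) / mass))"
    unfolding weighted_def sum_divide_distrib
    by (rule sum_ennreal[symmetric]) (auto intro!: divide_nonneg_nonneg integral_nonneg_AE mass_nonneg simp: nn)
  show 1: "(\<integral>\<^sup>+x. ennreal (g x) \<partial>product_spectral) = ennreal (weighted g / mass)"
    unfolding w
  proof (subst nn_integral_product_spectral, simp, rule sum.cong[OF refl])
    fix k assume k: "k \<in> {1..n}"
    have "(\<integral>\<^sup>+\<omega>. ennreal (N (R k \<omega>) powr \<alpha> / mass) * ennreal (g (dir (R k \<omega>))) \<partial>M) =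
       (\<integral>\<^sup>+\<omega>. ennreal (N (R k \<omega>) powr \<alpha> * g (dir (R k \<omega>)) / mass) \<partial>M)"
      using mass_nonneg nn by (intro nn_integral_cong) (simp add: ennreal_mult'[symmetric])
    also have "\<dots> = ennreal (\<integral>\<omega>. N (R k \<omega>) powr \<alpha> * g (dir (R k \<omega>)) / mass \<partial>M)"
    proof (rule nn_integral_eq_integral)
      show "integrable M (\<lambda>\<omega>. N (R k \<omega>) powr \<alpha> * g (dir (R k \<omega>)) / mass)"
        by (intro integrable_divide_zero integrable_weighted[OF k, of _ C]) (use nn bd in auto)
      show "AE \<omega> in M. 0 \<le> N (R k \<omega>) powr \<alpha> * g (dir (R k \<omega>)) / mass"
        using nn mass_nonneg by (intro AE_I2) auto
    qed
    finally show "(\<integral>\<^sup>+\<omega>. ennreal (N (R k \<omega>) powr \<alpha> / mass) * ennreal (g (dir (R k \<omega>))) \<partial>M) =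
       ennreal ((\<integral>\<omega>. N (R k \<omega>) powr \<alpha> * g (dir (R k \<omega>)) \<partial>M) / mass)" by simp
  qed
  have w0: "weighted g \<ge> 0" unfolding weighted_def using nn by (intro sum_nonneg integral_nonneg_AE) auto
  show "(\<integral>x. g x \<partial>product_spectral) = weighted g / mass"
    by (subst integral_eq_nn_integral) (use nn w0 mass_nonneg in \<open>auto simp: 1\<close>)
qed

lemma prob_space_product_spectral: "mass > 0 \<Longrightarrow> prob_space product_spectral"
  using integral_product_spectral(1)[of "\<lambda>_. 1" 1]
  by (intro prob_spaceI) (simp add: weighted_mass)

lemma measure_product_spectral:
  assumes "B \<in> sets borel"
  shows "measure product_spectral B = weighted (indicator B) / mass"
proof -
  have "measure product_spectral B = (\<integral>x. indicator B x \<partial>product_spectral)" using assms by simp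
  also have "\<dots> = weighted (indicator B) / mass"
    using assms by (intro integral_product_spectral(2)[of _ 1]) (auto split: split_indicator)
  finally show ?thesis .
qed

text \<open>
  The tail of the product is asymptotically a positive constant times that of one factor.
\<close>

lemma regular_tail_product:
  assumes "mass > 0"
  shows "regular_tail \<alpha> (tail_prob N M Prd)"
  unfolding regular_tail_def
proof (intro allI impI)
  fix u :: real assume u: "u > 0"
  let ?TP = "tail_prob N M Prd"
  have lim: "((\<lambda>t. ?TP t / T t) \<longlongrightarrow> mass) at_top" unfolding mass_def by (rule tail_limit)
  have ut: "filterlim (\<lambda>t. u * t) at_top at_top"
    by (rule filterlim_tendsto_pos_mult_at_top[OF tendsto_const u filterlim_ident])
  have lim2: "((\<lambda>t. (?TP (u * t) / T (u * t)) * (T (u * t) / T t) / (?TP t / T t)) \<longlongrightarrow> mass * u powr - \<alpha> / mass) at_top"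
    using assms by (intro tendsto_intros filterlim_compose[OF lim ut] regular_tailD[OF tail_T u] lim) auto
  have eq: "(?TP (u * t) / T (u * t)) * (T (u * t) / T t) / (?TP t / T t) = ?TP (u * t) / ?TP t" for t
    using T_pos[of t] T_pos[of "u * t"] by simp
  show "((\<lambda>t. ?TP (u * t) / ?TP t) \<longlongrightarrow> u powr - \<alpha>) at_top"
    using lim2 assms unfolding eq by simp
qed

text \<open>
  The law of the direction given \<open>N (Prd \<omega>) > t\<close> is a quotient; after division of numerator and
  denominator by \<open>T t\<close>, their limits are \<open>directional_limit\<close> and \<open>tail_limit\<close>.
\<close>

theorem spectral_law_product:
  assumes m: "mass > 0"
  shows "spectral_law N M Prd product_spectral"
proof -
  interpret PS: prob_space product_spectral by (rule prob_space_product_spectral[OF m])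
  let ?TP = "tail_prob N M Prd"
  have TP_pos: "?TP t > 0" for t
    by (rule regular_tail_pos[OF regular_tail_product[OF m] antimono_tail_prob[OF prob_space_axioms N Prd_meas]]) auto
  have "measure product_spectral {x. N x = 1} = 1"
  proof -
    have "measure product_spectral {x. N x = 1} = weighted (indicator {x. N x = 1}) / mass"
      by (rule measure_product_spectral) measurable
    also have "weighted (indicator {x. N x = 1}) = weighted (\<lambda>_. 1)"
      unfolding weighted_def
    proof (intro sum.cong Bochner_Integration.integral_cong refl)
      fix k \<omega>
      show "N (R k \<omega>) powr \<alpha> * indicator {x. N x = 1} (dir (R k \<omega>)) = N (R k \<omega>) powr \<alpha> * 1"
        by (cases "R k \<omega> = 0") (simp_all add: is_norm_zero[OF N] is_norm_normalize[OF N])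
    qed
    finally show ?thesis using m by (simp add: weighted_mass)
  qed
  then have "emeasure product_spectral {x. N x = 1} = 1" by (simp add: PS.emeasure_eq_measure)
  moreover have "weak_conv_filter (cond_direction N M Prd) product_spectral at_top"
    unfolding weak_conv_filter_def
  proof (intro allI impI, elim conjE)
    fix g :: "real^'n^'n \<Rightarrow> real" assume g: "continuous_on UNIV g" "bounded (range g)"
    have [measurable]: "g \<in> borel_measurable borel" by (rule borel_measurable_continuous_onI[OF g(1)])
    obtain C where C: "\<And>x. \<bar>g x\<bar> \<le> C" using g(2) unfolding bounded_iff by auto
    have C0: "C \<ge> 0" using order_trans[OF abs_ge_zero C] .
    have "((\<lambda>t. ((\<integral>\<omega>. g (dir (Prd \<omega>)) * indicator {t<..} (N (Prd \<omega>)) \<partial>M) / T t) / (?TP t / T t)) \<longlongrightarrow> weighted g / mass) at_top"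
      using m unfolding mass_def by (intro tendsto_divide directional_limit g tail_limit) auto
    moreover have "((\<integral>\<omega>. g (dir (Prd \<omega>)) * indicator {t<..} (N (Prd \<omega>)) \<partial>M) / T t) / (?TP t / T t) = (\<integral>x. g x \<partial>cond_direction N M Prd t)" for t
      using T_pos[of t] by (subst integral_cond_direction[OF prob_space_axioms N Prd_meas _ TP_pos]) auto
    moreover have "weighted g / mass = (\<integral>x. g x \<partial>product_spectral)"
    proof -
      have sh: "(\<integral>x. g x + C \<partial>product_spectral) = weighted (\<lambda>x. g x + C) / mass"
      proof (rule integral_product_spectral(2)[of _ "2 * C"])
        show "0 \<le> g x + C" "g x + C \<le> 2 * C" for x using C[of x] by auto
      qed measurable
      have "integrable product_spectral g" using C by (intro PS.integrable_const_bound[of _ C]) auto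
      then have "(\<integral>x. g x + C \<partial>product_spectral) = (\<integral>x. g x \<partial>product_spectral) + C"
        by (simp add: PS.prob_space)
      moreover have "weighted (\<lambda>x. g x + C) = weighted g + C * mass"
      proof -
        have "weighted (\<lambda>x. g x + C) = (\<Sum>k=1..n. (\<integral>\<omega>. N (R k \<omega>) powr \<alpha> * g (dir (R k \<omega>)) \<partial>M) + C * norm_moment N M \<alpha> (R k))"
          unfolding weighted_def norm_moment_def
        proof (rule sum.cong[OF refl])
          fix k assume k: "k \<in> {1..n}"
          show "(\<integral>\<omega>. N (R k \<omega>) powr \<alpha> * (g (dir (R k \<omega>)) + C) \<partial>M) =
             (\<integral>\<omega>. N (R k \<omega>) powr \<alpha> * g (dir (R k \<omega>)) \<partial>M) + C * (\<integral>\<omega>. N (R k \<omega>) powr \<alpha> \<partial>M)"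
            using integrable_weighted[OF k, of g C] integrable_R[OF k] C by (simp add: distrib_left mult.commute)
        qed
        then show ?thesis unfolding weighted_def mass_def by (simp add: sum.distrib sum_distrib_left)
      qed
      ultimately show ?thesis using sh m by (simp add: add_divide_distrib)
    qed
    ultimately show "((\<lambda>t. \<integral>x. g x \<partial>cond_direction N M Prd t) \<longlongrightarrow> (\<integral>x. g x \<partial>product_spectral)) at_top"
      by simp
  qed
  ultimately show ?thesis by (simp add: spectral_law_def PS.prob_space_axioms)
qed

lemma AE_norm_moment_0:
  assumes "k \<in> {1..n}" "norm_moment N M \<alpha> (R k) = 0"
  shows "AE \<omega> in M. N (R k \<omega>) powr \<alpha> = 0"
  using assms(2) unfolding norm_moment_def
  by (subst (asm) integral_nonneg_eq_0_iff_AE[OF integrable_R[OF assms(1)]]) auto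

lemma mass_pos:
  assumes k: "k \<in> {1..n}" and pos: "\<P>(\<omega> in M. N (R k \<omega>) > 0) > 0"
  shows "mass > 0"
proof -
  have [measurable]: "R k \<in> borel_measurable M" using k by simp
  have "norm_moment N M \<alpha> (R k) \<noteq> 0"
  proof
    assume "norm_moment N M \<alpha> (R k) = 0"
    from AE_norm_moment_0[OF k this] have "AE \<omega> in M. \<not> N (R k \<omega>) > 0" by eventually_elim auto
    then have "\<P>(\<omega> in M. N (R k \<omega>) > 0) = 0" by (subst prob_Collect_eq_0) auto
    with pos show False by simp
  qed
  then have "norm_moment N M \<alpha> (R k) > 0" using norm_moment_nonneg[of k] by simp
  also have "norm_moment N M \<alpha> (R k) \<le> mass"
    unfolding mass_def using k norm_moment_nonneg by (intro member_le_sum) auto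
  finally show ?thesis .
qed

text \<open>
  The mixture coefficient cancels the normalising moment.  If that moment is zero, the integrand
  vanishes almost everywhere and both sides are zero.
\<close>

lemma measure_product_spectral_mixture:
  assumes B [measurable]: "B \<in> sets borel"
  shows "measure product_spectral B =
    (\<Sum>k=1..n. (norm_moment N M \<alpha> (R k) / mass) *
       (\<integral>\<omega>. N (R k \<omega>) powr \<alpha> / norm_moment N M \<alpha> (R k) * indicator B (dir (R k \<omega>)) \<partial>M))"
  unfolding measure_product_spectral[OF B] weighted_def sum_divide_distrib
proof (rule sum.cong[OF refl])
  fix k assume k: "k \<in> {1..n}"
  then have [measurable]: "R k \<in> borel_measurable M" by simp
  let ?m = "norm_moment N M \<alpha> (R k)"
  let ?i = "\<integral>\<omega>. N (R k \<omega>) powr \<alpha> * indicator B (dir (R k \<omega>)) \<partial>M"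
  have zero: "?i = 0" if "?m = 0"
  proof -
    from AE_norm_moment_0[OF k that] have "AE \<omega> in M. N (R k \<omega>) powr \<alpha> * indicator B (dir (R k \<omega>)) = 0" by eventually_elim simp
    then show ?thesis by (rule integral_eq_zero_AE)
  qed
  have "(\<integral>\<omega>. N (R k \<omega>) powr \<alpha> / ?m * indicator B (dir (R k \<omega>)) \<partial>M) = ?i / ?m"
    by (simp flip: Bochner_Integration.integral_divide_zero)
  then show "?i / mass = ?m / mass * (\<integral>\<omega>. N (R k \<omega>) powr \<alpha> / ?m * indicator B (dir (R k \<omega>)) \<partial>M)"
    using zero by (cases "?m = 0") auto
qed

end

theorem corollary4p3:
  fixes M :: "'w measure"
    and N :: "real^'n^'n \<Rightarrow> real"
    and A :: "nat \<Rightarrow> 'w \<Rightarrow> real^'n^'n"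
    and A0 :: "'w \<Rightarrow> real^'n^'n"
    and \<theta> :: "nat \<Rightarrow> 'w \<Rightarrow> real^'n^'n"
    and \<mu> S :: "(real^'n^'n) measure"
    and \<alpha> :: real
    and n :: nat
  assumes "prob_space M"
    and "is_norm N"
    and iid: "prob_space.indep_vars M (\<lambda>_. borel) A {1..}"
      "\<forall>i\<ge>1. distr M borel (A i) = distr M borel A0"
    and rv: "regularly_varying N M A0 \<alpha> \<mu>"
    and product_condition:
      "((\<lambda>L. Limsup at_top (\<lambda>t.
           ereal (\<P>(\<omega> in M. N (A 1 \<omega>) * N (A 2 \<omega>) > t \<and> L < N (A 1 \<omega>) \<and> N (A 1 \<omega>) \<le> t / L)
                  / \<P>(\<omega> in M. N (A0 \<omega>) > t)))) \<longlongrightarrow> 0) (at_top :: real filter)"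
    and spectral: "spectral_law N M A0 S"
    and theta_copies: "\<forall>k\<ge>1. distr M borel (\<theta> k) = S"
    and theta_indep: "\<forall>k\<ge>1. prob_space.indep_vars M (\<lambda>_. borel)
           (\<lambda>i. if i = 0 then \<theta> k else A i) UNIV"
    and "n \<ge> 2"
  shows
    "(\<forall>k\<in>{1..n}. integrable M (\<lambda>\<omega>. N (repl_prod A \<theta> n k \<omega>) powr \<alpha>)) \<and>
     ((\<lambda>t. \<P>(\<omega> in M. N (mat_prod (\<lambda>i. A i \<omega>) 1 n) > t) / \<P>(\<omega> in M. N (A0 \<omega>) > t))
        \<longlongrightarrow> (\<Sum>k=1..n. norm_moment N M \<alpha> (repl_prod A \<theta> n k))) at_top \<and>
     ((\<exists>k\<in>{1..n}. \<P>(\<omega> in M. N (repl_prod A \<theta> n k \<omega>) > 0) > 0) \<longrightarrow>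
        (\<exists>\<mu>'. regularly_varying N M (\<lambda>\<omega>. mat_prod (\<lambda>i. A i \<omega>) 1 n) \<alpha> \<mu>') \<and>
        (\<exists>S'. spectral_law N M (\<lambda>\<omega>. mat_prod (\<lambda>i. A i \<omega>) 1 n) S' \<and>
           (\<forall>B\<in>sets borel. measure S' B =
              (\<Sum>k=1..n.
                 (norm_moment N M \<alpha> (repl_prod A \<theta> n k)
                    / (\<Sum>j=1..n. norm_moment N M \<alpha> (repl_prod A \<theta> n j))) *
                 (\<integral>\<omega>. N (repl_prod A \<theta> n k \<omega>) powr \<alpha>
                        / norm_moment N M \<alpha> (repl_prod A \<theta> n k)
                      * indicator B (repl_prod A \<theta> n k \<omega> /\<^sub>R N (repl_prod A \<theta> n k \<omega>)) \<partial>M)))))"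
proof -
  interpret prob_space M by fact
  interpret matrix_factors M N A A0 \<theta> S \<alpha> n
  proof (unfold_locales)
    show "A0 \<in> borel_measurable M" "\<alpha> > 0" using rv by (auto simp: regularly_varying_def)
    show "regular_tail \<alpha> (tail_prob N M A0)"
      by (rule regularly_varying_imp_regular_tail[OF assms(1,2) rv])
  qed (use assms in auto)
  have Prd: "(\<lambda>\<omega>. mat_prod (\<lambda>i. A i \<omega>) 1 n) = Prd" by (simp add: Prd_def[abs_def])
  have lim: "((\<lambda>t. tail_prob N M Prd t / tail_prob N M A0 t) \<longlongrightarrow> (\<Sum>k=1..n. norm_moment N M \<alpha> (repl_prod A \<theta> n k))) at_top"
    using tail_limit by (simp add: T_def)
  have "(\<exists>\<mu>'. regularly_varying N M Prd \<alpha> \<mu>') \<and>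
        (\<exists>S'. spectral_law N M Prd S' \<and>
           (\<forall>B\<in>sets borel. measure S' B =
              (\<Sum>k=1..n. (norm_moment N M \<alpha> (repl_prod A \<theta> n k) / mass) *
                 (\<integral>\<omega>. N (repl_prod A \<theta> n k \<omega>) powr \<alpha> / norm_moment N M \<alpha> (repl_prod A \<theta> n k)
                      * indicator B (repl_prod A \<theta> n k \<omega> /\<^sub>R N (repl_prod A \<theta> n k \<omega>)) \<partial>M))))"
    if "\<exists>k\<in>{1..n}. \<P>(\<omega> in M. N (repl_prod A \<theta> n k \<omega>) > 0) > 0"
  proof -
    have m: "mass > 0" using that mass_pos by blast
    have "regularly_varying N M Prd \<alpha> (polar_measure \<alpha> product_spectral)"
      by (rule polar_imp_regularly_varying[OF assms(1,2) Prd_meas \<alpha> regular_tail_product[OF m] spectral_law_product[OF m]])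
    then show ?thesis using spectral_law_product[OF m] measure_product_spectral_mixture by blast
  qed
  then show ?thesis
    using integrable_R lim unfolding Prd mass_def by (auto simp: Prd_def)
qed

end
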